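(* Consider the LPSA iterates described in the context with $\eta_n=\eta_0n^{-\alpha}$, $p_n=\min\{\gamma\eta_n^\beta,1\}$, where $\gamma>0$, $0<\alpha\le1$, $\beta\in(1/2,1)$ and $\eta_0>2\cdot\mathbb{1}_{\{\alpha=1\}}/\mu$ (and $\eta_0>0$). Assume: $\|\nabla f(x)-\nabla f(y)\|\le L\|x-y\|$ for all $x,y$; $f$ is $\mu$-strongly convex, $\mu>0$; and $\|\Sigma(x)-\Sigma(y)\|\le L\|x-y\|$ for all $x,y$. Then the sequence of càdlàg processes $\bar v^{(n)}$ defined in the context is tight (with respect to the Skorokhod topology on finite time intervals).
   Context: Setting (LPSA, loopless projected stochastic approximation). Let $A$ be a real matrix with $d$ rows; $P_A$ is the orthogonal projection of $\mathbb{R}^d$ onto the column space of $A$, and $P_{A^\perp}=I_d-P_A$ the orthogonal projection onto the null space of $A^\top$. Let $\mathcal D$ be a probability distribution, $f(x)=\mathbb{E}_{\zeta\sim\mathcal D}f(x,\zeta)$, with $\mathbb{E}_{\zeta\sim\mathcal D}\nabla f(x,\zeta)=\nabla f(x)$ (gradients in $x$). Let $x^\star$ be the unique minimizer of $f$ over $\{x\in\mathbb{R}^d: A^\top x=0\}$; standing assumption: $\nabla f(x^\star)\ne 0$. Starting from a deterministic point $x_1$, for $n\ge 1$ sample $\zeta_n\sim\mathcal D$ and $\omega_n\sim\mathrm{Bernoulli}(p_n)$ (all independent), set $x_{n+1/2}=x_n-\eta_n\nabla f(x_n,\zeta_n)$, and set $x_{n+1}=P_{A^\perp}x_{n+1/2}$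 if $\omega_n=1$, $x_{n+1}=x_{n+1/2}$ if $\omega_n=0$. The gradient noise is $\xi_n=\nabla f(x_n)-\nabla f(x_n,\zeta_n)$, a martingale difference with respect to $\mathcal F_n=\sigma(\zeta_k,\omega_k:k<n)$, and $\mathbb{E}[\xi_n\xi_n^\top\mid\mathcal F_n]=\Sigma(x_n)$, where $\Sigma(x)$ is the covariance matrix of $\nabla f(x,\zeta)$, $\zeta\sim\mathcal D$. $\|\cdot\|$ is the Euclidean norm for vectors and the spectral norm for matrices. Interpolation. Let $v_n=P_Ax_n$, $\check v_n=\eta_{n-1}^{\beta-1}v_n$, $\check v_{(n+1)-}=\eta_n^{\beta-1}P_Ax_{n+1/2}$ (so $\check v_{n+1}=\check v_{(n+1)-}$ if $\omega_n=0$ and $\check v_{n+1}=0$ if $\omega_n=1$), $\xi_n^{(2)}=P_A\xi_n$, and define $d_n$ by $\check v_{(n+1)-}=\check v_n-\eta_n^\beta d_n+\eta_n^\beta\xi_n^{(2)}$. For $n\ge1,t\ge0$ let $N(n,t)=\min\{m\ge n:\sum_{k=n}^m\eta_k^\beta>t\}$, $\Gamma_n=\sum_{k=1}^{n-1}\eta_k^\beta$, $\underline t_n=\Gamma_{N(n,t)}-\Gamma_n$, and $$\bar v^{(n)}_t=\check v_{N(n,t)}-(t-\underline t_n)\big(d_{N(n,t)}-\xi^{(2)}_{N(n,t)}\big).$$ *)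

theory Defs
  imports "HOL-Probability.Probability"
begin

section \<open>The Skorokhod space on a compact interval\<close>

text \<open>
  A path on \<open>[0,T]\<close> is a function on the reals that is \<open>undefined\<close> outside \<open>[0,T]\<close>, so
  that equality of paths is equality on \<open>[0,T]\<close>.
\<close>

definition cadlag_paths :: "real \<Rightarrow> (real \<Rightarrow> 'a::metric_space) set" where
  "cadlag_paths T = {x \<in> extensional {0..T}.
     (\<forall>t\<in>{0..<T}. (x \<longlongrightarrow> x t) (at_right t)) \<and>
     (\<forall>t\<in>{0<..T}. \<exists>l. (x \<longlongrightarrow> l) (at_left t))}"

definition time_changes :: "real \<Rightarrow> (real \<Rightarrow> real) set" where
  "time_changes T =
     {l. strict_mono_on {0..T} l \<and> continuous_on {0..T} l \<and> l ` {0..T} = {0..T}}"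

definition skorokhod_close ::
  "real \<Rightarrow> (real \<Rightarrow> 'a::metric_space) \<Rightarrow> (real \<Rightarrow> 'a) \<Rightarrow> real \<Rightarrow> bool" where
  "skorokhod_close T x y e \<longleftrightarrow>
     (\<exists>l\<in>time_changes T. \<forall>t\<in>{0..T}. \<bar>l t - t\<bar> \<le> e \<and> dist (x t) (y (l t)) \<le> e)"

text \<open>
  Billingsley's first metric for the Skorokhod \<open>J\<^sub>1\<close> topology. The value outside the path
  space is irrelevant; it is 0 because \<^locale>\<open>Metric_space\<close> asks for nonnegativity and
  symmetry on the whole type.
\<close>

definition skorokhod_dist ::
  "real \<Rightarrow> (real \<Rightarrow> 'a::metric_space) \<Rightarrow> (real \<Rightarrow> 'a) \<Rightarrow> real" where
  "skorokhod_dist T x y =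
     (if x \<in> cadlag_paths T \<and> y \<in> cadlag_paths T
      then Inf {e. 0 < e \<and> skorokhod_close T x y e} else 0)"

definition skorokhod_topology :: "real \<Rightarrow> (real \<Rightarrow> 'a::metric_space) topology" where
  "skorokhod_topology T = Metric_space.mtopology (cadlag_paths T) (skorokhod_dist T)"

lemma time_changes_id: "(\<lambda>t. t) \<in> time_changes T"
  by (auto simp: time_changes_def strict_mono_on_def)

lemma time_changes_comp:
  assumes "l \<in> time_changes T" "m \<in> time_changes T"
  shows "(\<lambda>t. m (l t)) \<in> time_changes T"
proof -
  have "strict_mono_on {0..T} (\<lambda>t. m (l t))"
    using assms unfolding time_changes_def strict_mono_on_def by blast
  moreover have "continuous_on {0..T} (\<lambda>t. m (l t))"
    using assms continuous_on_compose2[of "{0..T}" m "{0..T}" l]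
    unfolding time_changes_def by blast
  moreover have "(\<lambda>t. m (l t)) ` {0..T} = {0..T}"
    using assms unfolding time_changes_def by (metis (mono_tags, lifting) image_image mem_Collect_eq)
  ultimately show ?thesis by (simp add: time_changes_def)
qed

lemma time_changes_inverse:
  assumes "l \<in> time_changes T"
  shows "inv_into {0..T} l \<in> time_changes T"
proof -
  have mono: "strict_mono_on {0..T} l" and cont: "continuous_on {0..T} l"
    and im: "l ` {0..T} = {0..T}"
    using assms by (auto simp: time_changes_def)
  have inj: "inj_on l {0..T}"
    using mono by (rule strict_mono_on_imp_inj_on)
  have "strict_mono_on {0..T} (inv_into {0..T} l)"
  proof (rule strict_mono_onI)
    fix r s assume rs: "r \<in> {0..T}" "s \<in> {0..T}" "r < s"
    let ?a = "inv_into {0..T} l r" and ?b = "inv_into {0..T} l s"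
    have ab: "?a \<in> {0..T}" "?b \<in> {0..T}" "l ?a = r" "l ?b = s"
      using rs im by (metis inv_into_into, metis inv_into_into, metis f_inv_into_f, metis f_inv_into_f)
    show "?a < ?b"
    proof (rule ccontr)
      assume "\<not> ?a < ?b"
      then have "l ?b \<le> l ?a"
        using ab mono by (metis linorder_not_less nless_le strict_mono_onD)
      then show False using ab rs by simp
    qed
  qed
  moreover have "continuous_on (l ` {0..T}) (inv_into {0..T} l)"
    by (rule continuous_on_inv[OF cont]) (auto simp: inj)
  moreover have "inv_into {0..T} l ` {0..T} = {0..T}"
    using inj im by (metis inv_into_image_cancel order_refl)
  ultimately show ?thesis using im by (simp add: time_changes_def)
qed

lemma time_changes_end:
  assumes "l \<in> time_changes T" "0 \<le> T"
  shows "l T = T"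
proof -
  have mono: "strict_mono_on {0..T} l" and im: "l ` {0..T} = {0..T}"
    using assms by (auto simp: time_changes_def)
  obtain u where u: "u \<in> {0..T}" "l u = T"
    using im assms(2) by (metis atLeastAtMost_iff imageE order_refl)
  have "l T \<in> {0..T}" using im assms(2) by (metis atLeastAtMost_iff imageI order_refl)
  moreover have "l u \<le> l T"
    using u mono assms(2) by (metis atLeastAtMost_iff less_eq_real_def order_refl strict_mono_onD)
  ultimately show ?thesis using u by simp
qed

lemma skorokhod_close_sym:
  assumes "skorokhod_close T x y e"
  shows "skorokhod_close T y x e"
proof -
  obtain l where l: "l \<in> time_changes T"
    and le: "\<And>t. t \<in> {0..T} \<Longrightarrow> \<bar>l t - t\<bar> \<le> e \<and> dist (x t) (y (l t)) \<le> e"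
    using assms by (auto simp: skorokhod_close_def)
  have im: "l ` {0..T} = {0..T}" using l by (simp add: time_changes_def)
  have "\<bar>inv_into {0..T} l t - t\<bar> \<le> e \<and> dist (y t) (x (inv_into {0..T} l t)) \<le> e"
    if t: "t \<in> {0..T}" for t
  proof -
    have "inv_into {0..T} l t \<in> {0..T}" "l (inv_into {0..T} l t) = t"
      using t im by (metis inv_into_into, metis f_inv_into_f)
    then show ?thesis using le[of "inv_into {0..T} l t"] by (simp add: dist_commute abs_minus_commute)
  qed
  then show ?thesis
    unfolding skorokhod_close_def by (intro bexI[OF _ time_changes_inverse[OF l]] ballI)
qed

lemma skorokhod_close_trans:
  assumes "skorokhod_close T x y a" "skorokhod_close T y z b"
  shows "skorokhod_close T x z (a + b)"
proof -
  obtain l m where l: "l \<in> time_changes T" and m: "m \<in> time_changes T"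
    and la: "\<And>t. t \<in> {0..T} \<Longrightarrow> \<bar>l t - t\<bar> \<le> a \<and> dist (x t) (y (l t)) \<le> a"
    and mb: "\<And>t. t \<in> {0..T} \<Longrightarrow> \<bar>m t - t\<bar> \<le> b \<and> dist (y t) (z (m t)) \<le> b"
    using assms by (auto simp: skorokhod_close_def)
  have "\<bar>m (l t) - t\<bar> \<le> a + b \<and> dist (x t) (z (m (l t))) \<le> a + b" if t: "t \<in> {0..T}" for t
  proof -
    have "l t \<in> {0..T}" using l t by (auto simp: time_changes_def)
    then show ?thesis
      using la[OF t] mb[of "l t"] dist_triangle[of "x t" "z (m (l t))" "y (l t)"] by linarith
  qed
  then show ?thesis
    unfolding skorokhod_close_def by (intro bexI[OF _ time_changes_comp[OF l m]] ballI)
qed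

lemma cadlag_paths_bounded:
  assumes x: "x \<in> cadlag_paths T"
  shows "bounded (x ` {0..T})"
proof -
  have "\<exists>U. open U \<and> t \<in> U \<and> bounded (x ` (U \<inter> {0..T}))" if t: "t \<in> {0..T}" for t
  proof -
    have r: "\<exists>b>t. bounded (x ` ({t<..<b} \<inter> {0..T}))"
    proof (cases "t < T")
      case True
      then have "(x \<longlongrightarrow> x t) (at_right t)" using x t by (auto simp: cadlag_paths_def)
      then have "eventually (\<lambda>s. dist (x s) (x t) < 1) (at_right t)"
        by (rule tendstoD) simp
      then obtain b where "b > t" "\<And>s. t < s \<Longrightarrow> s < b \<Longrightarrow> dist (x s) (x t) < 1"
        by (auto simp: eventually_at_right_field)
      then have "x ` ({t<..<b} \<inter> {0..T}) \<subseteq> ball (x t) 1" by (auto simp: dist_commute)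
      then show ?thesis using \<open>b > t\<close> bounded_subset[OF bounded_ball] by blast
    next
      case False
      then have "x ` ({t<..<t+1} \<inter> {0..T}) = {}" using t by auto
      then show ?thesis by (metis bounded_empty less_add_one)
    qed
    have l: "\<exists>a<t. bounded (x ` ({a<..<t} \<inter> {0..T}))"
    proof (cases "0 < t")
      case True
      then have "t \<in> {0<..T}" using t by simp
      then obtain l where "(x \<longlongrightarrow> l) (at_left t)"
        using x unfolding cadlag_paths_def by blast
      then have "eventually (\<lambda>s. dist (x s) l < 1) (at_left t)"
        by (rule tendstoD) simp
      then obtain a where "a < t" "\<And>s. a < s \<Longrightarrow> s < t \<Longrightarrow> dist (x s) l < 1"
        by (auto simp: eventually_at_left_field)
      then have "x ` ({a<..<t} \<inter> {0..T}) \<subseteq> ball l 1" by (auto simp: dist_commute)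
      then show ?thesis using \<open>a < t\<close> bounded_subset[OF bounded_ball] by blast
    next
      case False
      then have "x ` ({t - 1<..<t} \<inter> {0..T}) = {}" using t by auto
      then show ?thesis by (metis bounded_empty diff_less_eq less_add_one)
    qed
    obtain a b where ab: "a < t" "t < b" "bounded (x ` ({t<..<b} \<inter> {0..T}))"
      "bounded (x ` ({a<..<t} \<inter> {0..T}))"
      using l r by blast
    have "x ` ({a<..<b} \<inter> {0..T}) \<subseteq>
        insert (x t) (x ` ({t<..<b} \<inter> {0..T}) \<union> x ` ({a<..<t} \<inter> {0..T}))"
    proof
      fix v assume "v \<in> x ` ({a<..<b} \<inter> {0..T})"
      then obtain s where s: "v = x s" "a < s" "s < b" "s \<in> {0..T}" by auto
      then show "v \<in> insert (x t) (x ` ({t<..<b} \<inter> {0..T}) \<union> x ` ({a<..<t} \<inter> {0..T}))"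
        by (cases s t rule: linorder_cases) auto
    qed
    then have "bounded (x ` ({a<..<b} \<inter> {0..T}))"
      using ab by (meson bounded_Un bounded_insert bounded_subset)
    then show ?thesis using ab by (intro exI[of _ "{a<..<b}"]) auto
  qed
  then obtain U where U: "\<And>t. t \<in> {0..T} \<Longrightarrow> open (U t) \<and> t \<in> U t \<and> bounded (x ` (U t \<inter> {0..T}))"
    by metis
  have cov: "{0..T} \<subseteq> (\<Union>t\<in>{0..T}. U t)" using U by blast
  obtain C where C: "C \<subseteq> {0..T}" "finite C" "{0..T} \<subseteq> (\<Union>t\<in>C. U t)"
  proof (rule compactE_image[OF compact_Icc _ cov])
    show "open (U t)" if "t \<in> {0..T}" for t using U that by blast
  qed
  have "bounded (\<Union>t\<in>C. x ` (U t \<inter> {0..T}))"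
    using C U by (intro bounded_UN) auto
  moreover have "x ` {0..T} \<subseteq> (\<Union>t\<in>C. x ` (U t \<inter> {0..T}))" using C(3) by blast
  ultimately show ?thesis by (rule bounded_subset)
qed

lemma skorokhod_close_exists:
  assumes "x \<in> cadlag_paths T" "y \<in> cadlag_paths T"
  shows "\<exists>e>0. skorokhod_close T x y e"
proof -
  have "bounded (x ` {0..T} \<union> y ` {0..T})"
    using assms cadlag_paths_bounded by (simp add: cadlag_paths_bounded)
  then obtain e where e: "\<And>u v. u \<in> x ` {0..T} \<Longrightarrow> v \<in> y ` {0..T} \<Longrightarrow> dist u v \<le> e"
    using bounded_two_points by (metis UnCI)
  have "skorokhod_close T x y (max e 1)"
    unfolding skorokhod_close_def
    by (intro bexI[OF _ time_changes_id] ballI) (simp add: e le_max_iff_disj)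
  then show ?thesis by (intro exI[of _ "max e 1"]) simp
qed

lemma skorokhod_dist_less:
  assumes "x \<in> cadlag_paths T" "y \<in> cadlag_paths T" "skorokhod_dist T x y < r"
  obtains e where "0 < e" "e < r" "skorokhod_close T x y e"
proof -
  let ?S = "{e. 0 < e \<and> skorokhod_close T x y e}"
  have "?S \<noteq> {}" using skorokhod_close_exists[OF assms(1,2)] by blast
  moreover have "Inf ?S < r" using assms by (simp add: skorokhod_dist_def)
  ultimately have "\<exists>e\<in>?S. e < r" by (rule cInf_lessD)
  then obtain e where "e \<in> ?S" "e < r" by (rule bexE)
  then show thesis using that by blast
qed

lemma skorokhod_dist_le:
  assumes "x \<in> cadlag_paths T" "y \<in> cadlag_paths T" "0 < e" "skorokhod_close T x y e"
  shows "skorokhod_dist T x y \<le> e"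
proof -
  have "bdd_below {e. 0 < e \<and> skorokhod_close T x y e}"
    by (rule bdd_belowI[of _ 0]) auto
  then show ?thesis using assms by (auto simp: skorokhod_dist_def intro!: cInf_lower)
qed

lemma Metric_space_skorokhod:
  assumes T: "0 < T"
  shows "Metric_space (cadlag_paths T :: (real \<Rightarrow> 'a::metric_space) set) (skorokhod_dist T)"
proof
  fix x y :: "real \<Rightarrow> 'a"
  show nn: "0 \<le> skorokhod_dist T x y"
  proof (cases "x \<in> cadlag_paths T \<and> y \<in> cadlag_paths T")
    case True
    then have "{e. 0 < e \<and> skorokhod_close T x y e} \<noteq> {}"
      using skorokhod_close_exists by blast
    then have "0 \<le> Inf {e. 0 < e \<and> skorokhod_close T x y e}"
      by (rule cInf_greatest) simp
    then show ?thesis using True by (simp add: skorokhod_dist_def)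
  next
    case False
    then show ?thesis by (simp only: skorokhod_dist_def if_False order_refl)
  qed
  show "skorokhod_dist T x y = skorokhod_dist T y x"
  proof -
    have "skorokhod_close T x y = skorokhod_close T y x"
      by (intro ext iffI; erule skorokhod_close_sym)
    then show ?thesis by (simp add: skorokhod_dist_def conj_commute)
  qed
  assume x: "x \<in> cadlag_paths T" and y: "y \<in> cadlag_paths T"
  show "skorokhod_dist T x y = 0 \<longleftrightarrow> x = y"
  proof
    assume "x = y"
    then have "skorokhod_close T x y e" if "0 < e" for e
      using that unfolding skorokhod_close_def
      by (intro bexI[OF _ time_changes_id]) simp
    then have "skorokhod_dist T x y \<le> 0 + e" if "0 < e" for e
      using that skorokhod_dist_le[OF x y] by simp
    then have "skorokhod_dist T x y \<le> 0" by (rule field_le_epsilon)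
    then show "skorokhod_dist T x y = 0" using nn by simp
  next
    assume "skorokhod_dist T x y = 0"
    then have small: "\<exists>e<r. skorokhod_close T x y e" if "0 < r" for r
    proof -
      have "skorokhod_dist T x y < r" using \<open>skorokhod_dist T x y = 0\<close> that by simp
      then show ?thesis by (rule skorokhod_dist_less[OF x y]) blast
    qed
    have "x t = y t" if t: "t \<in> {0..T}" for t
    proof (rule ccontr)
      assume ne: "x t \<noteq> y t"
      define r where "r = dist (x t) (y t) / 3"
      have r: "0 < r" using ne by (simp add: r_def)
      show False
      proof (cases "t = T")
        case True
        obtain e l where el: "e < r" "l \<in> time_changes T" "dist (x T) (y (l T)) \<le> e"
        proof -
          obtain e where "e < r" "skorokhod_close T x y e" using small[OF r] by blast
          moreover have "T \<in> {0..T}" using T by simp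
          ultimately show thesis using that unfolding skorokhod_close_def by blast
        qed
        then have "dist (x t) (y t) < r" using time_changes_end[OF el(2)] T True by simp
        then show False using r unfolding r_def by linarith
      next
        case False
        then have t': "t \<in> {0..<T}" using t by auto
        then have "(x \<longlongrightarrow> x t) (at_right t)" "(y \<longlongrightarrow> y t) (at_right t)"
          using x y by (auto simp: cadlag_paths_def)
        then have "eventually (\<lambda>s. dist (x s) (x t) < r \<and> dist (y s) (y t) < r) (at_right t)"
          using r by (intro eventually_conj tendstoD)
        then obtain b where b: "t < b"
            "\<And>s. t < s \<Longrightarrow> s < b \<Longrightarrow> dist (x s) (x t) < r \<and> dist (y s) (y t) < r"
          by (auto simp: eventually_at_right_field)
        define h where "h = (min b T - t) / 2"
        have h: "0 < h" "t + 2 * h \<le> b" "t + h \<le> T"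
          using b(1) t' by (auto simp: h_def min_def field_simps)
        obtain e l where el: "e < min r h" "\<bar>l (t + h) - (t + h)\<bar> \<le> e"
            "dist (x (t + h)) (y (l (t + h))) \<le> e"
        proof -
          have "0 < min r h" using r h by simp
          then obtain e where "e < min r h" "skorokhod_close T x y e" using small by blast
          moreover have "t + h \<in> {0..T}" using t h by simp
          ultimately show thesis using that unfolding skorokhod_close_def by blast
        qed
        have "dist (x (t + h)) (x t) < r" "dist (y (l (t + h))) (y t) < r"
          using b(2)[of "t + h"] b(2)[of "l (t + h)"] h el by auto
        then have "dist (x t) (y t) < 3 * r"
          using el dist_triangle[of "x t" "y t" "x (t + h)"]
            dist_triangle[of "x (t + h)" "y t" "y (l (t + h))"]
          by (simp add: dist_commute)
        then show False by (simp add: r_def)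
      qed
    qed
    moreover have "x \<in> extensional {0..T}" "y \<in> extensional {0..T}"
      using x y by (simp_all add: cadlag_paths_def)
    ultimately show "x = y" by (intro extensionalityI)
  qed
next
  fix x y z :: "real \<Rightarrow> 'a"
  assume x: "x \<in> cadlag_paths T" and y: "y \<in> cadlag_paths T" and z: "z \<in> cadlag_paths T"
  show "skorokhod_dist T x z \<le> skorokhod_dist T x y + skorokhod_dist T y z"
  proof (rule field_le_epsilon)
    fix e :: real assume e: "0 < e"
    obtain a where a: "0 < a" "a < skorokhod_dist T x y + e / 2" "skorokhod_close T x y a"
      using skorokhod_dist_less[OF x y, of "skorokhod_dist T x y + e / 2"] e by auto
    obtain b where b: "0 < b" "b < skorokhod_dist T y z + e / 2" "skorokhod_close T y z b"
      using skorokhod_dist_less[OF y z, of "skorokhod_dist T y z + e / 2"] e by auto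
    have "skorokhod_dist T x z \<le> a + b"
      using skorokhod_dist_le[OF x z] skorokhod_close_trans[OF a(3) b(3)] a b by simp
    then show "skorokhod_dist T x z \<le> skorokhod_dist T x y + skorokhod_dist T y z + e"
      using a b by simp
  qed
qed


section \<open>Tightness\<close>

definition borel_sigma :: "'a topology \<Rightarrow> 'a measure" where
  "borel_sigma X = sigma (topspace X) {U. openin X U}"

text \<open>
  Tightness of random elements \<open>Y\<^sub>i\<close>, \<open>i \<in> I\<close>, of a Hausdorff space \<open>X\<close>. Measurability
  is required explicitly because \<^const>\<open>distr\<close> has no meaning for a nonmeasurable map;
  compact sets are closed, hence Borel.
\<close>

definition tight_random_elements ::
  "'w measure \<Rightarrow> 'a topology \<Rightarrow> ('i \<Rightarrow> 'w \<Rightarrow> 'a) \<Rightarrow> 'i set \<Rightarrow> bool" where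
  "tight_random_elements M X Y I \<longleftrightarrow>
     (\<forall>i\<in>I. Y i \<in> M \<rightarrow>\<^sub>M borel_sigma X) \<and>
     (\<forall>\<epsilon>>0. \<exists>K. compactin X K \<and>
        (\<forall>i\<in>I. 1 - \<epsilon> \<le> measure (distr M (borel_sigma X) (Y i)) K))"


section \<open>Linear algebra, covariance and convexity\<close>

definition orthogonal_projection :: "'a::real_inner set \<Rightarrow> 'a \<Rightarrow> 'a" where
  "orthogonal_projection S x = (THE y. y \<in> S \<and> (\<forall>z\<in>S. orthogonal (x - y) z))"

definition covariance_matrix :: "'z measure \<Rightarrow> ('z \<Rightarrow> real ^ 'd) \<Rightarrow> real ^ 'd ^ 'd" where
  "covariance_matrix D X = (\<chi> i j. \<integral>z. (X z - (\<integral>u. X u \<partial>D)) $ i * (X z - (\<integral>u. X u \<partial>D)) $ j \<partial>D)"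

definition spectral_norm :: "real ^ 'n ^ 'm \<Rightarrow> real" where
  "spectral_norm B = onorm (\<lambda>u. B *v u)"

definition strongly_convex :: "real \<Rightarrow> ('a::real_normed_vector \<Rightarrow> real) \<Rightarrow> bool" where
  "strongly_convex \<mu> f \<longleftrightarrow> (\<forall>x y. \<forall>t\<in>{0..1}.
     f ((1 - t) *\<^sub>R x + t *\<^sub>R y) \<le> (1 - t) * f x + t * f y - \<mu> / 2 * t * (1 - t) * (norm (x - y))\<^sup>2)"


section \<open>Loopless projected stochastic approximation\<close>

text \<open>
  \<open>F x z\<close> is the stochastic objective, \<open>dF x z\<close> its gradient in \<open>x\<close>, and \<open>df\<close> the gradient of
  the mean objective \<open>f\<close>. \<open>M\<close> is the sample space of the algorithm and \<open>D\<close> the data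
  distribution. Finiteness of the second moment of \<open>dF x\<close> is what existence of the covariance
  matrix means. The family of all \<open>\<zeta>\<^sub>n\<close> and all \<open>\<omega>\<^sub>n\<close>, \<open>n \<ge> 1\<close>, is mutually
  independent; as the two kinds of variables differ in type, this is expressed through the
  generated sigma-algebras, indexed by a disjoint sum.

  The initial point \<open>x1\<close>, the step sizes \<open>\<eta>\<close> and the exponent \<open>\<beta>\<close> carry no assumptions, so they
  are arguments of the definitions below but not of the locale predicate. The value \<open>\<eta> 0\<close> enters
  only through \<open>vcheck 1\<close>; it is the constant \<open>\<eta>\<^sub>0\<close> of the step sizes \<open>\<eta>\<^sub>0 n\<^sup>-\<^sup>\<alpha>\<close>.
\<close>

locale lpsa = sample: prob_space M + data: prob_space D
  for M :: "'w measure" and D :: "'z measure" +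
  fixes A :: "real ^ 'm ^ 'd"
    and F :: "real ^ 'd \<Rightarrow> 'z \<Rightarrow> real" and dF :: "real ^ 'd \<Rightarrow> 'z \<Rightarrow> real ^ 'd"
    and f :: "real ^ 'd \<Rightarrow> real" and df :: "real ^ 'd \<Rightarrow> real ^ 'd"
    and xstar x1 :: "real ^ 'd"
    and \<eta> p :: "nat \<Rightarrow> real" and \<beta> :: real
    and \<zeta> :: "nat \<Rightarrow> 'w \<Rightarrow> 'z" and \<omega> :: "nat \<Rightarrow> 'w \<Rightarrow> bool"
  assumes F_integrable: "\<And>x. integrable D (F x)"
    and f_eq: "\<And>x. f x = (\<integral>z. F x z \<partial>D)"
    and F_gradient: "\<And>x z. z \<in> space D \<Longrightarrow> GDERIV (\<lambda>y. F y z) x :> dF x z"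
    and f_gradient: "\<And>x. GDERIV f x :> df x"
    and dF_integrable: "\<And>x. integrable D (dF x)"
    and dF_mean: "\<And>x. (\<integral>z. dF x z \<partial>D) = df x"
    and dF_square_integrable: "\<And>x. integrable D (\<lambda>z. (norm (dF x z))\<^sup>2)"
    and xstar_feasible: "transpose A *v xstar = 0"
    and xstar_unique_minimizer: "\<And>x. transpose A *v x = 0 \<Longrightarrow> x \<noteq> xstar \<Longrightarrow> f xstar < f x"
    and df_xstar_nonzero: "df xstar \<noteq> 0"
    and \<zeta>_measurable: "\<And>n. 1 \<le> n \<Longrightarrow> \<zeta> n \<in> M \<rightarrow>\<^sub>M D"
    and \<zeta>_distr: "\<And>n. 1 \<le> n \<Longrightarrow> distr M D (\<zeta> n) = D"
    and p_range: "\<And>n. 1 \<le> n \<Longrightarrow> 0 \<le> p n \<and> p n \<le> 1"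
    and \<omega>_measurable: "\<And>n. 1 \<le> n \<Longrightarrow> \<omega> n \<in> M \<rightarrow>\<^sub>M count_space UNIV"
    and \<omega>_distr: "\<And>n. 1 \<le> n \<Longrightarrow>
      distr M (count_space UNIV) (\<omega> n) = measure_pmf (bernoulli_pmf (p n))"
    and indep: "sample.indep_sets
      (\<lambda>i. case i of Inl n \<Rightarrow> {\<zeta> n -` B \<inter> space M | B. B \<in> sets D}
                   | Inr n \<Rightarrow> {\<omega> n -` B \<inter> space M | B. B \<in> UNIV})
      ({1..} <+> {1..})"
begin

definition P_col :: "real ^ 'd \<Rightarrow> real ^ 'd" where
  "P_col = orthogonal_projection (span (columns A))"

definition P_null :: "real ^ 'd \<Rightarrow> real ^ 'd" where
  "P_null x = x - P_col x"

definition half_step :: "nat \<Rightarrow> 'w \<Rightarrow> real ^ 'd \<Rightarrow> real ^ 'd" where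
  "half_step n w x = x - \<eta> n *\<^sub>R dF x (\<zeta> n w)"

text \<open>The iterates start at index 1; the value at index 0 is a dummy.\<close>

primrec iterate :: "nat \<Rightarrow> 'w \<Rightarrow> real ^ 'd" where
  "iterate 0 w = x1"
| "iterate (Suc n) w =
     (if n = 0 then x1
      else if \<omega> n w then P_null (half_step n w (iterate n w))
      else half_step n w (iterate n w))"

definition noise :: "nat \<Rightarrow> 'w \<Rightarrow> real ^ 'd" where
  "noise n w = df (iterate n w) - dF (iterate n w) (\<zeta> n w)"

definition noise2 :: "nat \<Rightarrow> 'w \<Rightarrow> real ^ 'd" where
  "noise2 n w = P_col (noise n w)"

definition vcheck :: "nat \<Rightarrow> 'w \<Rightarrow> real ^ 'd" where
  "vcheck n w = (\<eta> (n - 1) powr (\<beta> - 1)) *\<^sub>R P_col (iterate n w)"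

definition vcheck_minus :: "nat \<Rightarrow> 'w \<Rightarrow> real ^ 'd" where
  \<comment> \<open>\<open>vcheck_minus n\<close> is the left limit at index \<open>n + 1\<close>\<close>
  "vcheck_minus n w = (\<eta> n powr (\<beta> - 1)) *\<^sub>R P_col (half_step n w (iterate n w))"

definition drift :: "nat \<Rightarrow> 'w \<Rightarrow> real ^ 'd" where
  \<comment> \<open>the solution \<open>d\<^sub>n\<close> of
    \<open>vcheck_minus n w = vcheck n w - \<eta>\<^sub>n powr \<beta> * d\<^sub>n + \<eta>\<^sub>n powr \<beta> * noise2 n w\<close>\<close>
  "drift n w = noise2 n w - (vcheck_minus n w - vcheck n w) /\<^sub>R (\<eta> n powr \<beta>)"

definition Nidx :: "nat \<Rightarrow> real \<Rightarrow> nat" where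
  "Nidx n t = (LEAST m. n \<le> m \<and> t < (\<Sum>k=n..m. \<eta> k powr \<beta>))"

definition Gam :: "nat \<Rightarrow> real" where
  "Gam n = (\<Sum>k=1..<n. \<eta> k powr \<beta>)"

definition vbar :: "nat \<Rightarrow> real \<Rightarrow> 'w \<Rightarrow> real ^ 'd" where
  "vbar n t w = vcheck (Nidx n t) w
     - (t - (Gam (Nidx n t) - Gam n)) *\<^sub>R (drift (Nidx n t) w - noise2 (Nidx n t) w)"

end

end

theory Submission
  imports Defs "HOL-Complex_Analysis.Great_Picard"
begin

text \<open>
  Let \<open>h\<^sub>k = \<eta>\<^sub>k powr \<beta>\<close> be the length of the \<open>k\<close>-th time step and \<open>s\<^sub>k = drift k - noise2 k\<close>. During this
  step the interpolation moves linearly from \<open>vcheck k\<close> with velocity \<open>- s\<^sub>k\<close>; at the end of the step it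
  is reset to 0 if \<open>\<omega>\<^sub>k\<close> holds. Let \<open>B\<close> be the primitive of this velocity with \<open>B 0 = 0\<close>. Then \<open>vbar - B\<close> is
  constant between resets, and a reset at time \<open>t\<close> changes its value to \<open>- B t\<close>. So each path is a
  continuous function plus a step function, and two estimates, uniform in the starting index,
  put it into a compact set with high probability.

  \<^item> The continuous part. By Cauchy-Schwarz, \<open>B\<close> is Hoelder continuous with exponent 1/2, and the
    square of its constant is the energy, the sum of \<open>h\<^sub>k * (norm s\<^sub>k)\<^sup>2\<close> over the steps that meet
    \<open>[0,T]\<close>. The gradient noise is multiplied by the length of the time step, so it is just a part of
    the velocity, and the energy has bounded expectation as soon as \<open>s\<^sub>k\<close> has bounded second moments.
    Now \<open>s\<^sub>k\<close> is the projected stochastic gradient minus \<open>vcheck k\<close> times the growth rate of the scaling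
    factor \<open>\<eta>\<^sub>k powr (\<beta> - 1)\<close>. Second moments of the iterates stay bounded because
    strong convexity contracts the distance to \<open>xstar\<close>, which the projection does not increase.
    Second moments of \<open>vcheck k\<close> stay bounded because the resets, of probability \<open>\<gamma> * h\<^sub>k\<close>, outweigh the
    growth of the scaling factor, which is \<open>o(h\<^sub>k)\<close> as \<open>\<alpha> * \<beta> < 1\<close>.

  \<^item> The step part. Resets have probabilities at most \<open>\<gamma> * h\<^sub>k\<close> and are pairwise independent, so by a
    union bound two resets at distance less than \<open>\<delta>\<close>, or a reset this close to an end of
    \<open>[0,T]\<close>, have a probability that tends to 0 with \<open>\<delta>\<close>, uniformly in the starting index
    (\<open>prob_crowded_resets_le\<close>, \<open>prob_late_reset_small\<close>).

  The sums of a function \<open>B\<close> of this kind with a fixed Hoelder constant and a bounded step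
  function whose jumps are at least \<open>\<delta>\<close> apart form a compact set of the Skorokhod space
  (\<open>compactin_holder_step_paths\<close>): Arzela-Ascoli applies to \<open>B\<close> and Bolzano-Weierstrass to the times
  and values of the steps, and a time change that moves the jump times to their limits turns this
  into convergence in the Skorokhod metric.
\<close>

section \<open>A compact class of paths\<close>

text \<open>
  Only the entries up to \<open>Suc m\<close> matter; they subdivide \<open>[0,T]\<close>.
\<close>

definition separated_times :: "real \<Rightarrow> real \<Rightarrow> nat \<Rightarrow> (nat \<Rightarrow> real) \<Rightarrow> bool" where
  "separated_times T \<delta> m t \<longleftrightarrow> t 0 = 0 \<and> t (Suc m) = T \<and> (\<forall>j\<le>m. t j + \<delta> \<le> t (Suc j))"

text \<open>
  The end point \<open>T\<close> has its own value \<open>c (Suc m)\<close>: every time change fixes \<open>T\<close>, so a jump exactly there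
  does no harm to compactness.
\<close>

definition continuous_plus_step ::
  "real \<Rightarrow> nat \<Rightarrow> (nat \<Rightarrow> real) \<Rightarrow> (real \<Rightarrow> 'a::real_normed_vector) \<Rightarrow> (nat \<Rightarrow> 'a) \<Rightarrow> (real \<Rightarrow> 'a) \<Rightarrow> bool"
where
  "continuous_plus_step T m t B c x \<longleftrightarrow> x \<in> extensional {0..T} \<and>
     (\<forall>j\<le>m. \<forall>s\<in>{t j..<t (Suc j)}. x s = B s + c j) \<and> x T = B T + c (Suc m)"

definition half_holder :: "real \<Rightarrow> real \<Rightarrow> (real \<Rightarrow> 'a::real_normed_vector) \<Rightarrow> bool" where
  "half_holder T C B \<longleftrightarrow> (\<forall>s\<in>{0..T}. \<forall>s'\<in>{0..T}. norm (B s - B s') \<le> C * sqrt \<bar>s - s'\<bar>)"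

definition holder_step_paths ::
  "real \<Rightarrow> real \<Rightarrow> real \<Rightarrow> real \<Rightarrow> (real \<Rightarrow> 'a::real_normed_vector) set" where
  "holder_step_paths T \<delta> R C = {x. \<exists>m t B c. separated_times T \<delta> m t \<and>
     B 0 = 0 \<and> half_holder T C B \<and> (\<forall>j\<le>Suc m. norm (c j) \<le> R) \<and> continuous_plus_step T m t B c x}"

lemma separated_times_gap:
  assumes "separated_times T \<delta> m t" "0 < \<delta>" "j < k" "k \<le> Suc m"
  shows "t j + \<delta> \<le> t k"
proof -
  have "k = Suc j + d \<Longrightarrow> k \<le> Suc m \<Longrightarrow> t j + \<delta> \<le> t k" for d
  proof (induction d arbitrary: k)
    case 0
    then show ?case using assms(1) by (auto simp: separated_times_def)
  next
    case (Suc d)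
    then have "t j + \<delta> \<le> t (Suc j + d)" by simp
    moreover have "t (Suc j + d) + \<delta> \<le> t (Suc (Suc j + d))"
      using assms(1) Suc.prems unfolding separated_times_def by simp
    ultimately show ?case using assms(2) Suc.prems by simp
  qed
  moreover have "k = Suc j + (k - Suc j)" using assms(3) by simp
  ultimately show ?thesis using assms(4) by blast
qed

lemma separated_times_mono:
  assumes "separated_times T \<delta> m t" "0 < \<delta>" "j \<le> k" "k \<le> Suc m"
  shows "t j \<le> t k"
  using separated_times_gap[OF assms(1,2), of j k] assms by (cases "j = k") auto

lemma separated_times_range:
  assumes "separated_times T \<delta> m t" "0 < \<delta>" "j \<le> Suc m"
  shows "t j \<in> {0..T}"
proof -
  have "t 0 \<le> t j" "t j \<le> t (Suc m)"
    using separated_times_mono[OF assms(1,2)] assms(3) by simp_all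
  then show ?thesis using assms(1) by (simp add: separated_times_def)
qed

lemma separated_times_locate:
  assumes "separated_times T \<delta> m t" "0 < \<delta>" "0 \<le> s" "s < T"
  obtains j where "j \<le> m" "s \<in> {t j..<t (Suc j)}"
proof -
  define j where "j = (LEAST j. s < t (Suc j))"
  have "s < t (Suc m)" using assms by (simp add: separated_times_def)
  then have j: "s < t (Suc j)" "j \<le> m" unfolding j_def by (rule LeastI, rule Least_le)
  have "t j \<le> s"
  proof (cases j)
    case 0
    then show ?thesis using assms by (simp add: separated_times_def)
  next
    case (Suc i)
    then have "\<not> s < t (Suc i)" unfolding j_def by (metis lessI not_less_Least)
    then show ?thesis using Suc by simp
  qed
  then show thesis using that j by simp
qed

lemma separated_times_length:
  assumes "separated_times T \<delta> m t" "0 < \<delta>"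
  shows "m \<le> nat \<lfloor>T / \<delta>\<rfloor>"
proof -
  have "j \<le> Suc m \<Longrightarrow> real j * \<delta> \<le> t j" for j
  proof (induction j)
    case 0
    then show ?case using assms(1) by (simp add: separated_times_def)
  next
    case (Suc j)
    then have "t j + \<delta> \<le> t (Suc j)" using assms(1) by (simp add: separated_times_def)
    then show ?case using Suc by (simp add: algebra_simps)
  qed
  from this[of "Suc m"] have "real (Suc m) * \<delta> \<le> T" using assms(1) by (simp add: separated_times_def)
  then have "real m * \<delta> \<le> T" using assms(2) by (simp add: algebra_simps)
  then have "real m \<le> T / \<delta>" using assms(2) by (simp add: field_simps)
  then show ?thesis by (simp add: le_nat_floor)
qed

text \<open>
  The identity is perturbed by tents of radius \<open>\<delta> / 2\<close> at the points \<open>t j\<close>. Because of the gaps each \<open>t j\<close>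
  sees only its own tent and is moved exactly to \<open>u j\<close>; as the tents have slope \<open>2 / \<delta>\<close>, a total
  displacement below \<open>\<delta> / 2\<close> keeps the perturbed map strictly increasing.
\<close>

lemma separated_times_change:
  assumes t: "separated_times T \<delta> m t" and u: "separated_times T \<delta> m u" and \<delta>: "0 < \<delta>" and T: "0 < T"
    and close: "(\<Sum>j\<le>Suc m. \<bar>u j - t j\<bar>) < \<delta> / 2"
  obtains l where "l \<in> time_changes T" "\<And>j. j \<le> Suc m \<Longrightarrow> l (t j) = u j"
    "\<And>s. \<bar>l s - s\<bar> \<le> (\<Sum>j\<le>Suc m. \<bar>u j - t j\<bar>)"
proof -
  define tent where "tent j s = max 0 (1 - 2 / \<delta> * \<bar>s - t j\<bar>)" for j s
  define l where "l s = s + (\<Sum>j\<le>Suc m. (u j - t j) * tent j s)" for s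
  have tent01: "0 \<le> tent j s" "tent j s \<le> 1" for j s
    using \<delta> by (auto simp: tent_def)
  have tent_lip: "\<bar>tent j s - tent j r\<bar> \<le> 2 / \<delta> * \<bar>s - r\<bar>" for j r s
  proof -
    have "\<bar>tent j s - tent j r\<bar> \<le> \<bar>2 / \<delta> * \<bar>s - t j\<bar> - 2 / \<delta> * \<bar>r - t j\<bar>\<bar>"
      unfolding tent_def by linarith
    also have "\<dots> = 2 / \<delta> * \<bar>\<bar>s - t j\<bar> - \<bar>r - t j\<bar>\<bar>"
      using \<delta> by (metis abs_mult abs_of_pos right_diff_distrib zero_less_divide_iff zero_less_numeral)
    also have "\<dots> \<le> 2 / \<delta> * \<bar>s - r\<bar>"
      using \<delta> by (intro mult_left_mono) auto
    finally show ?thesis .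
  qed
  have at_knot: "l (t k) = u k" if k: "k \<le> Suc m" for k
  proof -
    have "tent j (t k) = (if j = k then 1 else 0)" if "j \<le> Suc m" for j
    proof (cases "j = k")
      case False
      then have "\<delta> \<le> \<bar>t k - t j\<bar>"
        using separated_times_gap[OF t \<delta>, of j k] separated_times_gap[OF t \<delta>, of k j] k that by linarith
      then have "2 / \<delta> * \<delta> \<le> 2 / \<delta> * \<bar>t k - t j\<bar>" using \<delta> by (intro mult_left_mono) auto
      then show ?thesis using False \<delta> by (simp add: tent_def)
    qed (simp add: tent_def)
    then have "(\<Sum>j\<le>Suc m. (u j - t j) * tent j (t k)) = (\<Sum>j\<le>Suc m. if j = k then u j - t j else 0)"
      by (intro sum.cong) auto
    also have "\<dots> = u k - t k" using k by simp
    finally show ?thesis by (simp add: l_def)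
  qed
  have near: "\<bar>l s - s\<bar> \<le> (\<Sum>j\<le>Suc m. \<bar>u j - t j\<bar>)" for s
  proof -
    have "\<bar>l s - s\<bar> \<le> (\<Sum>j\<le>Suc m. \<bar>(u j - t j) * tent j s\<bar>)"
      unfolding l_def by (simp only: add_diff_cancel_left' sum_abs)
    also have "\<dots> \<le> (\<Sum>j\<le>Suc m. \<bar>u j - t j\<bar>)"
      using tent01 by (intro sum_mono) (simp add: abs_mult mult_left_le)
    finally show ?thesis .
  qed
  have mono: "l r < l s" if "r < s" for r s
  proof -
    have "\<bar>(\<Sum>j\<le>Suc m. (u j - t j) * (tent j s - tent j r))\<bar>
        \<le> (\<Sum>j\<le>Suc m. \<bar>u j - t j\<bar> * (2 / \<delta> * \<bar>s - r\<bar>))"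
      using tent_lip by (intro sum_abs[THEN order_trans] sum_mono) (simp only: abs_mult mult_left_mono abs_ge_zero)
    also have "\<dots> = (\<Sum>j\<le>Suc m. \<bar>u j - t j\<bar>) * (2 / \<delta> * \<bar>s - r\<bar>)"
      by (rule sum_distrib_right[symmetric])
    also have "\<dots> < \<delta> / 2 * (2 / \<delta> * \<bar>s - r\<bar>)"
      using close that \<delta> by (intro mult_strict_right_mono) auto
    also have "\<dots> = s - r" using \<delta> that by simp
    finally have "(\<Sum>j\<le>Suc m. (u j - t j) * (tent j s - tent j r)) > - (s - r)" by linarith
    then have "(\<Sum>j\<le>Suc m. (u j - t j) * tent j s) - (\<Sum>j\<le>Suc m. (u j - t j) * tent j r) > - (s - r)"
      by (simp only: right_diff_distrib sum_subtractf)
    then show ?thesis unfolding l_def by linarith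
  qed
  have cont: "continuous_on {0..T} l"
    unfolding l_def tent_def by (intro continuous_intros)
  have ends: "l 0 = 0" "l T = T"
    using at_knot[of 0] at_knot[of "Suc m"] t u by (auto simp: separated_times_def)
  have "l ` {0..T} = {0..T}"
  proof
    show "l ` {0..T} \<subseteq> {0..T}"
    proof clarify
      fix s assume "s \<in> {0..T}"
      then show "l s \<in> {0..T}"
        using mono[of 0 s] mono[of s T] ends by (cases "s = 0"; cases "s = T") auto
    qed
    show "{0..T} \<subseteq> l ` {0..T}"
    proof
      fix y assume "y \<in> {0..T}"
      then show "y \<in> l ` {0..T}"
        using IVT'[of l 0 y T] ends cont T by force
    qed
  qed
  then have "l \<in> time_changes T"
    using mono cont by (auto simp: time_changes_def strict_mono_on_def)
  then show thesis using that at_knot near by blast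
qed

lemma half_holder_continuous:
  assumes "half_holder T C B"
  shows "continuous_on {0..T} B"
  unfolding continuous_on_def
proof
  fix s assume s: "s \<in> {0..T}"
  have "((\<lambda>r. C * sqrt \<bar>r - s\<bar>) \<longlongrightarrow> C * sqrt \<bar>s - s\<bar>) (at s within {0..T})"
    by (intro tendsto_intros)
  then have "((\<lambda>r. C * sqrt \<bar>r - s\<bar>) \<longlongrightarrow> 0) (at s within {0..T})" by simp
  moreover have "eventually (\<lambda>r. norm (B r - B s) \<le> C * sqrt \<bar>r - s\<bar>) (at s within {0..T})"
    using assms s by (auto simp: eventually_at_filter half_holder_def)
  ultimately have "((\<lambda>r. B r - B s) \<longlongrightarrow> 0) (at s within {0..T})"
    by (rule Lim_null_comparison[rotated])
  then show "(B \<longlongrightarrow> B s) (at s within {0..T})" by (rule LIM_zero_cancel)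
qed

lemma continuous_plus_step_cadlag:
  assumes sep: "separated_times T \<delta> m t" and \<delta>: "0 < \<delta>" and cont: "continuous_on {0..T} B"
    and x: "continuous_plus_step T m t B c x"
  shows "x \<in> cadlag_paths T"
proof -
  have val: "x s = B s + c j" if "j \<le> m" "t j \<le> s" "s < t (Suc j)" for j s
    using x that by (simp add: continuous_plus_step_def)
  have r: "(x \<longlongrightarrow> x s) (at_right s)" if s: "s \<in> {0..<T}" for s
  proof -
    obtain j where j: "j \<le> m" "s \<in> {t j..<t (Suc j)}"
      using separated_times_locate[OF sep \<delta>] s by auto
    have "t (Suc j) \<le> T" using separated_times_range[OF sep \<delta>] j by auto
    then have "continuous_on {s..t (Suc j)} B" using s by (intro continuous_on_subset[OF cont]) auto
    then have "(B \<longlongrightarrow> B s) (at_right s)"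
      using continuous_on_Icc_at_rightD j by force
    then have "((\<lambda>r. B r + c j) \<longlongrightarrow> x s) (at_right s)"
      using val[of j s] j by (auto intro!: tendsto_intros)
    moreover have "eventually (\<lambda>r. B r + c j = x r) (at_right s)"
      unfolding eventually_at_right_field using val j
      by (intro exI[of _ "t (Suc j)"]) auto
    ultimately show ?thesis by (rule Lim_transform_eventually)
  qed
  have l: "\<exists>y. (x \<longlongrightarrow> y) (at_left s)" if s: "s \<in> {0<..T}" for s
  proof -
    obtain j where j: "j \<le> m" "t j < s" "s \<le> t (Suc j)"
    proof (cases "s = T")
      case True
      then have "t m < T" using separated_times_gap[OF sep \<delta>, of m "Suc m"] \<delta> sep
        by (simp add: separated_times_def)
      then show thesis using that[of m] True sep by (simp add: separated_times_def)
    next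
      case False
      obtain j where j: "j \<le> m" "s \<in> {t j..<t (Suc j)}"
        using separated_times_locate[OF sep \<delta>] s False by (auto simp: less_eq_real_def)
      show thesis
      proof (cases "t j < s")
        case True
        then show thesis using that j by auto
      next
        case False
        then have js: "t j = s" using j by auto
        then have "j \<noteq> 0" using s sep by (metis greaterThanAtMost_iff less_irrefl separated_times_def)
        then obtain i where i: "j = Suc i" by (cases j) auto
        then show thesis using that[of i] separated_times_gap[OF sep \<delta>, of i j] j js \<delta> by auto
      qed
    qed
    have "t j \<in> {0..T}" using separated_times_range[OF sep \<delta>] j by auto
    then have "continuous_on {t j..s} B" using s by (intro continuous_on_subset[OF cont]) auto
    then have "(B \<longlongrightarrow> B s) (at_left s)"
      using continuous_on_Icc_at_leftD j by blast
    then have "((\<lambda>r. B r + c j) \<longlongrightarrow> B s + c j) (at_left s)"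
      by (auto intro!: tendsto_intros)
    moreover have "eventually (\<lambda>r. B r + c j = x r) (at_left s)"
      unfolding eventually_at_left_field using val j
      by (intro exI[of _ "t j"]) auto
    ultimately have "(x \<longlongrightarrow> B s + c j) (at_left s)" by (rule Lim_transform_eventually)
    then show ?thesis by blast
  qed
  show ?thesis using r l x by (auto simp: cadlag_paths_def continuous_plus_step_def)
qed

text \<open>
  The time change that matches the jump times makes the two step functions run in parallel. What is
  left is the distance of the data and, from the displacement of time, an oscillation of the
  continuous part, which is where a modulus of continuity is needed.
\<close>

lemma skorokhod_close_continuous_plus_step:
  fixes B B' :: "real \<Rightarrow> 'a::real_normed_vector"
  assumes T: "0 < T" and \<delta>: "0 < \<delta>"
    and t: "separated_times T \<delta> m t" and u: "separated_times T \<delta> m u"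
    and x: "continuous_plus_step T m t B c x" and y: "continuous_plus_step T m u B' c' y"
    and hol: "half_holder T C B'" and C: "0 \<le> C"
    and B: "\<And>s. s \<in> {0..T} \<Longrightarrow> norm (B s - B' s) \<le> e1"
    and c: "\<And>j. j \<le> Suc m \<Longrightarrow> norm (c j - c' j) \<le> e2"
    and tu: "(\<Sum>j\<le>Suc m. \<bar>u j - t j\<bar>) \<le> e3" and e3: "e3 < \<delta> / 2"
  shows "skorokhod_close T x y (e1 + e2 + e3 + C * sqrt e3)"
proof -
  have small: "(\<Sum>j\<le>Suc m. \<bar>u j - t j\<bar>) < \<delta> / 2" using tu e3 by (rule order.strict_trans1)
  obtain l where l: "l \<in> time_changes T" "\<And>j. j \<le> Suc m \<Longrightarrow> l (t j) = u j"
    "\<And>s. \<bar>l s - s\<bar> \<le> (\<Sum>j\<le>Suc m. \<bar>u j - t j\<bar>)"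
    using separated_times_change[OF t u \<delta> T small] by metis
  have ls: "\<bar>l s - s\<bar> \<le> e3" for s using l(3)[of s] tu by linarith
  have mono: "strict_mono_on {0..T} l" and im: "\<And>s. s \<in> {0..T} \<Longrightarrow> l s \<in> {0..T}"
    using l(1) by (auto simp: time_changes_def)
  have pos: "0 \<le> e1" "0 \<le> e2" "0 \<le> e3"
  proof -
    show "0 \<le> e1" using T by (intro order_trans[OF norm_ge_zero B[of 0]]) simp
    show "0 \<le> e2" by (rule order_trans[OF norm_ge_zero c[of 0]]) simp
    show "0 \<le> e3" using ls[of 0] by linarith
  qed
  have D: "norm (B s - B' (l s)) \<le> e1 + C * sqrt e3" if s: "s \<in> {0..T}" for s
  proof -
    have "norm (B' s - B' (l s)) \<le> C * sqrt \<bar>s - l s\<bar>"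
      using hol s im[OF s] by (simp add: half_holder_def)
    also have "\<dots> \<le> C * sqrt e3" using ls[of s] C by (intro mult_left_mono real_sqrt_le_mono) auto
    finally show ?thesis using B[OF s] norm_triangle_ineq[of "B s - B' s" "B' s - B' (l s)"] by simp
  qed
  have "dist (x s) (y (l s)) \<le> e1 + e2 + C * sqrt e3" if s: "s \<in> {0..T}" for s
  proof -
    obtain j where j: "j \<le> Suc m" "x s = B s + c j" "y (l s) = B' (l s) + c' j"
    proof (cases "s = T")
      case True
      then have "l s = T" using time_changes_end[OF l(1)] T by simp
      then show thesis using that[of "Suc m"] x y True by (simp add: continuous_plus_step_def)
    next
      case False
      obtain j where j: "j \<le> m" "s \<in> {t j..<t (Suc j)}"
        using separated_times_locate[OF t \<delta>] s False by (auto simp: less_eq_real_def)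
      have tj: "t j \<in> {0..T}" "t (Suc j) \<in> {0..T}" using separated_times_range[OF t \<delta>] j by auto
      have "l (t j) \<le> l s"
        using strict_mono_onD[OF mono tj(1) s] j by (cases "t j = s") auto
      moreover have "l s < l (t (Suc j))"
        using strict_mono_onD[OF mono s tj(2)] j by simp
      ultimately have "l s \<in> {u j..<u (Suc j)}" using l(2)[of j] l(2)[of "Suc j"] j by simp
      then show thesis using that[of j] x y j by (auto simp: continuous_plus_step_def)
    qed
    have "dist (x s) (y (l s)) = norm ((B s - B' (l s)) + (c j - c' j))"
      using j by (simp add: dist_norm algebra_simps)
    also have "\<dots> \<le> (e1 + C * sqrt e3) + e2"
      using D[OF s] c[OF j(1)] by (intro norm_triangle_le) auto
    finally show ?thesis by simp
  qed
  moreover have "0 \<le> C * sqrt e3" using C pos by simp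
  ultimately have "\<bar>l s - s\<bar> \<le> e1 + e2 + e3 + C * sqrt e3 \<and>
      dist (x s) (y (l s)) \<le> e1 + e2 + e3 + C * sqrt e3" if "s \<in> {0..T}" for s
    using ls[of s] pos that by fastforce
  then show ?thesis unfolding skorokhod_close_def using l(1) by blast
qed

lemma continuous_plus_step_exists:
  assumes sep: "separated_times T \<delta> m t" and \<delta>: "0 < \<delta>"
  obtains x where "continuous_plus_step T m t B c x"
proof -
  define x where "x = restrict (\<lambda>s. if s = T then B T + c (Suc m)
      else B s + c (LEAST j. s < t (Suc j))) {0..T}"
  have "x s = B s + c j" if j: "j \<le> m" and s: "s \<in> {t j..<t (Suc j)}" for j s
  proof -
    have "(LEAST i. s < t (Suc i)) = j"
    proof (rule Least_equality)
      fix i assume "s < t (Suc i)"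
      then show "j \<le> i"
        using separated_times_mono[OF sep \<delta>, of "Suc i" j] j s
        by (metis atLeastLessThan_iff le_SucI linorder_not_le not_less_eq_eq order.strict_trans1)
    qed (use s in simp)
    moreover have "t j \<in> {0..T}" "t (Suc j) \<in> {0..T}" using separated_times_range[OF sep \<delta>] j by auto
    ultimately show ?thesis using s by (simp add: x_def)
  qed
  moreover have "0 \<le> T" using separated_times_range[OF sep \<delta>, of 0] by auto
  ultimately have "continuous_plus_step T m t B c x" by (simp add: continuous_plus_step_def x_def)
  then show thesis by (rule that)
qed

text \<open>
  Each sequence in the set has a convergent subsequence: the gap \<open>\<delta>\<close> bounds the number of steps, which is
  therefore constant along a subsequence; the continuous parts converge uniformly by Arzela-Ascoli,
  the finitely many times and values by Bolzano-Weierstrass. All constraints are closed, so the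
  limiting data define a path of the same kind.
\<close>

theorem compactin_holder_step_paths:
  assumes T: "0 < T" and \<delta>: "0 < \<delta>" and C: "0 \<le> C"
  shows "compactin (skorokhod_topology T)
    (holder_step_paths T \<delta> R C :: (real \<Rightarrow> 'a::euclidean_space) set)" (is "compactin _ ?K")
proof -
  interpret Metric_space "cadlag_paths T :: (real \<Rightarrow> 'a) set" "skorokhod_dist T"
    by (rule Metric_space_skorokhod[OF T])
  have sub: "?K \<subseteq> cadlag_paths T"
    unfolding holder_step_paths_def
    using continuous_plus_step_cadlag[OF _ \<delta> half_holder_continuous] by blast
  have "\<exists>l r. l \<in> ?K \<and> strict_mono r \<and> limitin mtopology (\<sigma> \<circ> r) l sequentially"
    if \<sigma>: "range \<sigma> \<subseteq> ?K" for \<sigma> :: "nat \<Rightarrow> real \<Rightarrow> 'a"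
  proof -
    define Q where "Q i m t B c \<longleftrightarrow> separated_times T \<delta> m t \<and>
      B 0 = 0 \<and> half_holder T C B \<and> (\<forall>j\<le>Suc m. norm (c j) \<le> R) \<and> continuous_plus_step T m t B c (\<sigma> i)"
      for i m t B c
    have "\<forall>i. \<exists>m t B c. Q i m t B c"
      using \<sigma> unfolding Q_def holder_step_paths_def by blast
    then obtain m t B c where Q: "\<And>i. Q i (m i) (t i) (B i) (c i)" by metis
    \<comment> \<open>First subsequence: the number of steps is constant.\<close>
    have "range m \<subseteq> {..nat \<lfloor>T / \<delta>\<rfloor>}"
      using Q separated_times_length[OF _ \<delta>] unfolding Q_def by blast
    then have "finite (range m)" using finite_subset by blast
    then obtain i0 where i0: "infinite {i \<in> UNIV. m i = m i0}"
      using pigeonhole_infinite[of UNIV m] by auto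
    define m0 where "m0 = m i0"
    define r0 where "r0 = enumerate {i. m i = m0}"
    have r0: "strict_mono r0" "\<And>i. m (r0 i) = m0"
      using i0 strict_mono_enumerate enumerate_in_set unfolding r0_def m0_def by auto
    have hol: "half_holder T C (B i)" and B0: "B i 0 = 0" for i using Q[of i] by (auto simp: Q_def)
    \<comment> \<open>Second subsequence: the continuous parts converge uniformly.\<close>
    have B_bound: "norm (B i s) \<le> C * sqrt T" if "s \<in> {0..T}" for i s
    proof -
      have "norm (B i s - B i 0) \<le> C * sqrt \<bar>s - 0\<bar>" 
        using hol[of i] T that unfolding half_holder_def by (meson atLeastAtMost_iff less_imp_le order_refl)
      also have "\<dots> \<le> C * sqrt T" using that C by (intro mult_left_mono) auto
      finally show ?thesis by (simp add: B0)
    qed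
    have B_equi: "\<exists>d>0. \<forall>n y. y \<in> {0..T} \<and> norm (x - y) < d \<longrightarrow> norm (B (r0 n) x - B (r0 n) y) < e"
      if "x \<in> {0..T}" "0 < e" for x e
    proof -
      have "((\<lambda>h. C * sqrt \<bar>h\<bar>) \<longlongrightarrow> C * sqrt \<bar>0\<bar>) (at 0)" by (intro tendsto_intros)
      then have "eventually (\<lambda>h. C * sqrt \<bar>h\<bar> < e) (at 0)"
        using order_tendstoD(2) that(2) by fastforce
      then obtain d where d: "d > 0" "\<And>h. h \<noteq> 0 \<Longrightarrow> \<bar>h\<bar> < d \<Longrightarrow> C * sqrt \<bar>h\<bar> < e"
        by (auto simp: eventually_at dist_real_def)
      have "norm (B (r0 n) x - B (r0 n) y) < e" if y: "y \<in> {0..T}" "norm (x - y) < d" for n y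
      proof (cases "x = y")
        case False
        have "norm (B (r0 n) x - B (r0 n) y) \<le> C * sqrt \<bar>x - y\<bar>"
          using hol y \<open>x \<in> {0..T}\<close> by (simp add: half_holder_def)
        also have "\<dots> < e" using d(2)[of "x - y"] y False by simp
        finally show ?thesis .
      qed (simp add: \<open>0 < e\<close>)
      then show ?thesis using d(1) by blast
    qed
    obtain g k1 where g: "strict_mono (k1 :: nat \<Rightarrow> nat)"
      "\<And>e. 0 < e \<Longrightarrow> \<exists>N. \<forall>n x. n \<ge> N \<and> x \<in> {0..T} \<longrightarrow> norm (B (r0 (k1 n)) x - g x) < e"
      using Arzela_Ascoli[of "{0..T}" "\<lambda>n. B (r0 n)" "C * sqrt T"] B_bound B_equi compact_Icc by metis
    define r1 where "r1 = r0 \<circ> k1"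
    have r1: "strict_mono r1" "\<And>i. m (r1 i) = m0"
      using r0 g(1) by (auto simp: r1_def intro: strict_mono_o)
    \<comment> \<open>Third subsequence: the times and values of the steps converge.\<close>
    have bound: "norm (t (r1 n) j, c (r1 n) j) \<le> T + R" if "j \<in> {..Suc m0}" for n j
    proof -
      have "t (r1 n) j \<in> {0..T}" "norm (c (r1 n) j) \<le> R"
        using separated_times_range[OF _ \<delta>, of T m0 "t (r1 n)" j] Q[of "r1 n"] r1(2)[of n] that
        by (auto simp: Q_def)
      then show ?thesis using norm_Pair_le[of "t (r1 n) j" "c (r1 n) j"] by auto
    qed
    obtain k2 where k2: "strict_mono (k2 :: nat \<Rightarrow> nat)"
      "\<And>j. j \<in> {..Suc m0} \<Longrightarrow> \<exists>l. (\<lambda>n. (t (r1 (k2 n)) j, c (r1 (k2 n)) j)) \<longlonglongrightarrow> l"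
    proof (rule function_convergent_subsequence[of "{..Suc m0}" "\<lambda>n j. (t (r1 n) j, c (r1 n) j)" "T + R"])
      show "countable {..Suc m0}" by simp
      show "norm (t (r1 n) j, c (r1 n) j) \<le> T + R" if "j \<in> {..Suc m0}" for n j using bound that .
    qed blast
    define r where "r = r1 \<circ> k2"
    have r: "strict_mono r" "\<And>i. m (r i) = m0"
      unfolding r_def using strict_mono_o[OF r1(1) k2(1)] r1(2) by simp_all
    have "\<forall>j\<in>{..Suc m0}. \<exists>l. (\<lambda>n. (t (r n) j, c (r n) j)) \<longlonglongrightarrow> l"
      using k2(2) by (simp add: r_def)
    then obtain l where "\<forall>j\<in>{..Suc m0}. (\<lambda>n. (t (r n) j, c (r n) j)) \<longlonglongrightarrow> l j"
      unfolding bchoice_iff by blast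
    then have l: "(\<lambda>n. (t (r n) j, c (r n) j)) \<longlonglongrightarrow> l j" if "j \<le> Suc m0" for j
      using that by simp
    define t0 where "t0 = fst \<circ> l"
    define c0 where "c0 = snd \<circ> l"
    have tl: "(\<lambda>n. t (r n) j) \<longlonglongrightarrow> t0 j" and cl: "(\<lambda>n. c (r n) j) \<longlonglongrightarrow> c0 j" if "j \<le> Suc m0" for j
      using tendsto_fst[OF l[OF that]] tendsto_snd[OF l[OF that]] by (simp_all add: t0_def c0_def)
    have gl: "eventually (\<lambda>n. \<forall>x\<in>{0..T}. norm (B (r n) x - g x) < e) sequentially" if e: "0 < e" for e
    proof -
      obtain N where N: "\<And>n x. n \<ge> N \<Longrightarrow> x \<in> {0..T} \<Longrightarrow> norm (B (r0 (k1 n)) x - g x) < e"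
        using g(2)[OF e] by blast
      have "\<forall>x\<in>{0..T}. norm (B (r n) x - g x) < e" if "n \<ge> N" for n
        using N[of "k2 n"] seq_suble[OF k2(1), of n] that by (simp add: r_def r1_def)
      then show ?thesis unfolding eventually_sequentially by blast
    qed
    have gp: "(\<lambda>n. B (r n) x) \<longlonglongrightarrow> g x" if "x \<in> {0..T}" for x
    proof (rule tendstoI)
      fix e :: real assume "0 < e"
      show "eventually (\<lambda>n. dist (B (r n) x) (g x) < e) sequentially"
        using gl[OF \<open>0 < e\<close>] by eventually_elim (use that in \<open>simp add: dist_norm\<close>)
    qed
    have Qr: "separated_times T \<delta> m0 (t (r n))" "\<And>j. j \<le> Suc m0 \<Longrightarrow> norm (c (r n) j) \<le> R"
      "continuous_plus_step T m0 (t (r n)) (B (r n)) (c (r n)) (\<sigma> (r n))" for n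
      using Q[of "r n"] r(2)[of n] unfolding Q_def by simp_all
    have sep0: "separated_times T \<delta> m0 t0"
      unfolding separated_times_def
    proof (intro conjI allI impI)
      have "(\<lambda>n. t (r n) 0) = (\<lambda>n. 0)" "(\<lambda>n. t (r n) (Suc m0)) = (\<lambda>n. T)"
        using Qr(1) by (auto simp: separated_times_def)
      then show "t0 0 = 0" "t0 (Suc m0) = T"
        using tl[of 0] tl[of "Suc m0"] by (simp_all add: LIMSEQ_const_iff)
      fix j assume j: "j \<le> m0"
      show "t0 j + \<delta> \<le> t0 (Suc j)"
      proof (rule LIMSEQ_le)
        show "(\<lambda>n. t (r n) j + \<delta>) \<longlonglongrightarrow> t0 j + \<delta>" using j by (intro tendsto_intros tl) simp
        show "(\<lambda>n. t (r n) (Suc j)) \<longlonglongrightarrow> t0 (Suc j)" using j by (intro tl) simp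
        show "\<exists>N. \<forall>n\<ge>N. t (r n) j + \<delta> \<le> t (r n) (Suc j)"
          using Qr(1) j by (auto simp: separated_times_def)
      qed
    qed
    have g0: "g 0 = 0"
      using gp[of 0] T B0 by (simp add: LIMSEQ_const_iff)
    have holg: "half_holder T C g"
      unfolding half_holder_def
    proof (intro ballI)
      fix s s' assume s: "s \<in> {0..T}" "s' \<in> {0..T}"
      have "(\<lambda>n. norm (B (r n) s - B (r n) s')) \<longlonglongrightarrow> norm (g s - g s')"
        using s by (intro tendsto_intros gp)
      then show "norm (g s - g s') \<le> C * sqrt \<bar>s - s'\<bar>"
        by (rule LIMSEQ_le_const2) (use hol s in \<open>auto simp: half_holder_def\<close>)
    qed
    have c0: "norm (c0 j) \<le> R" if "j \<le> Suc m0" for j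
      by (rule LIMSEQ_le_const2[OF tendsto_norm[OF cl[OF that]]]) (use Qr(2) that in auto)
    obtain y where y: "continuous_plus_step T m0 t0 g c0 y"
      using continuous_plus_step_exists[OF sep0 \<delta>] by blast
    have yK: "y \<in> ?K" unfolding holder_step_paths_def using sep0 g0 holg c0 y by blast
    define E where "E n = (\<Sum>j\<le>Suc m0. \<bar>t0 j - t (r n) j\<bar>)" for n
    have "E \<longlonglongrightarrow> (\<Sum>j\<le>Suc m0. \<bar>t0 j - t0 j\<bar>)"
      unfolding E_def by (intro tendsto_intros tl) simp
    then have E: "E \<longlonglongrightarrow> 0" by simp
    have "(\<lambda>n. E n + C * sqrt (E n)) \<longlonglongrightarrow> 0 + C * sqrt 0" by (intro tendsto_intros E)
    then have E': "(\<lambda>n. E n + C * sqrt (E n)) \<longlonglongrightarrow> 0" by simp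
    have "limitin mtopology (\<sigma> \<circ> r) y sequentially"
      unfolding limitin_metric
    proof (intro conjI allI impI)
      show "y \<in> cadlag_paths T" using yK sub by blast
      fix e :: real assume e: "0 < e"
      have ev: "eventually (\<lambda>n. E n < \<delta> / 2) sequentially"
        "eventually (\<lambda>n. E n + C * sqrt (E n) < e / 2) sequentially"
        "eventually (\<lambda>n. \<forall>x\<in>{0..T}. norm (B (r n) x - g x) < e / 8) sequentially"
        using order_tendstoD(2)[OF E, of "\<delta> / 2"] order_tendstoD(2)[OF E', of "e / 2"] gl[of "e / 8"] e \<delta>
        by simp_all
      have "eventually (\<lambda>n. norm (c (r n) j - c0 j) < e / 8) sequentially" if "j \<in> {..Suc m0}" for j
        using tendstoD[OF cl, of j "e / 8"] that e by (simp add: dist_norm)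
      then have ev4: "eventually (\<lambda>n. \<forall>j\<in>{..Suc m0}. norm (c (r n) j - c0 j) < e / 8) sequentially"
        by (intro eventually_ball_finite) auto
      show "eventually (\<lambda>n. (\<sigma> \<circ> r) n \<in> cadlag_paths T \<and> skorokhod_dist T ((\<sigma> \<circ> r) n) y < e) sequentially"
        using ev ev4
      proof eventually_elim
        case (elim n)
        have mem: "\<sigma> (r n) \<in> cadlag_paths T" using \<sigma> sub by auto
        have cl: "skorokhod_close T (\<sigma> (r n)) y (e / 8 + e / 8 + E n + C * sqrt (E n))"
          by (rule skorokhod_close_continuous_plus_step[OF T \<delta> Qr(1) sep0 Qr(3) y holg C])
            (use elim in \<open>auto simp: E_def less_imp_le\<close>)
        have "0 \<le> E n" by (simp add: E_def sum_nonneg)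
        then have "0 < e / 8 + e / 8 + E n + C * sqrt (E n)" using e C by (simp add: add_pos_nonneg)
        from skorokhod_dist_le[OF mem _ this cl] have "skorokhod_dist T (\<sigma> (r n)) y \<le> e / 8 + e / 8 + E n + C * sqrt (E n)"
          using yK sub by blast
        then show ?case using mem elim(2) e by simp
      qed
    qed
    then show ?thesis using yK r(1) by blast
  qed
  then show ?thesis using sub by (simp add: skorokhod_topology_def compactin_sequentially)
qed

section \<open>Linear interpolation with resets on a time grid\<close>

text \<open>
  \<open>h k\<close> is the length of the \<open>k\<close>-th step. Time is counted from the beginning of step \<open>n\<close>, so that step
  \<open>k\<close> occupies the interval from \<open>grid n k\<close> to \<open>grid n (Suc k)\<close>; it is step number \<open>idx n t\<close> that is under
  way at time \<open>t\<close>.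
\<close>

locale time_grid =
  fixes h :: "nat \<Rightarrow> real"
  assumes h_pos: "1 \<le> k \<Longrightarrow> 0 < h k"
    and h_diverges: "1 \<le> n \<Longrightarrow> \<exists>m\<ge>n. c < sum h {n..m}"
begin

definition grid :: "nat \<Rightarrow> nat \<Rightarrow> real" where
  "grid n k = sum h {n..<k}"

definition idx :: "nat \<Rightarrow> real \<Rightarrow> nat" where
  "idx n t = (LEAST m. n \<le> m \<and> t < sum h {n..m})"

lemma grid_start: "grid n n = 0"
  by (simp add: grid_def)

lemma grid_Suc: "n \<le> k \<Longrightarrow> grid n (Suc k) = grid n k + h k"
  by (simp add: grid_def)

lemma grid_split: "n \<le> j \<Longrightarrow> j \<le> k \<Longrightarrow> grid n k = grid n j + sum h {j..<k}"
  unfolding grid_def by (simp add: sum.atLeastLessThan_concat)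

lemma sum_h_nonneg: "1 \<le> j \<Longrightarrow> 0 \<le> sum h {j..<k}"
  using h_pos by (intro sum_nonneg) (simp add: less_imp_le)

lemma grid_mono: "1 \<le> n \<Longrightarrow> n \<le> j \<Longrightarrow> j \<le> k \<Longrightarrow> grid n j \<le> grid n k"
  using sum_h_nonneg[of j k] by (simp add: grid_split[of n j k])

lemma grid_strict_mono: "1 \<le> n \<Longrightarrow> n \<le> j \<Longrightarrow> j < k \<Longrightarrow> grid n j < grid n k"
  using grid_mono[of n "Suc j" k] grid_Suc[of n j] h_pos[of j] by simp

lemma grid_nonneg: "1 \<le> n \<Longrightarrow> 0 \<le> grid n k"
  by (simp add: grid_def sum_h_nonneg)

lemma idx_props:
  assumes "1 \<le> n"
  shows idx_ge: "n \<le> idx n t" and idx_upper: "t < grid n (Suc (idx n t))"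
proof -
  have "\<exists>m. n \<le> m \<and> t < sum h {n..m}" using h_diverges[OF assms] by blast
  then have "n \<le> idx n t \<and> t < sum h {n..idx n t}" unfolding idx_def by (rule LeastI_ex)
  then show "n \<le> idx n t" "t < grid n (Suc (idx n t))"
    by (simp_all add: grid_def atLeastLessThanSuc_atLeastAtMost)
qed

lemma idx_lower:
  assumes "1 \<le> n" "0 \<le> t"
  shows "grid n (idx n t) \<le> t"
proof (cases "idx n t = n")
  case True
  then show ?thesis using assms by (simp add: grid_start)
next
  case False
  then obtain m where m: "idx n t = Suc m" "n \<le> m"
    using idx_ge[OF assms(1), of t] by (cases "idx n t") auto
  then have "\<not> (n \<le> m \<and> t < sum h {n..m})" unfolding idx_def by (metis lessI not_less_Least)
  then show ?thesis using m by (simp add: grid_def atLeastLessThanSuc_atLeastAtMost)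
qed

lemma idx_less_iff:
  assumes "1 \<le> n" "n \<le> k" "0 \<le> t"
  shows "idx n t < k \<longleftrightarrow> t < grid n k"
proof
  assume "idx n t < k"
  then have "grid n (Suc (idx n t)) \<le> grid n k" using idx_ge[OF assms(1)] assms
    by (intro grid_mono) (auto intro: le_SucI)
  then show "t < grid n k" using idx_upper[OF assms(1), of t] by simp
next
  assume "t < grid n k"
  then show "idx n t < k"
    using idx_lower[OF assms(1,3)] grid_mono[OF assms(1,2), of "idx n t"] by (meson leI le_less_trans not_le)
qed

lemma idx_eqI:
  assumes "1 \<le> n" "n \<le> k" "grid n k \<le> t" "t < grid n (Suc k)"
  shows "idx n t = k"
proof -
  have "0 \<le> t" using assms grid_nonneg[of n k] by simp
  then show ?thesis
    using idx_less_iff[of n "Suc k" t] idx_less_iff[of n k t] assms by simp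
qed

lemma idx_mono: "1 \<le> n \<Longrightarrow> 0 \<le> s \<Longrightarrow> s \<le> t \<Longrightarrow> idx n s \<le> idx n t"
  using idx_less_iff[of n "Suc (idx n t)" s] idx_upper[of n t] idx_ge[of n t] by simp

lemma finite_grid_below:
  assumes "1 \<le> n" shows "finite {k. n \<le> k \<and> grid n (Suc k) < b}"
proof (rule finite_subset)
  show "{k. n \<le> k \<and> grid n (Suc k) < b} \<subseteq> {..idx n b}"
  proof clarsimp
    fix k assume k: "n \<le> k" "grid n (Suc k) < b"
    show "k \<le> idx n b"
    proof (rule ccontr)
      assume "\<not> k \<le> idx n b"
      then have "grid n (Suc (idx n b)) \<le> grid n (Suc k)"
        using idx_ge[OF assms, of b] by (intro grid_mono[OF assms]) auto
      then show False using idx_upper[OF assms, of b] k by simp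
    qed
  qed
qed simp

text \<open>
  The steps that end before time \<open>b\<close> are consecutive and do not overlap. The union bounds over resets
  rest on this lemma.
\<close>

lemma sum_steps_below:
  assumes n: "1 \<le> n" "n \<le> m" "grid n m \<le> b"
  shows "sum h {k. m \<le> k \<and> grid n (Suc k) < b} \<le> b - grid n m"
proof -
  define S where "S = {k. m \<le> k \<and> grid n (Suc k) < b}"
  have fin: "finite S"
    using finite_grid_below[OF n(1), of b] by (rule finite_subset[rotated]) (use n in \<open>auto simp: S_def\<close>)
  show ?thesis
  proof (cases "S = {}")
    case True
    then show ?thesis using n unfolding S_def[symmetric] by simp
  next
    case False
    define K where "K = Max S"
    have K: "K \<in> S" "\<And>k. k \<in> S \<Longrightarrow> k \<le> K" using fin False by (auto simp: K_def)
    have "S \<subseteq> {m..<Suc K}"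
    proof
      fix k assume "k \<in> S"
      then show "k \<in> {m..<Suc K}" using K(2)[of k] by (simp add: S_def)
    qed
    then have "sum h S \<le> sum h {m..<Suc K}"
      using n h_pos by (intro sum_mono2) (auto simp: less_imp_le)
    also have "\<dots> = grid n (Suc K) - grid n m" using grid_split[of n m "Suc K"] K n by (auto simp: S_def)
    also have "\<dots> \<le> b - grid n m" using K(1) by (simp add: S_def)
    finally show ?thesis by (simp add: S_def)
  qed
qed

definition path :: "(nat \<Rightarrow> 'a::real_vector) \<Rightarrow> (nat \<Rightarrow> 'a) \<Rightarrow> nat \<Rightarrow> real \<Rightarrow> 'a" where
  "path a b n t = a (idx n t) - (t - grid n (idx n t)) *\<^sub>R b (idx n t)"

text \<open>
  The length of the intersection of \<open>[0,t]\<close> with step \<open>k\<close>.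
\<close>

definition overlap :: "nat \<Rightarrow> nat \<Rightarrow> real \<Rightarrow> real" where
  "overlap n k t = max 0 (min (t - grid n k) (h k))"

lemma sum_overlap:
  fixes x :: "nat \<Rightarrow> 'a::real_vector"
  assumes n: "1 \<le> n" and t: "0 \<le> t" "idx n t \<le> K"
  shows "(\<Sum>k=n..K. overlap n k t *\<^sub>R x k)
    = (\<Sum>k=n..<idx n t. h k *\<^sub>R x k) + (t - grid n (idx n t)) *\<^sub>R x (idx n t)"
proof -
  let ?i = "idx n t"
  have i: "n \<le> ?i" "grid n ?i \<le> t" "t < grid n (Suc ?i)"
    using idx_ge idx_lower idx_upper n t by auto
  have before: "overlap n k t = h k" if k: "n \<le> k" "k < ?i" for k
    using grid_mono[of n "Suc k" ?i] grid_Suc[of n k] h_pos[of k] i n k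
    by (auto simp: overlap_def)
  have at: "overlap n ?i t = t - grid n ?i" using i by (auto simp: overlap_def grid_Suc)
  have after: "overlap n k t = 0" if "?i < k" for k
    using grid_mono[of n "Suc ?i" k] i n that by (auto simp: overlap_def)
  have "{n..K} = {n..<?i} \<union> {?i} \<union> {?i<..K}" using i t by auto
  then have "(\<Sum>k=n..K. overlap n k t *\<^sub>R x k) = (\<Sum>k\<in>{n..<?i} \<union> {?i} \<union> {?i<..K}. overlap n k t *\<^sub>R x k)"
    by simp
  also have "\<dots> = (\<Sum>k\<in>{n..<?i}. overlap n k t *\<^sub>R x k) + overlap n ?i t *\<^sub>R x ?i
      + (\<Sum>k\<in>{?i<..K}. overlap n k t *\<^sub>R x k)"
    by (subst sum.union_disjoint; force)+
  also have "(\<Sum>k\<in>{?i<..K}. overlap n k t *\<^sub>R x k) = 0"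
    by (intro sum.neutral) (simp add: after)
  also have "(\<Sum>k\<in>{n..<?i}. overlap n k t *\<^sub>R x k) = (\<Sum>k=n..<?i. h k *\<^sub>R x k)"
    by (intro sum.cong) (simp_all add: before)
  finally show ?thesis by (simp add: at)
qed

lemma sum_overlap_total:
  assumes "1 \<le> n" "0 \<le> t" "idx n t \<le> K"
  shows "(\<Sum>k=n..K. overlap n k t) = t"
  using sum_overlap[OF assms, of "\<lambda>_. 1::real"] by (simp add: grid_def)

lemma overlap_increment:
  assumes "1 \<le> n" "n \<le> k" "s \<le> t"
  shows "0 \<le> overlap n k t - overlap n k s" "overlap n k t - overlap n k s \<le> h k"
proof -
  have "0 < h k" using h_pos[of k] assms by simp
  then show "0 \<le> overlap n k t - overlap n k s" "overlap n k t - overlap n k s \<le> h k"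
    using assms(3) unfolding overlap_def by linarith+
qed

text \<open>
  The integral over \<open>[0,t]\<close>, for \<open>t \<le> T\<close>, of the step function with the values \<open>b k\<close>. All these sums
  have the same range of indices, so that increments can be taken termwise.
\<close>

definition slope_integral :: "(nat \<Rightarrow> 'a::real_vector) \<Rightarrow> nat \<Rightarrow> real \<Rightarrow> real \<Rightarrow> 'a" where
  "slope_integral b n T t = (\<Sum>k=n..idx n T. overlap n k t *\<^sub>R b k)"

text \<open>
  Cauchy-Schwarz: an increment over an interval is at most the square root of its length times the
  square root of the energy.
\<close>

lemma half_holder_slope_integral:
  fixes b :: "nat \<Rightarrow> 'a::real_normed_vector"
  assumes n: "1 \<le> n" and energy: "(\<Sum>k=n..idx n T. h k * (norm (b k))\<^sup>2) \<le> C\<^sup>2" and C: "0 \<le> C"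
  shows "half_holder T C (slope_integral b n T)"
proof -
  have main: "norm (slope_integral b n T t - slope_integral b n T s) \<le> C * sqrt (t - s)"
    if st: "0 \<le> s" "s \<le> t" "t \<le> T" for s t
  proof -
    define d where "d k = overlap n k t - overlap n k s" for k
    let ?K = "idx n T"
    have d: "0 \<le> d k" "d k \<le> h k" if "n \<le> k" for k
      using overlap_increment[OF n that st(2)] by (auto simp: d_def)
    have "norm (slope_integral b n T t - slope_integral b n T s) = norm (\<Sum>k=n..?K. d k *\<^sub>R b k)"
      unfolding slope_integral_def d_def by (simp add: sum_subtractf scaleR_diff_left)
    also have "\<dots> \<le> (\<Sum>k=n..?K. d k * norm (b k))"
      by (intro sum_norm_le) (simp add: d)
    finally have "(norm (slope_integral b n T t - slope_integral b n T s))\<^sup>2 \<le> (\<Sum>k=n..?K. d k * norm (b k))\<^sup>2"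
      by (intro power_mono) auto
    also have "\<dots> = (\<Sum>k=n..?K. sqrt (d k) * (sqrt (d k) * norm (b k)))\<^sup>2"
      by (intro arg_cong[where f="\<lambda>x. x\<^sup>2"] sum.cong) (simp_all add: d flip: mult.assoc)
    also have "\<dots> \<le> (\<Sum>k=n..?K. (sqrt (d k))\<^sup>2) * (\<Sum>k=n..?K. (sqrt (d k) * norm (b k))\<^sup>2)"
      by (rule Cauchy_Schwarz_ineq_sum)
    also have "\<dots> = (\<Sum>k=n..?K. d k) * (\<Sum>k=n..?K. d k * (norm (b k))\<^sup>2)"
      by (intro arg_cong2[where f="(*)"] sum.cong) (simp_all add: d power_mult_distrib)
    also have "(\<Sum>k=n..?K. d k) = t - s"
      unfolding d_def sum_subtractf using n st idx_mono[OF n]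
      by (simp add: sum_overlap_total)
    also have "(\<Sum>k=n..?K. d k * (norm (b k))\<^sup>2) \<le> (\<Sum>k=n..?K. h k * (norm (b k))\<^sup>2)"
      by (intro sum_mono mult_right_mono) (simp_all add: d)
    also have "\<dots> \<le> C\<^sup>2" by (rule energy)
    finally have "(norm (slope_integral b n T t - slope_integral b n T s))\<^sup>2 \<le> (t - s) * C\<^sup>2"
      using st by (simp add: mult_left_mono)
    also have "\<dots> = (C * sqrt (t - s))\<^sup>2" using st by (simp add: power_mult_distrib)
    finally show ?thesis by (rule power2_le_imp_le) (use C st in simp)
  qed
  show ?thesis
    unfolding half_holder_def
  proof (intro ballI)
    fix s s' assume "s \<in> {0..T}" "s' \<in> {0..T}"
    then show "norm (slope_integral b n T s - slope_integral b n T s') \<le> C * sqrt \<bar>s - s'\<bar>"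
      using main[of s s'] main[of s' s] by (cases "s \<le> s'") (simp_all add: norm_minus_commute)
  qed
qed

text \<open>
  The difference \<open>c\<close> between the path and the continuous part \<open>B\<close> does not change within a step, and from
  one step to the next it changes only at a reset, where the path vanishes and \<open>c\<close> becomes \<open>- B\<close>.
\<close>

lemma path_in_holder_step_paths:
  fixes a b :: "nat \<Rightarrow> 'a::real_normed_vector"
  assumes n: "1 \<le> n" and T: "0 < T" and \<delta>: "0 < \<delta>" and C: "0 \<le> C"
    and reset: "\<And>k. n \<le> k \<Longrightarrow> a (Suc k) = (if J k then 0 else a k - h k *\<^sub>R b k)"
    and energy: "(\<Sum>k=n..idx n T. h k * (norm (b k))\<^sup>2) \<le> C\<^sup>2"
    and R: "norm (a n) \<le> R"
    and Z: "Z = {0, T} \<union> {grid n (Suc k) | k. n \<le> k \<and> J k \<and> grid n (Suc k) < T}"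
    and gap: "\<And>u v. u \<in> Z \<Longrightarrow> v \<in> Z \<Longrightarrow> u < v \<Longrightarrow> u + \<delta> \<le> v"
  shows "restrict (path a b n) {0..T} \<in> holder_step_paths T \<delta> (R + C * sqrt T) C"
proof -
  define B where "B t = - slope_integral b n T t" for t
  define c where "c i = a i + (\<Sum>k=n..<i. h k *\<^sub>R b k)" for i
  have hol: "half_holder T C B"
    using half_holder_slope_integral[OF n energy C] unfolding half_holder_def B_def
    by (simp add: norm_minus_commute)
  have B0: "B 0 = 0"
  proof -
    have "overlap n k 0 = 0" if "n \<le> k" for k
      unfolding overlap_def using grid_nonneg[OF n, of k] by (simp add: max_def min_def)
    then show ?thesis by (simp add: B_def slope_integral_def)
  qed
  have B_bound: "norm (B t) \<le> C * sqrt T" if "t \<in> {0..T}" for t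
  proof -
    have "0 \<in> {0..T}" using T by simp
    then have "norm (B t - B 0) \<le> C * sqrt \<bar>t - 0\<bar>"
      using hol that unfolding half_holder_def by blast
    also have "\<dots> \<le> C * sqrt T" using that C by (intro mult_left_mono) auto
    finally show ?thesis by (simp add: B0)
  qed
  have path_eq: "path a b n t = B t + c (idx n t)" if t: "t \<in> {0..T}" for t
  proof -
    have "slope_integral b n T t
      = (\<Sum>k=n..<idx n t. h k *\<^sub>R b k) + (t - grid n (idx n t)) *\<^sub>R b (idx n t)"
      unfolding slope_integral_def using t idx_mono[OF n, of t T] by (intro sum_overlap n) auto
    then show ?thesis by (simp add: path_def B_def c_def)
  qed
  have c_Suc: "c (Suc k) = (if J k then (\<Sum>i=n..<Suc k. h i *\<^sub>R b i) else c k)" if "n \<le> k" for k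
    using reset[OF that] that by (auto simp: c_def)
  have c_bound: "norm (c i) \<le> R + C * sqrt T" if "n \<le> i" "grid n i \<le> T" for i
    using that
  proof (induction i rule: dec_induct)
    case base
    have "0 \<le> C * sqrt T" using C T by simp
    then show ?case using R by (simp add: c_def)
  next
    case (step i)
    have gi: "grid n i \<le> T" using step.prems grid_mono[OF n step.hyps(1), of "Suc i"] by simp
    show ?case
    proof (cases "J i")
      case True
      have g: "grid n (Suc i) \<in> {0..T}" using grid_nonneg[OF n] step.prems by auto
      have idxg: "idx n (grid n (Suc i)) = Suc i"
        using n step.hyps grid_strict_mono[OF n, of "Suc i"] by (intro idx_eqI) auto
      have "slope_integral b n T (grid n (Suc i)) = (\<Sum>k=n..<Suc i. h k *\<^sub>R b k)"
        unfolding slope_integral_def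
        using idxg g idx_mono[OF n, of "grid n (Suc i)" T] n
        by (subst sum_overlap) auto
      then have "norm (c (Suc i)) = norm (B (grid n (Suc i)))"
        using True c_Suc[OF step.hyps(1)] by (simp add: B_def)
      then show ?thesis using B_bound[OF g] order_trans[OF norm_ge_zero R] by simp
    next
      case False
      then show ?thesis using c_Suc[OF step.hyps(1)] step.IH[OF gi] by simp
    qed
  qed
  have "Z \<subseteq> {0, T} \<union> (\<lambda>k. grid n (Suc k)) ` {n..idx n T}"
  proof
    fix z assume "z \<in> Z"
    moreover have "k \<le> idx n T" if "n \<le> k" "grid n (Suc k) < T" for k
    proof (rule ccontr)
      assume "\<not> k \<le> idx n T"
      then have "grid n (Suc (idx n T)) \<le> grid n (Suc k)" using idx_ge[OF n, of T] by (intro grid_mono[OF n]) auto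
      then show False using idx_upper[OF n, of T] that by simp
    qed
    ultimately show "z \<in> {0, T} \<union> (\<lambda>k. grid n (Suc k)) ` {n..idx n T}" unfolding Z by auto
  qed
  then have finZ: "finite Z" by (rule finite_subset) simp
  have rangeZ: "Z \<subseteq> {0..T}" using Z T grid_nonneg[OF n] by auto
  \<comment> \<open>The jump times in increasing order, including both ends of the
    interval.\<close>
  define ts where "ts = sorted_list_of_set Z"
  define m where "m = length ts - 2"
  have ts: "set ts = Z" "sorted_wrt (<) ts" using finZ by (simp_all add: ts_def)
  have "card {0, T} \<le> card Z" using Z finZ by (intro card_mono) auto
  then have "2 \<le> length ts" using T by (simp add: ts_def)
  then have len: "length ts = Suc (Suc m)" by (simp add: m_def)
  have strict: "ts ! i < ts ! j" if "i < j" "j < Suc (Suc m)" for i j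
    using sorted_wrt_nth_less[OF ts(2)] that len by simp
  have memZ: "ts ! j \<in> Z" if "j < Suc (Suc m)" for j using nth_mem[of j ts] that len ts by simp
  have ends: "ts ! 0 = 0" "ts ! Suc m = T"
  proof -
    have "0 \<in> set ts" "T \<in> set ts" using ts Z by auto
    then obtain i j where ij: "ts ! i = 0" "i < Suc (Suc m)" "ts ! j = T" "j < Suc (Suc m)"
      using len by (auto simp: in_set_conv_nth)
    show "ts ! 0 = 0"
      using strict[of 0 i] ij memZ[of 0] rangeZ by (cases "i = 0") auto
    show "ts ! Suc m = T"
      using strict[of j "Suc m"] ij memZ[of "Suc m"] rangeZ by (cases "j = Suc m") auto
  qed
  have sep: "separated_times T \<delta> m (\<lambda>j. ts ! j)"
    unfolding separated_times_def using ends gap[OF memZ memZ strict] by simp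
  have const: "c (idx n s) = c (idx n (ts ! j))"
    if j: "j \<le> m" and s: "s \<in> {ts ! j..<ts ! Suc j}" for j s
  proof -
    have jZ: "ts ! j \<in> {0..T}" "ts ! Suc j \<in> {0..T}" using memZ[of j] memZ[of "Suc j"] j rangeZ by auto
    have s0: "0 \<le> s" using s jZ by simp
    have le: "idx n (ts ! j) \<le> idx n s" using jZ s by (intro idx_mono n) auto
    have "i \<le> idx n s \<Longrightarrow> c i = c (idx n (ts ! j))" if "idx n (ts ! j) \<le> i" for i
      using that
    proof (induction i rule: dec_induct)
      case base
      show ?case ..
    next
      case (step i)
      have ni: "n \<le> i" using idx_ge[OF n] step.hyps(1) order_trans by blast
      have "\<not> J i"
      proof
        assume "J i"
        have upper: "grid n (Suc i) \<le> s"
          using grid_mono[OF n, of "Suc i" "idx n s"] step.prems idx_lower[OF n s0] ni by simp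
        have lower: "ts ! j < grid n (Suc i)"
          using grid_mono[OF n, of "Suc (idx n (ts ! j))" "Suc i"] step.hyps(1) idx_ge[OF n]
            idx_upper[OF n, of "ts ! j"] by (smt (verit) Suc_le_mono le_SucI)
        have "grid n (Suc i) \<in> Z" using upper s jZ \<open>J i\<close> ni by (auto simp: Z)
        then obtain i' where i': "i' < Suc (Suc m)" "ts ! i' = grid n (Suc i)"
          using ts len by (metis in_set_conv_nth)
        have "j < i'" using lower i' strict[of i' j] j by (cases "i' = j"; cases "i' < j") auto
        then have "ts ! Suc j \<le> ts ! i'" using strict[of "Suc j" i'] i' by (cases "Suc j = i'") auto
        then show False using i' upper s by simp
      qed
      then show ?case using c_Suc[OF ni] step by simp
    qed
    then show ?thesis using le by blast
  qed
  have "continuous_plus_step T m (\<lambda>j. ts ! j) B (\<lambda>j. c (idx n (ts ! j))) (restrict (path a b n) {0..T})"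
    unfolding continuous_plus_step_def
  proof (intro conjI allI ballI impI)
    fix j s assume j: "j \<le> m" and s: "s \<in> {ts ! j..<ts ! Suc j}"
    have "s \<in> {0..T}" using memZ[of j] memZ[of "Suc j"] j rangeZ s by auto
    then show "restrict (path a b n) {0..T} s = B s + c (idx n (ts ! j))"
      using path_eq const[OF j s] by simp
  qed (use path_eq[of T] ends T in auto)
  moreover have "norm (c (idx n (ts ! j))) \<le> R + C * sqrt T" if "j \<le> Suc m" for j
  proof (intro c_bound idx_ge n)
    have "ts ! j \<in> {0..T}" using memZ[of j] that rangeZ by auto
    then show "grid n (idx n (ts ! j)) \<le> T" using idx_lower[OF n, of "ts ! j"] by auto
  qed
  ultimately show ?thesis
    unfolding holder_step_paths_def using sep B0 hol
    by (intro CollectI exI[of _ m] exI[of _ "\<lambda>j. ts ! j"] exI[of _ B]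
        exI[of _ "\<lambda>j. c (idx n (ts ! j))"] conjI allI impI)
qed

end

section \<open>Measurability of gradients and of interpolated paths\<close>

text \<open>
  Along a sequence of simple functions \<open>S i\<close> converging to the identity, \<open>G (S i x) z\<close> converges to \<open>G x z\<close>
  by continuity, and it is jointly measurable because \<open>S i\<close> has finite range.
\<close>

lemma borel_measurable_caratheodory:
  fixes G :: "'a::{metric_space, second_countable_topology} \<Rightarrow> 'z \<Rightarrow> 'b::metric_space"
  assumes meas: "\<And>x. G x \<in> borel_measurable D"
    and cont: "\<And>z. z \<in> space D \<Longrightarrow> continuous_on UNIV (\<lambda>x. G x z)"
  shows "(\<lambda>(x, z). G x z) \<in> borel_measurable (borel \<Otimes>\<^sub>M D)"
proof -
  obtain S :: "nat \<Rightarrow> 'a \<Rightarrow> 'a" where S: "\<And>i. simple_function borel (S i)" "\<And>x. (\<lambda>i. S i x) \<longlonglongrightarrow> x"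
    using borel_measurable_implies_sequence_metric[of "\<lambda>x. x" borel undefined] by auto
  show ?thesis
  proof (rule borel_measurable_LIMSEQ_metric)
    fix i
    have fin: "finite (range (S i))" using S(1)[of i] by (simp add: simple_function_def)
    have "S i \<in> borel \<rightarrow>\<^sub>M count_space (range (S i))"
      using S(1)[of i] by (auto simp: measurable_count_space_eq2 simple_function_def)
    then have 1: "(\<lambda>p. S i (fst p)) \<in> borel \<Otimes>\<^sub>M D \<rightarrow>\<^sub>M count_space (range (S i))"
      by (rule measurable_compose[OF measurable_fst])
    have 2: "(\<lambda>p. G c (snd p)) \<in> borel_measurable (borel \<Otimes>\<^sub>M D)" for c
      by (rule measurable_compose[OF measurable_snd meas])
    show "(\<lambda>p. G (S i (fst p)) (snd p)) \<in> borel_measurable (borel \<Otimes>\<^sub>M D)"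
      by (rule measurable_compose_countable'[where f="\<lambda>c p. G c (snd p)", OF 2 1 countable_finite[OF fin]])
  next
    fix p :: "'a \<times> 'z" assume "p \<in> space (borel \<Otimes>\<^sub>M D)"
    then have z: "snd p \<in> space D" by (auto simp: space_pair_measure)
    have "isCont (\<lambda>x. G x (snd p)) (fst p)"
      using cont[OF z] by (simp add: continuous_on_eq_continuous_at)
    then show "(\<lambda>i. G (S i (fst p)) (snd p)) \<longlonglongrightarrow> (case p of (x, z) \<Rightarrow> G x z)"
      using isCont_tendsto_compose[OF _ S(2)] by (simp add: split_beta)
  qed
qed

lemma GDERIV_difference_quotient:
  fixes f :: "'a::real_inner \<Rightarrow> real"
  assumes "GDERIV f x :> D"
  shows "(\<lambda>n. (f (x + inverse (real (Suc n)) *\<^sub>R b) - f x) * real (Suc n)) \<longlonglongrightarrow> D \<bullet> b"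
proof -
  have f: "(f has_derivative (\<lambda>h. h \<bullet> D)) (at (x + 0 *\<^sub>R b))" using assms by (simp add: gderiv_def)
  have "((\<lambda>t. f (x + t *\<^sub>R b)) has_derivative (\<lambda>t. (t *\<^sub>R b) \<bullet> D)) (at 0)"
  proof (rule has_derivative_compose[of "\<lambda>t. x + t *\<^sub>R b" "\<lambda>t. t *\<^sub>R b" 0 UNIV f "\<lambda>h. h \<bullet> D"])
    show "((\<lambda>t. x + t *\<^sub>R b) has_derivative (\<lambda>t. t *\<^sub>R b)) (at 0)"
      by (auto intro!: derivative_eq_intros)
  qed (rule f)
  then have "DERIV (\<lambda>t. f (x + t *\<^sub>R b)) 0 :> D \<bullet> b"
    by (simp add: has_field_derivative_def inner_commute mult_commute_abs)
  then have lim: "((\<lambda>h. (f (x + h *\<^sub>R b) - f x) / h) \<longlongrightarrow> D \<bullet> b) (at 0)"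
    by (simp add: DERIV_def)
  have "filterlim (\<lambda>n. inverse (real (Suc n))) (at 0) sequentially"
    unfolding filterlim_at using LIMSEQ_inverse_real_of_nat by simp
  from filterlim_compose[OF lim this] show ?thesis by (simp add: divide_inverse)
qed

text \<open>
  Each component of the gradient is a limit of difference quotients of a Caratheodory function.
\<close>

lemma borel_measurable_gradient:
  fixes F :: "'a::euclidean_space \<Rightarrow> 'z \<Rightarrow> real"
  assumes meas: "\<And>x. F x \<in> borel_measurable D"
    and grad: "\<And>x z. z \<in> space D \<Longrightarrow> GDERIV (\<lambda>y. F y z) x :> dF x z"
  shows "(\<lambda>(x, z). dF x z) \<in> borel_measurable (borel \<Otimes>\<^sub>M D)"
proof (rule borel_measurable_euclidean_space[THEN iffD2], rule ballI)
  fix b :: 'a assume "b \<in> Basis"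
  have cont: "continuous_on UNIV (\<lambda>x. F x z)" if "z \<in> space D" for z
  proof -
    have "isCont (\<lambda>x. F x z) x" for x
      using grad[OF that, of x] unfolding gderiv_def by (rule has_derivative_continuous)
    then show ?thesis by (simp only: continuous_on_eq_continuous_at[OF open_UNIV]) blast
  qed
  have F: "(\<lambda>(x, z). F x z) \<in> borel_measurable (borel \<Otimes>\<^sub>M D)"
    by (rule borel_measurable_caratheodory[OF meas cont])
  show "(\<lambda>p. (case p of (x, z) \<Rightarrow> dF x z) \<bullet> b) \<in> borel_measurable (borel \<Otimes>\<^sub>M D)"
  proof (rule borel_measurable_LIMSEQ_metric)
    fix n
    have "(\<lambda>p. (fst p + inverse (real (Suc n)) *\<^sub>R b, snd p)) \<in> borel \<Otimes>\<^sub>M D \<rightarrow>\<^sub>M borel \<Otimes>\<^sub>M D"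
      by measurable
    from measurable_compose[OF this F]
    show "(\<lambda>p. (F (fst p + inverse (real (Suc n)) *\<^sub>R b) (snd p) - F (fst p) (snd p)) * real (Suc n))
        \<in> borel_measurable (borel \<Otimes>\<^sub>M D)"
      using F by (simp add: split_beta)
  next
    fix p :: "'a \<times> 'z" assume "p \<in> space (borel \<Otimes>\<^sub>M D)"
    then have "snd p \<in> space D" by (auto simp: space_pair_measure)
    from GDERIV_difference_quotient[OF grad[OF this], of "fst p" b]
    show "(\<lambda>n. (F (fst p + inverse (real (Suc n)) *\<^sub>R b) (snd p) - F (fst p) (snd p)) * real (Suc n))
        \<longlonglongrightarrow> (case p of (x, z) \<Rightarrow> dF x z) \<bullet> b"
      by (simp add: split_beta)
  qed
qed

context time_grid
begin

lemma path_cadlag: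
  fixes a b :: "nat \<Rightarrow> 'a::real_normed_vector"
  assumes n: "1 \<le> n"
  shows "restrict (path a b n) {0..T} \<in> cadlag_paths T"
proof -
  define piece where "piece i t = a i - (t - grid n i) *\<^sub>R b i" for i t
  have piece: "path a b n t = piece i t" if "n \<le> i" "grid n i \<le> t" "t < grid n (Suc i)" for i t
    using idx_eqI[OF n that] by (simp add: path_def piece_def)
  have cont: "(piece i \<longlongrightarrow> piece i t) F" if "F \<le> at t" for i t F
    using that unfolding piece_def by (intro tendsto_intros tendsto_mono[OF that] tendsto_ident_at)
  have r: "(restrict (path a b n) {0..T} \<longlongrightarrow> restrict (path a b n) {0..T} t) (at_right t)"
    if t: "t \<in> {0..<T}" for t
  proof -
    let ?i = "idx n t"
    have i: "n \<le> ?i" "grid n ?i \<le> t" "t < grid n (Suc ?i)" using idx_ge idx_lower idx_upper n t by auto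
    have "eventually (\<lambda>s. piece ?i s = restrict (path a b n) {0..T} s) (at_right t)"
      unfolding eventually_at_right_field
      using piece[OF i(1)] i t by (intro exI[of _ "min T (grid n (Suc ?i))"]) auto
    moreover have "(piece ?i \<longlongrightarrow> piece ?i t) (at_right t)" by (intro cont at_le) simp
    ultimately show ?thesis
      using piece[OF i] t Lim_transform_eventually[of "piece ?i" "piece ?i t"] by simp
  qed
  have l: "\<exists>y. (restrict (path a b n) {0..T} \<longlongrightarrow> y) (at_left t)" if t: "t \<in> {0<..T}" for t
  proof -
    obtain i where i: "n \<le> i" "grid n i < t" "t \<le> grid n (Suc i)"
    proof (cases "grid n (idx n t) < t")
      case True
      then show thesis using that[of "idx n t"] idx_ge[OF n, of t] idx_upper[OF n, of t] by simp
    next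
      case False
      then have g: "grid n (idx n t) = t" using idx_lower[OF n, of t] t by simp
      then have "idx n t \<noteq> n" using t grid_start[of n] by (metis greaterThanAtMost_iff less_irrefl)
      then obtain i where "idx n t = Suc i" "n \<le> i" using idx_ge[OF n, of t] by (cases "idx n t") auto
      then show thesis using that[of i] grid_strict_mono[OF n, of i "Suc i"] g by simp
    qed
    have "eventually (\<lambda>s. piece i s = restrict (path a b n) {0..T} s) (at_left t)"
      unfolding eventually_at_left_field
      using piece[OF i(1)] i t grid_nonneg[OF n, of i] by (intro exI[of _ "grid n i"]) auto
    moreover have "(piece i \<longlongrightarrow> piece i t) (at_left t)" by (intro cont at_le) simp
    ultimately show ?thesis using Lim_transform_eventually by blast
  qed
  show ?thesis unfolding cadlag_paths_def using r l by simp
qed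

text \<open>
  On \<open>[0,T]\<close> the path depends on finitely many positions and velocities only, and it depends on them
  continuously in the supremum distance, which dominates the Skorokhod distance.
\<close>

lemma continuous_path_of_data:
  fixes U :: "(real \<Rightarrow> 'a::real_normed_vector) set"
  assumes n: "1 \<le> n" and T: "0 < T" and U: "openin (skorokhod_topology T) U"
  shows "open ((\<lambda>q. restrict (path (\<lambda>k. fst (q k)) (\<lambda>k. snd (q k)) n) {0..T}) -` U)" (is "open (?\<Phi> -` U)")
proof (subst open_subopen, rule ballI)
  interpret Metric_space "cadlag_paths T :: (real \<Rightarrow> 'a) set" "skorokhod_dist T"
    by (rule Metric_space_skorokhod[OF T])
  fix p :: "nat \<Rightarrow> 'a \<times> 'a" assume "p \<in> ?\<Phi> -` U"
  then obtain r where r: "0 < r" "mball (?\<Phi> p) r \<subseteq> U"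
    using U by (auto simp: skorokhod_topology_def openin_mtopology)
  define e where "e = r / 2 / (1 + T)"
  define V where "V = (\<Inter>k\<in>{n..idx n T}. (\<lambda>q :: nat \<Rightarrow> 'a \<times> 'a. q k) -` ball (p k) e)"
  have "1 + T \<noteq> 0" using T by simp
  then have "e * (1 + T) = r / 2" using nonzero_eq_divide_eq[of "1 + T" e "r / 2"] e_def by blast
  then have e: "0 < e" "e + T * e = r / 2"
    using r(1) T by (simp add: e_def, simp only: distrib_left mult_1_right mult.commute)
  have "open V"
    unfolding V_def by (intro open_INT finite_atLeastAtMost ballI open_vimage open_ball) simp
  moreover have "p \<in> V" using e by (simp add: V_def)
  moreover have "V \<subseteq> ?\<Phi> -` U"
  proof
    fix q assume q: "q \<in> V"
    have close: "dist (path (\<lambda>k. fst (p k)) (\<lambda>k. snd (p k)) n t) (path (\<lambda>k. fst (q k)) (\<lambda>k. snd (q k)) n t) \<le> r / 2"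
      if t: "t \<in> {0..T}" for t
    proof -
      let ?i = "idx n t"
      have "?i \<in> {n..idx n T}" using idx_ge[OF n, of t] idx_mono[OF n, of t T] t by auto
      then have "dist (p ?i) (q ?i) < e" using q by (simp add: V_def)
      then have "dist (fst (p ?i)) (fst (q ?i)) \<le> e" "dist (snd (p ?i)) (snd (q ?i)) \<le> e"
        using dist_fst_le[of "p ?i" "q ?i"] dist_snd_le[of "p ?i" "q ?i"] by linarith+
      then have d: "norm (fst (p ?i) - fst (q ?i)) \<le> e" "norm (snd (p ?i) - snd (q ?i)) \<le> e"
        by (simp_all add: dist_norm)
      have s: "0 \<le> t - grid n ?i" "t - grid n ?i \<le> T"
        using idx_lower[OF n, of t] t grid_nonneg[OF n, of ?i] by auto
      have "dist (path (\<lambda>k. fst (p k)) (\<lambda>k. snd (p k)) n t) (path (\<lambda>k. fst (q k)) (\<lambda>k. snd (q k)) n t)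
        = norm ((fst (p ?i) - fst (q ?i)) - (t - grid n ?i) *\<^sub>R (snd (p ?i) - snd (q ?i)))"
        by (simp add: path_def dist_norm algebra_simps)
      also have "\<dots> \<le> norm (fst (p ?i) - fst (q ?i)) + (t - grid n ?i) * norm (snd (p ?i) - snd (q ?i))"
        using s by (intro order_trans[OF norm_triangle_ineq4]) simp
      also have "\<dots> \<le> e + T * e" using d s e by (intro add_mono mult_mono) auto
      finally show ?thesis by (simp add: e)
    qed
    have "skorokhod_close T (?\<Phi> p) (?\<Phi> q) (r / 2)"
      unfolding skorokhod_close_def
      using close r by (intro bexI[OF _ time_changes_id]) simp
    from skorokhod_dist_le[OF path_cadlag[OF n] path_cadlag[OF n] _ this]
    have "skorokhod_dist T (?\<Phi> p) (?\<Phi> q) < r" using r(1) by linarith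
    then have "?\<Phi> q \<in> mball (?\<Phi> p) r"
      unfolding in_mball by (intro conjI path_cadlag n)
    then show "q \<in> ?\<Phi> -` U" using r(2) by (simp add: subset_iff)
  qed
  ultimately show "\<exists>V. open V \<and> p \<in> V \<and> V \<subseteq> ?\<Phi> -` U" by blast
qed

text \<open>
  The random path is a continuous image of the sequence of its positions and velocities, whose
  measurability can be checked coordinatewise.
\<close>

lemma measurable_path:
  fixes a b :: "nat \<Rightarrow> 'w \<Rightarrow> 'a::euclidean_space"
  assumes n: "1 \<le> n" and T: "0 < T"
    and meas: "\<And>k. n \<le> k \<Longrightarrow> a k \<in> borel_measurable M" "\<And>k. n \<le> k \<Longrightarrow> b k \<in> borel_measurable M"
  shows "(\<lambda>w. restrict (path (\<lambda>k. a k w) (\<lambda>k. b k w) n) {0..T}) \<in> M \<rightarrow>\<^sub>M borel_sigma (skorokhod_topology T)"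
proof -
  interpret Metric_space "cadlag_paths T :: (real \<Rightarrow> 'a) set" "skorokhod_dist T"
    by (rule Metric_space_skorokhod[OF T])
  let ?\<Phi> = "\<lambda>q. restrict (path (\<lambda>k. fst (q k)) (\<lambda>k. snd (q k)) n) {0..T} :: real \<Rightarrow> 'a"
  \<comment> \<open>The path does not see the entries below \<open>n\<close>, so they are
    replaced by a measurable dummy.\<close>
  define data where "data w k = (if n \<le> k then (a k w, b k w) else (0, 0))" for w k
  have "(\<lambda>w. data w k) \<in> borel_measurable M" for k
    using meas[of k] by (cases "n \<le> k") (simp_all add: data_def borel_measurable_Pair)
  then have data: "data \<in> borel_measurable M"
    by (rule measurable_coordinatewise_then_product)
  have "?\<Phi> \<in> borel \<rightarrow>\<^sub>M borel_sigma (skorokhod_topology T)"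
    unfolding borel_sigma_def
  proof (rule measurable_measure_of)
    show "{U. openin (skorokhod_topology T) U} \<subseteq> Pow (topspace (skorokhod_topology T))"
      using openin_subset by blast
    show "?\<Phi> \<in> space borel \<rightarrow> topspace (skorokhod_topology T)"
      using path_cadlag[OF n] by (auto simp: skorokhod_topology_def)
    fix U :: "(real \<Rightarrow> 'a) set" assume "U \<in> {U. openin (skorokhod_topology T) U}"
    then show "?\<Phi> -` U \<inter> space borel \<in> sets borel"
      using continuous_path_of_data[OF n T, of U] by simp
  qed
  from measurable_compose[OF data this]
  have "(\<lambda>w. ?\<Phi> (data w)) \<in> M \<rightarrow>\<^sub>M borel_sigma (skorokhod_topology T)" .
  moreover have "?\<Phi> (data w) = restrict (path (\<lambda>k. a k w) (\<lambda>k. b k w) n) {0..T}" for w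
    using idx_ge[OF n] by (simp add: path_def data_def restrict_def fun_eq_iff)
  ultimately show ?thesis by simp
qed

end

section \<open>Tools from linear algebra, convexity and probability\<close>

lemma orthogonal_projection_span:
  fixes B :: "'a::euclidean_space set"
  shows orthogonal_projection_in: "orthogonal_projection (span B) x \<in> span B"
    and orthogonal_projection_orthogonal: "z \<in> span B \<Longrightarrow> orthogonal (x - orthogonal_projection (span B) x) z"
    and orthogonal_projection_unique:
      "y \<in> span B \<Longrightarrow> (\<And>z. z \<in> span B \<Longrightarrow> orthogonal (x - y) z) \<Longrightarrow> orthogonal_projection (span B) x = y"
proof -
  let ?Q = "\<lambda>y. y \<in> span B \<and> (\<forall>z\<in>span B. orthogonal (x - y) z)"
  have uniq: "y = y'" if "?Q y" "?Q y'" for y y'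
  proof -
    have "y - y' \<in> span B" using that span_diff by blast
    then have "(x - y') \<bullet> (y - y') = 0" "(x - y) \<bullet> (y - y') = 0"
      using that by (simp_all add: orthogonal_def)
    then have "(y - y') \<bullet> (y - y') = 0" by (simp add: inner_diff_left)
    then show ?thesis by simp
  qed
  obtain u v where "u \<in> span B" "\<And>w. w \<in> span B \<Longrightarrow> orthogonal v w" "x = u + v"
    using orthogonal_subspace_decomp_exists by metis
  then have "?Q u" by simp
  then have ex: "\<exists>!y. ?Q y" using uniq by blast
  from theI'[OF ex] show "orthogonal_projection (span B) x \<in> span B"
    "z \<in> span B \<Longrightarrow> orthogonal (x - orthogonal_projection (span B) x) z"
    unfolding orthogonal_projection_def by blast+
  show "orthogonal_projection (span B) x = y"
    if "y \<in> span B" "\<And>z. z \<in> span B \<Longrightarrow> orthogonal (x - y) z"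
    unfolding orthogonal_projection_def using that uniq by (intro the_equality) blast+
qed

lemma linear_orthogonal_projection:
  fixes B :: "'a::euclidean_space set"
  shows "linear (orthogonal_projection (span B))"
proof
  let ?P = "orthogonal_projection (span B)"
  fix x y :: 'a and c :: real
  show "?P (x + y) = ?P x + ?P y"
  proof (rule orthogonal_projection_unique)
    show "?P x + ?P y \<in> span B" by (intro span_add orthogonal_projection_in)
    show "orthogonal (x + y - (?P x + ?P y)) z" if "z \<in> span B" for z
      using orthogonal_projection_orthogonal[OF that, of x] orthogonal_projection_orthogonal[OF that, of y]
      by (simp add: orthogonal_def inner_diff_left inner_add_left)
  qed
  show "?P (c *\<^sub>R x) = c *\<^sub>R ?P x"
  proof (rule orthogonal_projection_unique)
    show "c *\<^sub>R ?P x \<in> span B" by (intro span_scale orthogonal_projection_in)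
    show "orthogonal (c *\<^sub>R x - c *\<^sub>R ?P x) z" if "z \<in> span B" for z
      using orthogonal_projection_orthogonal[OF that, of x]
      by (simp add: orthogonal_def inner_diff_left)
  qed
qed

lemma norm_orthogonal_projection:
  fixes B :: "'a::euclidean_space set"
  shows "(norm x)\<^sup>2 = (norm (orthogonal_projection (span B) x))\<^sup>2 + (norm (x - orthogonal_projection (span B) x))\<^sup>2"
proof -
  let ?P = "orthogonal_projection (span B) x"
  have "orthogonal (x - ?P) ?P" by (intro orthogonal_projection_orthogonal orthogonal_projection_in)
  from norm_add_Pythagorean[OF this] show ?thesis by simp
qed

lemma abs_diagonal_le_spectral_norm:
  fixes B :: "real ^ 'n ^ 'n"
  shows "\<bar>B $ i $ i\<bar> \<le> spectral_norm B"
proof -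
  have "norm (B *v axis i 1) \<le> onorm (\<lambda>u. B *v u) * norm (axis i (1::real))"
    by (intro onorm matrix_vector_mul_bounded_linear)
  moreover have "\<bar>(B *v axis i 1) $ i\<bar> \<le> norm (B *v axis i 1)" by (rule component_le_norm_cart)
  moreover have "(B *v axis i 1) $ i = B $ i $ i"
    by (simp add: matrix_vector_mul_component inner_axis)
  ultimately show ?thesis by (simp add: spectral_norm_def)
qed

text \<open>
  The defining inequality at the points \<open>x + t n *\<^sub>R (y - x)\<close>, divided by \<open>t n\<close>, with \<open>t n\<close> tending to 0.
\<close>

lemma strongly_convex_gradient_le:
  fixes f :: "'a::real_inner \<Rightarrow> real"
  assumes conv: "strongly_convex \<mu> f" and grad: "GDERIV f x :> D"
  shows "f x + D \<bullet> (y - x) + \<mu> / 2 * (norm (x - y))\<^sup>2 \<le> f y"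
proof -
  define t where "t n = inverse (real (Suc n))" for n
  have t: "0 < t n" "t n \<le> 1" for n by (simp_all add: t_def field_simps)
  have "(f (x + t n *\<^sub>R (y - x)) - f x) * real (Suc n) \<le> f y - f x - \<mu> / 2 * (1 - t n) * (norm (x - y))\<^sup>2" for n
  proof -
    have "f ((1 - t n) *\<^sub>R x + t n *\<^sub>R y) \<le> (1 - t n) * f x + t n * f y - \<mu> / 2 * t n * (1 - t n) * (norm (x - y))\<^sup>2"
      using conv t[of n] by (simp add: strongly_convex_def)
    moreover have "(1 - t n) *\<^sub>R x + t n *\<^sub>R y = x + t n *\<^sub>R (y - x)" by (simp add: algebra_simps)
    ultimately have "f (x + t n *\<^sub>R (y - x)) - f x \<le> t n * (f y - f x - \<mu> / 2 * (1 - t n) * (norm (x - y))\<^sup>2)"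
      by (simp add: algebra_simps)
    then have "(f (x + t n *\<^sub>R (y - x)) - f x) * real (Suc n)
        \<le> t n * (f y - f x - \<mu> / 2 * (1 - t n) * (norm (x - y))\<^sup>2) * real (Suc n)"
      by (intro mult_right_mono) simp_all
    also have "\<dots> = f y - f x - \<mu> / 2 * (1 - t n) * (norm (x - y))\<^sup>2" by (simp add: t_def)
    finally show ?thesis .
  qed
  moreover have "(\<lambda>n. (f (x + t n *\<^sub>R (y - x)) - f x) * real (Suc n)) \<longlonglongrightarrow> D \<bullet> (y - x)"
    unfolding t_def by (rule GDERIV_difference_quotient[OF grad])
  moreover have "t \<longlonglongrightarrow> 0" unfolding t_def by (rule LIMSEQ_inverse_real_of_nat)
  then have "(\<lambda>n. f y - f x - \<mu> / 2 * (1 - t n) * (norm (x - y))\<^sup>2)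
      \<longlonglongrightarrow> f y - f x - \<mu> / 2 * (1 - 0) * (norm (x - y))\<^sup>2"
    by (intro tendsto_intros)
  ultimately have "D \<bullet> (y - x) \<le> f y - f x - \<mu> / 2 * (1 - 0) * (norm (x - y))\<^sup>2"
    by (intro LIMSEQ_le) auto
  then show ?thesis by simp
qed

lemma strongly_convex_monotone_gradient:
  fixes f :: "'a::real_inner \<Rightarrow> real"
  assumes "strongly_convex \<mu> f" "GDERIV f x :> Dx" "GDERIV f y :> Dy"
  shows "\<mu> * (norm (x - y))\<^sup>2 \<le> (x - y) \<bullet> (Dx - Dy)"
  using strongly_convex_gradient_le[OF assms(1,2), of y] strongly_convex_gradient_le[OF assms(1,3), of x]
  by (simp add: algebra_simps norm_minus_commute inner_commute)

text \<open>
  Independence is stated for preimages because the two variables may have different types.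
\<close>

lemma (in prob_space) nn_integral_independent_pair:
  assumes X: "X \<in> M \<rightarrow>\<^sub>M S" and Y: "Y \<in> M \<rightarrow>\<^sub>M T"
    and ind: "\<And>A B. A \<in> sets S \<Longrightarrow> B \<in> sets T \<Longrightarrow>
      prob ((X -` A \<inter> space M) \<inter> (Y -` B \<inter> space M)) = prob (X -` A \<inter> space M) * prob (Y -` B \<inter> space M)"
    and g: "g \<in> borel_measurable (S \<Otimes>\<^sub>M T)"
  shows "(\<integral>\<^sup>+w. g (X w, Y w) \<partial>M) = (\<integral>\<^sup>+w. (\<integral>\<^sup>+w'. g (X w, Y w') \<partial>M) \<partial>M)"
proof -
  interpret X: prob_space "distr M S X" by (rule prob_space_distr[OF X])
  interpret Y: prob_space "distr M T Y" by (rule prob_space_distr[OF Y])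
  have eq: "distr M S X \<Otimes>\<^sub>M distr M T Y = distr M (S \<Otimes>\<^sub>M T) (\<lambda>w. (X w, Y w))"
  proof (rule pair_measure_eqI)
    fix A B assume A: "A \<in> sets (distr M S X)" and B: "B \<in> sets (distr M T Y)"
    have "(\<lambda>w. (X w, Y w)) -` (A \<times> B) \<inter> space M = (X -` A \<inter> space M) \<inter> (Y -` B \<inter> space M)" by auto
    moreover have "A \<times> B \<in> sets (S \<Otimes>\<^sub>M T)" using A B by (intro pair_measureI) simp_all
    ultimately show "emeasure (distr M S X) A * emeasure (distr M T Y) B
        = emeasure (distr M (S \<Otimes>\<^sub>M T) (\<lambda>w. (X w, Y w))) (A \<times> B)"
      using A B X Y ind[of A B]
      by (simp add: emeasure_distr measurable_Pair emeasure_eq_measure ennreal_mult)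
  qed (simp_all add: X.sigma_finite_measure_axioms Y.sigma_finite_measure_axioms cong: sets_pair_measure_cong)
  have g': "g \<in> borel_measurable (distr M S X \<Otimes>\<^sub>M distr M T Y)" using g by simp
  have "(\<integral>\<^sup>+w. g (X w, Y w) \<partial>M) = integral\<^sup>N (distr M (S \<Otimes>\<^sub>M T) (\<lambda>w. (X w, Y w))) g"
    using X Y g by (simp add: nn_integral_distr)
  also have "\<dots> = (\<integral>\<^sup>+x. (\<integral>\<^sup>+y. g (x, y) \<partial>distr M T Y) \<partial>distr M S X)"
    unfolding eq[symmetric] by (rule Y.nn_integral_fst[OF g', symmetric])
  also have "\<dots> = (\<integral>\<^sup>+w. (\<integral>\<^sup>+y. g (X w, y) \<partial>distr M T Y) \<partial>M)"
    using g' by (intro nn_integral_distr X) (simp add: Y.borel_measurable_nn_integral_fst)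
  also have "\<dots> = (\<integral>\<^sup>+w. (\<integral>\<^sup>+w'. g (X w, Y w') \<partial>M) \<partial>M)"
  proof (rule nn_integral_cong)
    fix w assume "w \<in> space M"
    then have "X w \<in> space S" using X by (rule measurable_space[rotated])
    then show "(\<integral>\<^sup>+y. g (X w, y) \<partial>distr M T Y) = (\<integral>\<^sup>+w'. g (X w, Y w') \<partial>M)"
      using measurable_compose[OF measurable_Pair1' g, of "X w"] by (intro nn_integral_distr Y) (simp add: o_def)
  qed
  finally show ?thesis .
qed

text \<open>
  The bound \<open>C\<close> dominates the finitely many values before the contraction sets in, and it is at least
  \<open>c / \<kappa>\<close>, the fixed point of the contracting recursion.
\<close>

lemma contracting_recursion_bounded:
  fixes \<Delta> :: "nat \<Rightarrow> ennreal"
  assumes start: "\<Delta> 1 < \<infinity>"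
    and step: "\<And>n. 1 \<le> n \<Longrightarrow> \<Delta> (Suc n) \<le> ennreal A * \<Delta> n + ennreal B"
    and contract: "\<And>n. N \<le> n \<Longrightarrow> 1 \<le> n \<Longrightarrow> \<Delta> (Suc n) \<le> ennreal (1 - \<kappa> * e n) * \<Delta> n + ennreal (e n * c)"
    and e: "\<And>n. N \<le> n \<Longrightarrow> 0 \<le> e n \<and> \<kappa> * e n \<le> 1" and \<kappa>: "0 < \<kappa>" and c: "0 \<le> c"
  shows "\<exists>C\<ge>0. \<forall>n\<ge>1. \<Delta> n \<le> ennreal C"
proof -
  have fin: "\<Delta> n < \<infinity>" if "1 \<le> n" for n
    using that
  proof (induction n rule: dec_induct)
    case (step n)
    then have "ennreal A * \<Delta> n + ennreal B < \<infinity>" by (simp add: ennreal_mult_less_top)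
    then show ?case using assms(2)[OF step.hyps(1)] by (rule le_less_trans[rotated])
  qed (rule start)
  define N1 where "N1 = max 1 N"
  define C where "C = Max (insert (c / \<kappa>) ((\<lambda>n. enn2real (\<Delta> n)) ` {1..N1}))"
  have C: "c / \<kappa> \<le> C" "\<And>n. n \<in> {1..N1} \<Longrightarrow> enn2real (\<Delta> n) \<le> C"
    unfolding C_def by (rule Max_ge; simp)+
  have C0: "0 \<le> C" 
    by (rule order_trans[OF _ C(1)]) (use c \<kappa> in simp)
  have early: "\<Delta> n \<le> ennreal C" if "n \<in> {1..N1}" for n
  proof -
    have "\<Delta> n = ennreal (enn2real (\<Delta> n))" using fin[of n] that by (simp add: ennreal_enn2real_if)
    also have "\<dots> \<le> ennreal C" using C(2)[OF that] by (rule ennreal_leI)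
    finally show ?thesis .
  qed
  have late_reset: "\<Delta> n \<le> ennreal C" if "N1 \<le> n" for n
    using that
  proof (induction n rule: dec_induct)
    case base
    then show ?case using early[of N1] by (simp add: N1_def)
  next
    case (step n)
    have n: "N \<le> n" "1 \<le> n" using step.hyps by (auto simp: N1_def)
    have "\<Delta> (Suc n) \<le> ennreal (1 - \<kappa> * e n) * \<Delta> n + ennreal (e n * c)" by (rule contract[OF n])
    also have "\<dots> \<le> ennreal (1 - \<kappa> * e n) * ennreal C + ennreal (e n * c)"
      by (intro add_right_mono mult_left_mono step.IH) simp
    also have "\<dots> = ennreal ((1 - \<kappa> * e n) * C + e n * c)"
      using e[OF n(1)] C0 c by (simp add: ennreal_mult ennreal_plus)
    also have "\<dots> \<le> ennreal C"
    proof (rule ennreal_leI)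
      have "c \<le> \<kappa> * C" using C(1) \<kappa> by (simp add: field_simps)
      then have "e n * c \<le> e n * (\<kappa> * C)" using e[OF n(1)] by (intro mult_left_mono) auto
      then show "(1 - \<kappa> * e n) * C + e n * c \<le> C" by (simp add: algebra_simps)
    qed
    finally show ?case .
  qed
  have "\<Delta> n \<le> ennreal C" if "1 \<le> n" for n
    using early[of n] late_reset[of n] that by (cases "n \<le> N1") auto
  then show ?thesis using C0 by blast
qed

text \<open>
  The weighted form of \<open>2 * x * y \<le> x\<^sup>2 + y\<^sup>2\<close>: a small \<open>\<theta>\<close> hardly enlarges the first square.
\<close>

lemma norm_diff_square_le:
  fixes a b :: "'a::real_inner"
  assumes "0 < \<theta>"
  shows "(norm (a - b))\<^sup>2 \<le> (1 + \<theta>) * (norm a)\<^sup>2 + (1 + 1 / \<theta>) * (norm b)\<^sup>2"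
proof -
  have "(norm (a - b))\<^sup>2 \<le> (norm a + norm b)\<^sup>2" by (intro power_mono norm_triangle_ineq4) simp
  also have "\<dots> = (norm a)\<^sup>2 + 2 * norm a * norm b + (norm b)\<^sup>2" by (simp add: power2_sum)
  also have "2 * norm a * norm b \<le> \<theta> * (norm a)\<^sup>2 + (norm b)\<^sup>2 / \<theta>"
  proof -
    have "0 \<le> (\<theta> * norm a - norm b)\<^sup>2 / \<theta>" using assms by simp
    also have "\<dots> = \<theta> * (norm a)\<^sup>2 - 2 * norm a * norm b + (norm b)\<^sup>2 / \<theta>"
      using assms by (simp add: field_simps power2_eq_square)
    finally show ?thesis by simp
  qed
  finally show ?thesis by (simp add: algebra_simps)
qed

lemma (in prob_space) prob_greater_le_of_nn_integral:
  assumes X: "X \<in> borel_measurable M" and B: "(\<integral>\<^sup>+w. ennreal (X w) \<partial>M) \<le> ennreal B"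
    and "0 \<le> B" "0 < t" "B \<le> t * e"
  shows "prob {w \<in> space M. t < X w} \<le> e"
proof -
  have ev: "{w \<in> space M. t < X w} \<in> sets M" using X by measurable
  have "ennreal (t * prob {w \<in> space M. t < X w}) = (\<integral>\<^sup>+w. ennreal t * indicator {w \<in> space M. t < X w} w \<partial>M)"
    using ev assms(4) by (simp add: nn_integral_cmult_indicator emeasure_eq_measure ennreal_mult)
  also have "\<dots> \<le> (\<integral>\<^sup>+w. ennreal (X w) \<partial>M)"
    using assms(4) by (intro nn_integral_mono) (auto simp: indicator_def intro!: ennreal_leI)
  also have "\<dots> \<le> ennreal B" by (rule B)
  finally have "t * prob {w \<in> space M. t < X w} \<le> t * e" using assms(3,5) by (simp add: ennreal_le_iff)
  then show ?thesis using assms(4) by simp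
qed

text \<open>
  A compact set of a Hausdorff space is closed and hence Borel, so its mass under the distribution is
  the probability of its preimage.
\<close>

lemma tight_random_elementsI:
  assumes M: "prob_space M" and "Hausdorff_space X"
    and meas: "\<And>i. i \<in> I \<Longrightarrow> Y i \<in> M \<rightarrow>\<^sub>M borel_sigma X"
    and bad: "\<And>\<epsilon>. 0 < \<epsilon> \<Longrightarrow> \<exists>K. compactin X K \<and> (\<forall>i\<in>I. \<exists>Bad\<in>sets M. measure M Bad \<le> \<epsilon> \<and>
      (\<forall>w\<in>space M - Bad. Y i w \<in> K))"
  shows "tight_random_elements M X Y I"
  unfolding tight_random_elements_def
proof (intro conjI ballI allI impI meas)
  interpret prob_space M by fact
  fix \<epsilon> :: real assume "0 < \<epsilon>"
  then obtain K where K: "compactin X K"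
    and bad: "\<And>i. i \<in> I \<Longrightarrow> \<exists>Bad\<in>sets M. prob Bad \<le> \<epsilon> \<and> (\<forall>w\<in>space M - Bad. Y i w \<in> K)"
    using bad by blast
  have KX: "K \<subseteq> topspace X" using K by (rule compactin_subset_topspace)
  have "closedin X K" using compactin_imp_closedin[OF assms(2) K] .
  then have op: "openin X (topspace X - K)" by (simp add: closedin_def)
  have sub: "{U. openin X U} \<subseteq> Pow (topspace X)" using openin_subset by blast
  have "topspace X - K \<in> sets (borel_sigma X)"
    unfolding borel_sigma_def using op sub by (simp add: sets_measure_of sigma_sets.Basic)
  then have "space (borel_sigma X) - (topspace X - K) \<in> sets (borel_sigma X)" by (rule sets.compl_sets)
  moreover have "space (borel_sigma X) - (topspace X - K) = K"
    unfolding borel_sigma_def using sub KX by (auto simp: space_measure_of)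
  ultimately have Ks: "K \<in> sets (borel_sigma X)" by simp
  show "\<exists>K. compactin X K \<and> (\<forall>i\<in>I. 1 - \<epsilon> \<le> measure (distr M (borel_sigma X) (Y i)) K)"
  proof (intro exI[of _ K] conjI K ballI)
    fix i assume i: "i \<in> I"
    obtain Bad where B: "Bad \<in> sets M" "prob Bad \<le> \<epsilon>" "\<And>w. w \<in> space M - Bad \<Longrightarrow> Y i w \<in> K"
      using bad[OF i] by blast
    have "1 - \<epsilon> \<le> prob (space M - Bad)" using B by (simp add: prob_compl)
    also have "\<dots> \<le> prob (Y i -` K \<inter> space M)"
      using B(3) measurable_sets[OF meas[OF i] Ks] by (intro finite_measure_mono) auto
    also have "\<dots> = measure (distr M (borel_sigma X) (Y i)) K"
      by (rule measure_distr[OF meas[OF i] Ks, symmetric])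
    finally show "1 - \<epsilon> \<le> measure (distr M (borel_sigma X) (Y i)) K" .
  qed
qed

section \<open>Projections, measurability and independence of the iterates\<close>

context lpsa
begin

lemma linear_P_col: "linear P_col"
  unfolding P_col_def by (rule linear_orthogonal_projection)

lemma norm_P_col_le: "norm (P_col x) \<le> norm x"
  by (rule power2_le_imp_le)
    (use norm_orthogonal_projection[of x "columns A"] in \<open>simp_all add: P_col_def\<close>)

lemma norm_P_null_le: "norm (P_null x) \<le> norm x"
  by (rule power2_le_imp_le)
    (use norm_orthogonal_projection[of x "columns A"] in \<open>simp_all add: P_null_def P_col_def\<close>)

lemma P_col_P_null: "P_col (P_null x) = 0"
  unfolding P_null_def P_col_def
  using orthogonal_projection_orthogonal[of _ "columns A" x]
  by (intro orthogonal_projection_unique) (simp_all add: span_zero)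

lemma P_col_xstar: "P_col xstar = 0"
proof -
  have "orthogonal xstar c" if c: "c \<in> columns A" for c
  proof -
    obtain i where "c = column i A" using c unfolding columns_def by blast
    then have "c \<bullet> xstar = (transpose A *v xstar) $ i"
      by (simp add: matrix_vector_mul_component transpose_def column_def)
    then show ?thesis using xstar_feasible by (simp add: orthogonal_def inner_commute)
  qed
  then have "orthogonal (xstar - 0) z" if "z \<in> span (columns A)" for z
    using that orthogonal_to_span by auto
  then show ?thesis unfolding P_col_def by (intro orthogonal_projection_unique span_zero)
qed

lemma norm_P_null_minus_xstar: "norm (P_null x - xstar) \<le> norm (x - xstar)"
proof -
  have "P_null x - xstar = P_null (x - xstar)"
    by (simp add: P_null_def linear_diff[OF linear_P_col] P_col_xstar)
  then show ?thesis using norm_P_null_le by simp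
qed

lemma borel_measurable_P_col [measurable]: "P_col \<in> borel_measurable borel"
  by (intro borel_measurable_continuous_onI linear_continuous_on linear_conv_bounded_linear[THEN iffD1] linear_P_col)

lemma borel_measurable_P_null [measurable]: "P_null \<in> borel_measurable borel"
  unfolding P_null_def[abs_def] by measurable

lemma borel_measurable_dF [measurable]: "(\<lambda>(x, z). dF x z) \<in> borel_measurable (borel \<Otimes>\<^sub>M D)"
  by (rule borel_measurable_gradient[of F]) (auto intro: F_gradient borel_measurable_integrable F_integrable)

text \<open>
  Samples and projection decisions share one index set, so that groups of independent variables are
  disjoint sets of indices although the variables differ in type.
\<close>

definition generators :: "nat + nat \<Rightarrow> 'w set set" where
  "generators i = (case i of Inl n \<Rightarrow> {\<zeta> n -` B \<inter> space M | B. B \<in> sets D}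
                   | Inr n \<Rightarrow> {\<omega> n -` B \<inter> space M | B. B \<in> UNIV})"

definition info :: "(nat + nat) set \<Rightarrow> 'w measure" where
  "info K = sigma (space M) (\<Union>i\<in>K. generators i)"

lemma generators_subset: "generators i \<subseteq> Pow (space M)"
  by (auto simp: generators_def split: sum.splits)

lemma space_info [simp]: "space (info K) = space M"
  by (simp add: info_def space_measure_of_conv)

lemma sets_info: "sets (info K) = sigma_sets (space M) (\<Union>i\<in>K. generators i)"
  unfolding info_def using generators_subset by (intro sets_measure_of) blast

lemma measurable_info_mono: "K \<subseteq> K' \<Longrightarrow> X \<in> info K \<rightarrow>\<^sub>M N \<Longrightarrow> X \<in> info K' \<rightarrow>\<^sub>M N"
proof -
  assume K: "K \<subseteq> K'" and X: "X \<in> info K \<rightarrow>\<^sub>M N"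
  have "sets (info K) \<subseteq> sets (info K')"
    unfolding sets_info using K by (intro sigma_sets_mono') auto
  then show ?thesis using measurable_mono[OF order_refl refl, of "info K" "info K'" N] X by auto
qed

lemma measurable_info_zeta: "Inl n \<in> K \<Longrightarrow> 1 \<le> n \<Longrightarrow> \<zeta> n \<in> info K \<rightarrow>\<^sub>M D"
proof (rule measurableI)
  assume n: "Inl n \<in> K" "1 \<le> n"
  show "\<zeta> n w \<in> space D" if "w \<in> space (info K)" for w
    using measurable_space[OF \<zeta>_measurable[OF n(2)]] that by simp
  fix B assume "B \<in> sets D"
  then have "\<zeta> n -` B \<inter> space M \<in> generators (Inl n)" by (auto simp: generators_def)
  then show "\<zeta> n -` B \<inter> space (info K) \<in> sets (info K)" using n(1) by (auto simp: sets_info)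
qed

lemma measurable_info_omega: "Inr n \<in> K \<Longrightarrow> \<omega> n \<in> info K \<rightarrow>\<^sub>M count_space UNIV"
proof (rule measurableI)
  assume n: "Inr n \<in> K"
  fix B :: "bool set"
  have "\<omega> n -` B \<inter> space M \<in> generators (Inr n)" by (auto simp: generators_def)
  then show "\<omega> n -` B \<inter> space (info K) \<in> sets (info K)" using n by (auto simp: sets_info)
qed simp

abbreviation indices :: "(nat + nat) set" where "indices \<equiv> {1..} <+> {1..}"

lemma generators_events: "i \<in> indices \<Longrightarrow> generators i \<subseteq> sets M"
  using indep unfolding sample.indep_sets_def generators_def by blast

lemma measurable_info_imp:
  assumes "K \<subseteq> indices" "X \<in> info K \<rightarrow>\<^sub>M N"
  shows "X \<in> M \<rightarrow>\<^sub>M N"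
proof -
  have "sets (info K) \<subseteq> sets M"
    unfolding sets_info using assms(1) generators_events by (intro sets.sigma_sets_subset) blast
  then show ?thesis using measurable_mono[OF order_refl refl, of "info K" M N] assms(2) by auto
qed

text \<open>
  The generators are closed under intersections, so independence passes to the sigma-algebras
  generated by disjoint groups of variables.
\<close>

lemma independent_info:
  assumes K: "K \<subseteq> indices" "K' \<subseteq> indices" "K \<inter> K' = {}"
    and X: "X \<in> info K \<rightarrow>\<^sub>M S" and Y: "Y \<in> info K' \<rightarrow>\<^sub>M T"
    and U: "U \<in> sets S" and V: "V \<in> sets T"
  shows "sample.prob ((X -` U \<inter> space M) \<inter> (Y -` V \<inter> space M))
    = sample.prob (X -` U \<inter> space M) * sample.prob (Y -` V \<inter> space M)"
proof -
  have "sample.indep_sets (\<lambda>b. sigma_sets (space M) (\<Union>i\<in>case_bool K K' b. generators i)) UNIV"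
  proof (rule sample.indep_sets_collect_sigma)
    have "sample.indep_sets generators indices" using indep unfolding generators_def[abs_def] .
    then show "sample.indep_sets generators (\<Union>b\<in>UNIV. case_bool K K' b)"
      by (rule sample.indep_sets_mono_index[rotated]) (use K in \<open>auto split: bool.splits\<close>)
    show "Int_stable (generators i)" for i
    proof (cases i)
      case (Inl n)
      show ?thesis
      proof (rule Int_stableI)
        have gen: "\<zeta> n -` B \<inter> space M \<in> generators i" if "B \<in> sets D" for B
          using that Inl by (auto simp: generators_def)
        fix a b assume "a \<in> generators i" "b \<in> generators i"
        then obtain B B' where B: "B \<in> sets D" "B' \<in> sets D"
          and ab: "a = \<zeta> n -` B \<inter> space M" "b = \<zeta> n -` B' \<inter> space M"
          using Inl by (auto simp: generators_def)
        have "a \<inter> b = \<zeta> n -` (B \<inter> B') \<inter> space M" unfolding ab by auto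
        then show "a \<inter> b \<in> generators i" using gen[OF sets.Int[OF B]] by (simp only:)
      qed
    next
      case (Inr n)
      show ?thesis
      proof (rule Int_stableI)
        have gen: "\<omega> n -` B \<inter> space M \<in> generators i" for B
          using Inr by (auto simp: generators_def)
        fix a b assume "a \<in> generators i" "b \<in> generators i"
        then obtain B B' where ab: "a = \<omega> n -` B \<inter> space M" "b = \<omega> n -` B' \<inter> space M"
          using Inr by (auto simp: generators_def)
        have "a \<inter> b = \<omega> n -` (B \<inter> B') \<inter> space M" unfolding ab by auto
        then show "a \<inter> b \<in> generators i" using gen by (simp only:)
      qed
    qed
    show "disjoint_family_on (case_bool K K') UNIV"
      using K(3) by (auto simp: disjoint_family_on_def split: bool.splits)
  qed
  then have "sample.indep_set (sets (info K)) (sets (info K'))"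
    unfolding sample.indep_set_def sets_info
    by (rule sample.indep_sets_mono_sets) (auto split: bool.splits)
  then show ?thesis
    using measurable_sets[OF X U] measurable_sets[OF Y V] by (intro sample.indep_setD) simp_all
qed

text \<open>
  The indices of all variables that enter \<open>iterate n\<close>.
\<close>

abbreviation past :: "nat \<Rightarrow> (nat + nat) set" where "past n \<equiv> {1..<n} <+> {1..<n}"

lemma measurable_half_step:
  assumes "X \<in> borel_measurable N" "\<zeta> n \<in> N \<rightarrow>\<^sub>M D"
  shows "(\<lambda>w. half_step n w (X w)) \<in> borel_measurable N"
proof -
  have "(\<lambda>w. (X w, \<zeta> n w)) \<in> N \<rightarrow>\<^sub>M borel \<Otimes>\<^sub>M D" using assms by (rule measurable_Pair)
  from measurable_compose[OF this borel_measurable_dF] show ?thesis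
    unfolding half_step_def using assms by simp
qed

lemma measurable_info_iterate: "1 \<le> n \<Longrightarrow> iterate n \<in> borel_measurable (info (past n))"
proof (induction n rule: dec_induct)
  case (step n)
  have x: "iterate n \<in> borel_measurable (info (past (Suc n)))"
    by (rule measurable_info_mono[OF _ step.IH]) auto
  have z: "\<zeta> n \<in> info (past (Suc n)) \<rightarrow>\<^sub>M D" using step.hyps by (intro measurable_info_zeta) auto
  have o: "\<omega> n \<in> info (past (Suc n)) \<rightarrow>\<^sub>M count_space UNIV" using step.hyps by (intro measurable_info_omega) auto
  have "(\<lambda>w. if \<omega> n w then P_null (half_step n w (iterate n w)) else half_step n w (iterate n w))
      \<in> borel_measurable (info (past (Suc n)))"
    using measurable_half_step[OF x z] o
    by (intro measurable_If measurable_compose[OF _ borel_measurable_P_null]) (simp_all add: pred_def)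
  then show ?case using step.hyps by (simp cong: measurable_cong)
qed simp

lemma measurable_iterate: "1 \<le> n \<Longrightarrow> iterate n \<in> borel_measurable M"
  by (rule measurable_info_imp[OF _ measurable_info_iterate]) auto

text \<open>
  \<open>\<zeta> n\<close> is independent of the past, so it can be integrated out while the iterate is held fixed.
\<close>

lemma nn_integral_iterate_zeta:
  assumes n: "1 \<le> n" and g: "g \<in> borel_measurable (borel \<Otimes>\<^sub>M D)"
  shows "(\<integral>\<^sup>+w. g (iterate n w, \<zeta> n w) \<partial>M) = (\<integral>\<^sup>+w. (\<integral>\<^sup>+z. g (iterate n w, z) \<partial>D) \<partial>M)"
proof -
  have "(\<integral>\<^sup>+w. g (iterate n w, \<zeta> n w) \<partial>M) = (\<integral>\<^sup>+w. (\<integral>\<^sup>+w'. g (iterate n w, \<zeta> n w') \<partial>M) \<partial>M)"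
  proof (rule sample.nn_integral_independent_pair[OF measurable_iterate[OF n] \<zeta>_measurable[OF n] _ g])
    show "sample.prob ((iterate n -` U \<inter> space M) \<inter> (\<zeta> n -` B \<inter> space M))
        = sample.prob (iterate n -` U \<inter> space M) * sample.prob (\<zeta> n -` B \<inter> space M)"
      if "U \<in> sets borel" "B \<in> sets D" for U B
      using n by (intro independent_info[of "past n" "{Inl n}", OF _ _ _ measurable_info_iterate
            measurable_info_zeta that]) auto
  qed
  also have "\<dots> = (\<integral>\<^sup>+w. (\<integral>\<^sup>+z. g (iterate n w, z) \<partial>distr M D (\<zeta> n)) \<partial>M)"
    using measurable_compose[OF measurable_Pair1' g]
    by (intro nn_integral_cong nn_integral_distr[symmetric] \<zeta>_measurable n) (simp add: o_def)
  finally show ?thesis by (simp add: \<zeta>_distr[OF n])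
qed

lemma prob_omega:
  assumes n: "1 \<le> n"
  shows "sample.prob {w \<in> space M. \<omega> n w} = p n" "sample.prob {w \<in> space M. \<not> \<omega> n w} = 1 - p n"
proof -
  have *: "sample.prob {w \<in> space M. \<omega> n w \<in> B} = measure_pmf.prob (bernoulli_pmf (p n)) B" for B
    using \<omega>_distr[OF n] measure_distr[OF \<omega>_measurable[OF n], of B]
    by (simp add: vimage_def Int_def conj_commute)
  show "sample.prob {w \<in> space M. \<omega> n w} = p n"
    using *[of "{True}"] p_range[OF n] by (simp add: measure_pmf_single)
  show "sample.prob {w \<in> space M. \<not> \<omega> n w} = 1 - p n"
    using *[of "{False}"] p_range[OF n] by (simp add: measure_pmf_single)
qed

text \<open>
  The decision \<open>\<omega> n\<close> is independent of the iterate and of the sample \<open>\<zeta> n\<close>.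
\<close>

lemma nn_integral_reset:
  assumes n: "1 \<le> n" and g: "g \<in> borel_measurable (borel \<Otimes>\<^sub>M D)"
  shows "(\<integral>\<^sup>+w. (if \<omega> n w then 0 else g (iterate n w, \<zeta> n w)) \<partial>M)
    = ennreal (1 - p n) * (\<integral>\<^sup>+w. g (iterate n w, \<zeta> n w) \<partial>M)"
proof -
  let ?S = "borel \<Otimes>\<^sub>M D :: ((real ^ 'd) \<times> 'z) measure"
  let ?X = "\<lambda>w. (iterate n w, \<zeta> n w)"
  have X: "?X \<in> info (past n \<union> {Inl n}) \<rightarrow>\<^sub>M ?S"
    using n by (intro measurable_Pair measurable_info_zeta measurable_info_mono[OF _ measurable_info_iterate]) auto
  have XM: "?X \<in> M \<rightarrow>\<^sub>M ?S" by (rule measurable_info_imp[OF _ X]) (use n in auto)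
  have ind: "sample.prob ((?X -` U \<inter> space M) \<inter> (\<omega> n -` B \<inter> space M))
      = sample.prob (?X -` U \<inter> space M) * sample.prob (\<omega> n -` B \<inter> space M)"
    if "U \<in> sets ?S" "B \<in> sets (count_space UNIV)" for U B
    by (rule independent_info[OF _ _ _ X measurable_info_omega[of n "{Inr n}"] that]) (use n in auto)
  define G where "G = (\<lambda>(s, b). if b then 0 else g s :: ennreal)"
  have G: "G \<in> borel_measurable (?S \<Otimes>\<^sub>M count_space UNIV)"
    unfolding G_def using g by measurable
  have inner: "(\<integral>\<^sup>+w'. G (?X w, \<omega> n w') \<partial>M) = ennreal (1 - p n) * g (?X w)" for w
  proof -
    have sets: "{w' \<in> space M. \<not> \<omega> n w'} \<in> sets M" using \<omega>_measurable[OF n] by measurable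
    have "(\<integral>\<^sup>+w'. G (?X w, \<omega> n w') \<partial>M) = (\<integral>\<^sup>+w'. g (?X w) * indicator {w' \<in> space M. \<not> \<omega> n w'} w' \<partial>M)"
      by (intro nn_integral_cong) (auto simp: G_def indicator_def)
    also have "\<dots> = g (?X w) * emeasure M {w' \<in> space M. \<not> \<omega> n w'}"
      using sets by (rule nn_integral_cmult_indicator)
    finally show ?thesis by (simp add: sample.emeasure_eq_measure prob_omega[OF n] mult.commute)
  qed
  have "(\<integral>\<^sup>+w. (if \<omega> n w then 0 else g (?X w)) \<partial>M) = (\<integral>\<^sup>+w. (\<integral>\<^sup>+w'. G (?X w, \<omega> n w') \<partial>M) \<partial>M)"
    using sample.nn_integral_independent_pair[OF XM \<omega>_measurable[OF n] ind G] by (simp add: G_def)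
  also have "\<dots> = (\<integral>\<^sup>+w. ennreal (1 - p n) * g (?X w) \<partial>M)" by (simp only: inner)
  also have "\<dots> = ennreal (1 - p n) * (\<integral>\<^sup>+w. g (?X w) \<partial>M)"
    by (intro nn_integral_cmult measurable_compose[OF XM g])
  finally show ?thesis .
qed

lemma prob_omega_pair:
  assumes "1 \<le> k" "1 \<le> l" "k \<noteq> l"
  shows "sample.prob {w \<in> space M. \<omega> k w \<and> \<omega> l w} = p k * p l"
proof -
  have "sample.prob ((\<omega> k -` {True} \<inter> space M) \<inter> (\<omega> l -` {True} \<inter> space M))
      = sample.prob (\<omega> k -` {True} \<inter> space M) * sample.prob (\<omega> l -` {True} \<inter> space M)"
    by (rule independent_info[OF _ _ _ measurable_info_omega[of k "{Inr k}"] measurable_info_omega[of l "{Inr l}"]])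
      (use assms in auto)
  moreover have "\<omega> j -` {True} \<inter> space M = {w \<in> space M. \<omega> j w}" for j by auto
  moreover have "{w \<in> space M. \<omega> k w} \<inter> {w \<in> space M. \<omega> l w} = {w \<in> space M. \<omega> k w \<and> \<omega> l w}" by auto
  ultimately show ?thesis using assms by (simp add: prob_omega)
qed

end

section \<open>Step sizes and the linear form of a step\<close>

locale lpsa_regime = lpsa M D A F dF f df xstar x1 \<eta> p \<beta> \<zeta> \<omega>
  for M :: "'w measure" and D :: "'z measure"
    and A :: "real ^ 'm ^ 'd"
    and F :: "real ^ 'd \<Rightarrow> 'z \<Rightarrow> real" and dF :: "real ^ 'd \<Rightarrow> 'z \<Rightarrow> real ^ 'd"
    and f :: "real ^ 'd \<Rightarrow> real" and df :: "real ^ 'd \<Rightarrow> real ^ 'd"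
    and xstar x1 :: "real ^ 'd"
    and \<eta> p :: "nat \<Rightarrow> real" and \<beta> :: real
    and \<zeta> :: "nat \<Rightarrow> 'w \<Rightarrow> 'z" and \<omega> :: "nat \<Rightarrow> 'w \<Rightarrow> bool" +
  fixes \<alpha> \<gamma> \<eta>0 \<mu> L :: real
  assumes step_size_0: "\<eta> 0 = \<eta>0"
    and step_size: "1 \<le> n \<Longrightarrow> \<eta> n = \<eta>0 * real n powr (- \<alpha>)"
    and p_eq: "1 \<le> n \<Longrightarrow> p n = min (\<gamma> * \<eta> n powr \<beta>) 1"
    and gamma_pos: "0 < \<gamma>" and alpha_pos: "0 < \<alpha>" and alpha_le: "\<alpha> \<le> 1"
    and beta_pos: "0 < \<beta>" and beta_less: "\<beta> < 1" and eta0_pos: "0 < \<eta>0"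
    and gradient_lipschitz: "norm (df x - df y) \<le> L * norm (x - y)"
    and mu_pos: "0 < \<mu>" and f_strongly_convex: "strongly_convex \<mu> f"
    and covariance_lipschitz: "spectral_norm (covariance_matrix D (dF x) - covariance_matrix D (dF y))
      \<le> L * norm (x - y)"
begin

definition h :: "nat \<Rightarrow> real" where "h n = \<eta> n powr \<beta>"

lemma eta_pos: "0 < \<eta> n"
  using eta0_pos step_size_0 step_size[of n] by (cases n) auto

lemma eta_le: "\<eta> n \<le> \<eta>0"
proof (cases "1 \<le> n")
  case True
  then have "real n powr (- \<alpha>) \<le> real n powr 0" using alpha_pos by (intro powr_mono) auto
  then show ?thesis using step_size[OF True] eta0_pos True by (simp add: mult_left_le)
qed (use step_size_0 in \<open>cases n; simp\<close>)

lemma h_pos: "0 < h n"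
  using eta_pos[of n] by (simp add: h_def)

lemma h_le: "h n \<le> h 0"
  unfolding h_def step_size_0 using eta_le[of n] eta_pos[of n] beta_pos by (intro powr_mono2) auto

lemma h_eq: "1 \<le> n \<Longrightarrow> h n = h 0 * real n powr (- (\<alpha> * \<beta>))"
  using eta0_pos by (simp add: h_def step_size step_size_0 powr_mult powr_powr)

lemma exponent_less_1: "\<alpha> * \<beta> < 1"
proof -
  have "\<alpha> * \<beta> \<le> 1 * \<beta>" using alpha_le beta_pos by (intro mult_right_mono) auto
  then show ?thesis using beta_less by linarith
qed

lemma eta_tendsto_0: "\<eta> \<longlonglongrightarrow> 0"
proof -
  have lim: "(\<lambda>n. \<eta>0 * real n powr (- \<alpha>)) \<longlonglongrightarrow> \<eta>0 * 0"
    using alpha_pos by (intro tendsto_mult tendsto_const tendsto_neg_powr filterlim_real_sequentially) auto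
  have ev: "eventually (\<lambda>n. \<eta>0 * real n powr (- \<alpha>) = \<eta> n) sequentially"
    using eventually_ge_at_top[of 1] by eventually_elim (simp add: step_size)
  show ?thesis using Lim_transform_eventually[OF lim ev] by simp
qed

lemma h_tendsto_0: "h \<longlonglongrightarrow> 0"
proof -
  have lim: "(\<lambda>n. h 0 * real n powr (- (\<alpha> * \<beta>))) \<longlonglongrightarrow> h 0 * 0"
    using alpha_pos beta_pos by (intro tendsto_mult tendsto_const tendsto_neg_powr filterlim_real_sequentially) auto
  have ev: "eventually (\<lambda>n. h 0 * real n powr (- (\<alpha> * \<beta>)) = h n) sequentially"
    using eventually_ge_at_top[of 1] by eventually_elim (simp add: h_eq)
  show ?thesis using Lim_transform_eventually[OF lim ev] by simp
qed

text \<open>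
  The factor by which the scaling of \<open>vcheck\<close> increases from index \<open>n\<close> to index \<open>Suc n\<close>.
\<close>

definition growth :: "nat \<Rightarrow> real" where
  "growth n = (\<eta> n / \<eta> (n - 1)) powr (\<beta> - 1)"

text \<open>
  The factor is a power of \<open>n / (n - 1)\<close> with an exponent between 0 and 1. At index 1 it is 1, since
  \<open>\<eta> 0 = \<eta> 1\<close>.
\<close>

lemma growth_bounds:
  assumes "1 \<le> n"
  shows "1 \<le> growth n" "growth n \<le> 1 + 2 / real n"
proof -
  have "1 \<le> growth n \<and> growth n \<le> 1 + 2 / real n"
  proof (cases "n = 1")
    case True
    then show ?thesis using step_size[of 1] step_size_0 eta0_pos by (simp add: growth_def)
  next
    case False
    then have n: "2 \<le> n" using assms by simp
    define q where "q = real n / real (n - 1)"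
    have q: "1 \<le> q" "q \<le> 1 + 2 / real n" using n by (simp_all add: q_def field_simps)
    have "\<eta> n / \<eta> (n - 1) = q powr (- \<alpha>)"
      using n eta0_pos by (simp add: step_size q_def powr_divide)
    then have "growth n = q powr (\<alpha> * (1 - \<beta>))"
      by (simp add: growth_def powr_powr algebra_simps)
    moreover have "q powr 0 \<le> q powr (\<alpha> * (1 - \<beta>))" "q powr (\<alpha> * (1 - \<beta>)) \<le> q powr 1"
      using q alpha_pos alpha_le beta_pos beta_less by (intro powr_mono mult_le_one; simp)+
    ultimately show ?thesis using q by simp
  qed
  then show "1 \<le> growth n" "growth n \<le> 1 + 2 / real n" by auto
qed

text \<open>
  A growth of order \<open>1 / n\<close> is small compared with \<open>h n\<close>, which decays like \<open>n powr (- (\<alpha> * \<beta>))\<close>.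
\<close>

lemma growth_relative:
  assumes "1 \<le> n"
  shows "(growth n - 1) / h n \<le> 2 / h 0 * real n powr (\<alpha> * \<beta> - 1)"
proof -
  have "(growth n - 1) / h n \<le> (2 / real n) / h n"
    using growth_bounds[OF assms] h_pos[of n] by (intro divide_right_mono) auto
  also have "\<dots> = 2 / h 0 * real n powr (\<alpha> * \<beta> - 1)"
    using assms h_pos[of 0] by (simp add: h_eq powr_minus powr_diff field_simps)
  finally show ?thesis .
qed

lemma growth_relative_bound:
  assumes "1 \<le> n"
  shows "(growth n - 1) / h n \<le> 2 / h 0"
proof -
  have "real n powr (\<alpha> * \<beta> - 1) \<le> real n powr 0"
    using assms exponent_less_1 by (intro powr_mono) auto
  then have "2 / h 0 * real n powr (\<alpha> * \<beta> - 1) \<le> 2 / h 0 * 1"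
    using assms h_pos[of 0] by (intro mult_left_mono) auto
  then show ?thesis using growth_relative[OF assms] by simp
qed

lemma growth_relative_tendsto_0: "(\<lambda>n. (growth n - 1) / h n) \<longlonglongrightarrow> 0"
proof (rule tendsto_sandwich)
  show "eventually (\<lambda>n. 0 \<le> (growth n - 1) / h n) sequentially"
    using eventually_ge_at_top[of 1] by eventually_elim (use growth_bounds h_pos in \<open>simp add: less_imp_le\<close>)
  show "eventually (\<lambda>n. (growth n - 1) / h n \<le> 2 / h 0 * real n powr (\<alpha> * \<beta> - 1)) sequentially"
    using eventually_ge_at_top[of 1] by eventually_elim (rule growth_relative)
  have "(\<lambda>n. 2 / h 0 * real n powr (\<alpha> * \<beta> - 1)) \<longlonglongrightarrow> 2 / h 0 * 0"
    using exponent_less_1 by (intro tendsto_mult tendsto_const tendsto_neg_powr filterlim_real_sequentially) auto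
  then show "(\<lambda>n. 2 / h 0 * real n powr (\<alpha> * \<beta> - 1)) \<longlonglongrightarrow> 0" by simp
qed (rule tendsto_const)

definition slope :: "nat \<Rightarrow> 'w \<Rightarrow> real ^ 'd" where
  "slope n w = drift n w - noise2 n w"

lemma vcheck_minus_slope: "vcheck_minus n w = vcheck n w - h n *\<^sub>R slope n w"
  using h_pos[of n] by (simp add: slope_def drift_def h_def)

lemma vcheck_minus_eq:
  "vcheck_minus n w = growth n *\<^sub>R vcheck n w - h n *\<^sub>R P_col (dF (iterate n w) (\<zeta> n w))"
proof -
  have "\<eta> n powr (\<beta> - 1) * \<eta> n = h n"
    using eta_pos[of n] powr_add[of "\<eta> n" "\<beta> - 1" 1] by (simp add: h_def)
  moreover have "\<eta> n powr (\<beta> - 1) = growth n * \<eta> (n - 1) powr (\<beta> - 1)"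
    using eta_pos[of n] eta_pos[of "n - 1"] by (simp add: growth_def powr_divide)
  ultimately show ?thesis
    by (simp add: vcheck_minus_def vcheck_def half_step_def linear_diff[OF linear_P_col]
        linear_cmul[OF linear_P_col] scaleR_diff_right flip: mult.assoc)
qed

text \<open>
  The velocity consists of the projected stochastic gradient and of a multiple of \<open>vcheck\<close> caused by the
  change of scale.
\<close>

lemma slope_eq: "slope n w = P_col (dF (iterate n w) (\<zeta> n w)) - ((growth n - 1) / h n) *\<^sub>R vcheck n w"
proof -
  have "h n *\<^sub>R slope n w = vcheck n w - vcheck_minus n w" by (simp add: vcheck_minus_slope)
  also have "\<dots> = h n *\<^sub>R P_col (dF (iterate n w) (\<zeta> n w)) - (growth n - 1) *\<^sub>R vcheck n w"
    by (simp add: vcheck_minus_eq scaleR_left_diff_distrib)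
  also have "\<dots> = h n *\<^sub>R (P_col (dF (iterate n w) (\<zeta> n w)) - ((growth n - 1) / h n) *\<^sub>R vcheck n w)"
    using h_pos[of n] by (simp add: scaleR_diff_right)
  finally have "h n *\<^sub>R slope n w = h n *\<^sub>R (P_col (dF (iterate n w) (\<zeta> n w)) - ((growth n - 1) / h n) *\<^sub>R vcheck n w)" .
  then show ?thesis using h_pos[of n] by simp
qed

lemma vcheck_Suc: "1 \<le> n \<Longrightarrow> vcheck (Suc n) w = (if \<omega> n w then 0 else vcheck_minus n w)"
  by (simp add: vcheck_def vcheck_minus_def P_col_P_null)

lemma vcheck_Suc_slope: "1 \<le> n \<Longrightarrow> vcheck (Suc n) w = (if \<omega> n w then 0 else vcheck n w - h n *\<^sub>R slope n w)"
  by (simp add: vcheck_Suc vcheck_minus_slope)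

lemma borel_measurable_vcheck: "1 \<le> n \<Longrightarrow> vcheck n \<in> borel_measurable M"
  unfolding vcheck_def[abs_def]
  by (intro borel_measurable_scaleR borel_measurable_const measurable_compose[OF _ borel_measurable_P_col]
      measurable_iterate)

lemma borel_measurable_gradient_sample:
  assumes "1 \<le> n" shows "(\<lambda>w. dF (iterate n w) (\<zeta> n w)) \<in> borel_measurable M"
  using measurable_compose[OF measurable_Pair[OF measurable_iterate[OF assms] \<zeta>_measurable[OF assms]] borel_measurable_dF]
  by simp

lemma borel_measurable_slope: "1 \<le> n \<Longrightarrow> slope n \<in> borel_measurable M"
  unfolding slope_eq[abs_def]
  by (intro borel_measurable_diff borel_measurable_scaleR borel_measurable_const borel_measurable_vcheck
      measurable_compose[OF _ borel_measurable_P_col] borel_measurable_gradient_sample)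

end

section \<open>Second moments\<close>

context lpsa_regime
begin

lemma gradient_second_moment:
  "(\<integral>z. (norm (dF x z))\<^sup>2 \<partial>D) = (norm (df x))\<^sup>2 + (\<Sum>i\<in>UNIV. covariance_matrix D (dF x) $ i $ i)"
proof -
  let ?X = "\<lambda>z. dF x z - df x"
  have sq: "(norm (?X z))\<^sup>2 = (norm (dF x z))\<^sup>2 - 2 * (df x \<bullet> dF x z) + (norm (df x))\<^sup>2" for z
    by (simp add: power2_norm_eq_inner inner_diff_left inner_diff_right inner_commute)
  have dfi: "integrable D (\<lambda>z. df x \<bullet> dF x z)" using dF_integrable[of x] by simp
  have int: "integrable D (\<lambda>z. (norm (?X z))\<^sup>2)"
    unfolding sq using dF_square_integrable[of x] dfi by simp
  have "integrable D (\<lambda>z. ?X z $ i * ?X z $ i)" for i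
  proof (rule Bochner_Integration.integrable_bound[OF int])
    have "dF x \<in> borel_measurable D" using dF_integrable[of x] by simp
    then have "(\<lambda>z. ?X z \<bullet> axis i 1) \<in> borel_measurable D" by simp
    then show "(\<lambda>z. ?X z $ i * ?X z $ i) \<in> borel_measurable D" by (simp add: inner_axis)
    show "AE z in D. norm (?X z $ i * ?X z $ i) \<le> norm ((norm (?X z))\<^sup>2)"
    proof (intro always_eventually allI)
      fix z
      have "\<bar>?X z $ i\<bar> * \<bar>?X z $ i\<bar> \<le> norm (?X z) * norm (?X z)"
        by (intro mult_mono component_le_norm_cart) auto
      then show "norm (?X z $ i * ?X z $ i) \<le> norm ((norm (?X z))\<^sup>2)"
        by (simp add: power2_eq_square abs_mult)
    qed
  qed
  then have "(\<Sum>i\<in>UNIV. covariance_matrix D (dF x) $ i $ i) = (\<integral>z. (\<Sum>i\<in>UNIV. ?X z $ i * ?X z $ i) \<partial>D)"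
    by (simp add: covariance_matrix_def dF_mean)
  also have "\<dots> = (\<integral>z. (norm (?X z))\<^sup>2 \<partial>D)"
    by (simp add: power2_norm_eq_inner inner_vec_def)
  also have "\<dots> = (\<integral>z. (norm (dF x z))\<^sup>2 \<partial>D) - 2 * (df x \<bullet> df x) + (norm (df x))\<^sup>2"
    unfolding sq using dF_square_integrable[of x] dfi dF_integrable[of x]
    by (simp add: dF_mean data.prob_space)
  finally show ?thesis by (simp add: power2_norm_eq_inner)
qed

text \<open>
  The trace of the covariance matrix and the norm of the mean gradient are both Lipschitz.
\<close>

lemma gradient_second_moment_growth:
  "\<exists>G\<ge>0. \<forall>x. (\<integral>z. (norm (dF x z))\<^sup>2 \<partial>D) \<le> G * (1 + (norm (x - xstar))\<^sup>2)"
proof -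
  define a where "a = norm (df xstar)"
  define c0 where "c0 = (\<Sum>i\<in>UNIV. \<bar>covariance_matrix D (dF xstar) $ i $ i\<bar>)"
  define k where "k = real CARD('d) * \<bar>L\<bar>"
  define G where "G = 2 * a\<^sup>2 + 2 * L\<^sup>2 + c0 + k"
  have pos: "0 \<le> c0" "0 \<le> k" by (simp_all add: c0_def k_def sum_nonneg)
  have "(\<integral>z. (norm (dF x z))\<^sup>2 \<partial>D) \<le> G * (1 + (norm (x - xstar))\<^sup>2)" for x
  proof -
    define r where "r = norm (x - xstar)"
    have r0: "0 \<le> r" by (simp add: r_def)
    then have r: "0 \<le> r" "r \<le> 1 + r\<^sup>2" using zero_le_power2[of "r - 1"] by (simp_all add: power2_diff)
    have Lr: "L * r \<le> \<bar>L\<bar> * r" using r by (intro mult_right_mono) auto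
    have "norm (df x) \<le> a + \<bar>L\<bar> * r"
      using norm_triangle_ineq[of "df x - df xstar" "df xstar"] gradient_lipschitz[of x xstar] Lr
      by (simp add: a_def r_def)
    then have "(norm (df x))\<^sup>2 \<le> (a + \<bar>L\<bar> * r)\<^sup>2" by (intro power_mono) auto
    also have "\<dots> \<le> 2 * a\<^sup>2 + 2 * L\<^sup>2 * r\<^sup>2"
      using zero_le_power2[of "a - \<bar>L\<bar> * r"] by (simp add: power2_diff power2_sum power_mult_distrib)
    finally have 1: "(norm (df x))\<^sup>2 \<le> 2 * a\<^sup>2 + 2 * L\<^sup>2 * r\<^sup>2" .
    have "covariance_matrix D (dF x) $ i $ i \<le> \<bar>covariance_matrix D (dF xstar) $ i $ i\<bar> + \<bar>L\<bar> * r" for i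
      using abs_diagonal_le_spectral_norm[of "covariance_matrix D (dF x) - covariance_matrix D (dF xstar)" i]
        covariance_lipschitz[of x xstar] Lr
      by (simp add: r_def)
    then have "(\<Sum>i\<in>UNIV. covariance_matrix D (dF x) $ i $ i)
        \<le> (\<Sum>i\<in>UNIV. \<bar>covariance_matrix D (dF xstar) $ i $ i\<bar> + \<bar>L\<bar> * r)"
      by (intro sum_mono)
    also have "\<dots> = c0 + k * r" by (simp add: c0_def k_def sum.distrib)
    finally have "(\<integral>z. (norm (dF x z))\<^sup>2 \<partial>D) \<le> 2 * a\<^sup>2 + 2 * L\<^sup>2 * r\<^sup>2 + (c0 + k * r)"
      using 1 by (simp add: gradient_second_moment)
    also have "\<dots> \<le> 2 * a\<^sup>2 * (1 + r\<^sup>2) + 2 * L\<^sup>2 * (1 + r\<^sup>2) + (c0 * (1 + r\<^sup>2) + k * (1 + r\<^sup>2))"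
      using r pos by (intro add_mono mult_left_mono) (simp_all add: algebra_simps)
    finally show ?thesis by (simp add: G_def r_def algebra_simps)
  qed
  moreover have "0 \<le> G" using pos by (simp add: G_def)
  ultimately show ?thesis by blast
qed

text \<open>
  In expectation, the expansion of the square has the cross term \<open>- 2 * e * ((x - xstar) \<bullet> df x)\<close>. Strong convexity turns
  it into a contraction up to \<open>df xstar\<close>, and Young's inequality spends half of the contraction on that
  term.
\<close>

lemma half_step_second_moment:
  assumes e: "0 \<le> e" and G: "\<And>x. (\<integral>z. (norm (dF x z))\<^sup>2 \<partial>D) \<le> G * (1 + (norm (x - xstar))\<^sup>2)"
  shows "(\<integral>\<^sup>+z. ennreal ((norm (x - e *\<^sub>R dF x z - xstar))\<^sup>2) \<partial>D)
    \<le> ennreal ((1 - e * \<mu> + e\<^sup>2 * G) * (norm (x - xstar))\<^sup>2 + (e * ((norm (df xstar))\<^sup>2 / \<mu>) + e\<^sup>2 * G))"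
proof -
  define u where "u = x - xstar"
  define a where "a = norm (df xstar)"
  have sq: "(norm (x - e *\<^sub>R dF x z - xstar))\<^sup>2 = (norm u)\<^sup>2 - 2 * e * (u \<bullet> dF x z) + e\<^sup>2 * (norm (dF x z))\<^sup>2" for z
  proof -
    have "x - e *\<^sub>R dF x z - xstar = u - e *\<^sub>R dF x z" by (simp add: u_def)
    then show ?thesis
      by (simp only: power2_norm_eq_inner inner_diff_left inner_diff_right inner_scaleR_left
          inner_scaleR_right inner_commute) (simp add: power2_eq_square inner_commute)
  qed
  have int: "integrable D (\<lambda>z. u \<bullet> dF x z)" using dF_integrable[of x] by simp
  have "integrable D (\<lambda>z. (norm (x - e *\<^sub>R dF x z - xstar))\<^sup>2)"
    unfolding sq using int dF_square_integrable[of x] by simp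
  then have "(\<integral>\<^sup>+z. ennreal ((norm (x - e *\<^sub>R dF x z - xstar))\<^sup>2) \<partial>D)
      = ennreal (\<integral>z. (norm (x - e *\<^sub>R dF x z - xstar))\<^sup>2 \<partial>D)"
    by (rule nn_integral_eq_integral) simp
  also have "(\<integral>z. (norm (x - e *\<^sub>R dF x z - xstar))\<^sup>2 \<partial>D)
      = (norm u)\<^sup>2 - 2 * e * (u \<bullet> df x) + e\<^sup>2 * (\<integral>z. (norm (dF x z))\<^sup>2 \<partial>D)"
    unfolding sq using int dF_square_integrable[of x] dF_integrable[of x]
    by (simp add: data.prob_space dF_mean)
  also have "ennreal \<dots> \<le> ennreal ((1 - e * \<mu> + e\<^sup>2 * G) * (norm u)\<^sup>2 + (e * (a\<^sup>2 / \<mu>) + e\<^sup>2 * G))"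
  proof (rule ennreal_leI)
    have "\<mu> * (norm u)\<^sup>2 \<le> u \<bullet> (df x - df xstar)"
      unfolding u_def by (rule strongly_convex_monotone_gradient[OF f_strongly_convex f_gradient f_gradient])
    moreover have "- (a * norm u) \<le> u \<bullet> df xstar"
      using Cauchy_Schwarz_ineq2[of u "df xstar"] by (simp add: a_def mult.commute abs_le_iff)
    ultimately have 1: "\<mu> * (norm u)\<^sup>2 - a * norm u \<le> u \<bullet> df x" by (simp add: inner_diff_right)
    have 2: "2 * (a * norm u) \<le> \<mu> * (norm u)\<^sup>2 + a\<^sup>2 / \<mu>"
    proof -
      have "0 \<le> (\<mu> * norm u - a)\<^sup>2 / \<mu>" using mu_pos by simp
      also have "\<dots> = \<mu> * (norm u)\<^sup>2 - 2 * (a * norm u) + a\<^sup>2 / \<mu>"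
        using mu_pos by (simp add: field_simps power2_eq_square)
      finally show ?thesis by simp
    qed
    have "\<mu> * (norm u)\<^sup>2 - a\<^sup>2 / \<mu> \<le> 2 * (u \<bullet> df x)" using 1 2 by linarith
    then have "e * (\<mu> * (norm u)\<^sup>2 - a\<^sup>2 / \<mu>) \<le> e * (2 * (u \<bullet> df x))" using e by (rule mult_left_mono)
    moreover have "e\<^sup>2 * (\<integral>z. (norm (dF x z))\<^sup>2 \<partial>D) \<le> e\<^sup>2 * (G * (1 + (norm u)\<^sup>2))"
      using G[of x] unfolding u_def by (intro mult_left_mono) auto
    ultimately show "(norm u)\<^sup>2 - 2 * e * (u \<bullet> df x) + e\<^sup>2 * (\<integral>z. (norm (dF x z))\<^sup>2 \<partial>D)
        \<le> (1 - e * \<mu> + e\<^sup>2 * G) * (norm u)\<^sup>2 + (e * (a\<^sup>2 / \<mu>) + e\<^sup>2 * G)"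
      by (simp add: algebra_simps)
  qed
  finally show ?thesis by (simp add: u_def a_def)
qed

text \<open>
  The projection does not increase the distance to \<open>xstar\<close>, so only the gradient step counts, and that
  step contracts once the step size is small.
\<close>

lemma iterate_second_moment_bounded:
  "\<exists>C\<ge>0. \<forall>n\<ge>1. (\<integral>\<^sup>+w. ennreal ((norm (iterate n w - xstar))\<^sup>2) \<partial>M) \<le> ennreal C"
proof -
  obtain G where G0: "0 \<le> G" and G: "\<And>x. (\<integral>z. (norm (dF x z))\<^sup>2 \<partial>D) \<le> G * (1 + (norm (x - xstar))\<^sup>2)"
    using gradient_second_moment_growth by blast
  define K where "K = (norm (df xstar))\<^sup>2 / \<mu>"
  have K: "0 \<le> K" using mu_pos by (simp add: K_def)
  define \<Delta> where "\<Delta> n = (\<integral>\<^sup>+w. ennreal ((norm (iterate n w - xstar))\<^sup>2) \<partial>M)" for n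
  have step: "\<Delta> (Suc n) \<le> ennreal a * \<Delta> n + ennreal b"
    if n: "1 \<le> n" and a: "0 \<le> a" "1 - \<eta> n * \<mu> + (\<eta> n)\<^sup>2 * G \<le> a"
      and b: "0 \<le> b" "\<eta> n * K + (\<eta> n)\<^sup>2 * G \<le> b" for n a b
  proof -
    define g where "g = (\<lambda>(x, z). ennreal ((norm (x - \<eta> n *\<^sub>R dF x z - xstar))\<^sup>2))"
    have g: "g \<in> borel_measurable (borel \<Otimes>\<^sub>M D)"
      unfolding g_def using borel_measurable_dF by (simp add: split_beta)
    have "\<Delta> (Suc n) \<le> (\<integral>\<^sup>+w. g (iterate n w, \<zeta> n w) \<partial>M)"
      unfolding \<Delta>_def
    proof (rule nn_integral_mono)
      fix w
      have "norm (iterate (Suc n) w - xstar) \<le> norm (half_step n w (iterate n w) - xstar)"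
        using norm_P_null_minus_xstar n by simp
      then show "ennreal ((norm (iterate (Suc n) w - xstar))\<^sup>2) \<le> g (iterate n w, \<zeta> n w)"
        unfolding g_def prod.case half_step_def by (intro ennreal_leI power_mono) auto
    qed
    also have "\<dots> = (\<integral>\<^sup>+w. (\<integral>\<^sup>+z. g (iterate n w, z) \<partial>D) \<partial>M)"
      by (rule nn_integral_iterate_zeta[OF n g])
    also have "\<dots> \<le> (\<integral>\<^sup>+w. ennreal a * ennreal ((norm (iterate n w - xstar))\<^sup>2) + ennreal b \<partial>M)"
    proof (rule nn_integral_mono)
      fix w
      let ?x = "iterate n w"
      have "(\<integral>\<^sup>+z. g (?x, z) \<partial>D) \<le> ennreal ((1 - \<eta> n * \<mu> + (\<eta> n)\<^sup>2 * G) * (norm (?x - xstar))\<^sup>2 + (\<eta> n * K + (\<eta> n)\<^sup>2 * G))"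
        using half_step_second_moment[where e = "\<eta> n" and x = ?x, OF less_imp_le[OF eta_pos] G]
        by (simp only: g_def K_def prod.case)
      also have "\<dots> \<le> ennreal (a * (norm (?x - xstar))\<^sup>2 + b)"
        using a b by (intro ennreal_leI add_mono mult_right_mono) auto
      also have "\<dots> = ennreal a * ennreal ((norm (?x - xstar))\<^sup>2) + ennreal b"
        using a b by (simp add: ennreal_plus ennreal_mult)
      finally show "(\<integral>\<^sup>+z. g (?x, z) \<partial>D) \<le> ennreal a * ennreal ((norm (?x - xstar))\<^sup>2) + ennreal b" .
    qed
    also have "\<dots> = ennreal a * \<Delta> n + ennreal b"
      unfolding \<Delta>_def using measurable_iterate[OF n]
      by (simp add: nn_integral_add nn_integral_cmult sample.emeasure_space_1)
    finally show ?thesis .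
  qed
  have lim: "(\<lambda>n. \<eta> n * G) \<longlonglongrightarrow> 0" "(\<lambda>n. \<mu> / 2 * \<eta> n) \<longlonglongrightarrow> 0"
    by (rule tendsto_mult_left_zero[OF eta_tendsto_0], rule tendsto_mult_right_zero[OF eta_tendsto_0])
  have "eventually (\<lambda>n. \<eta> n * G < \<mu> / 2) sequentially" "eventually (\<lambda>n. \<mu> / 2 * \<eta> n < 1) sequentially"
    using order_tendstoD(2)[OF lim(1), of "\<mu> / 2"] order_tendstoD(2)[OF lim(2), of 1] mu_pos by simp_all
  then have "eventually (\<lambda>n. \<eta> n * G < \<mu> / 2 \<and> \<mu> / 2 * \<eta> n < 1) sequentially" by (rule eventually_conj)
  then obtain N where N: "\<And>n. N \<le> n \<Longrightarrow> \<eta> n * G < \<mu> / 2 \<and> \<mu> / 2 * \<eta> n < 1"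
    by (auto simp: eventually_sequentially)
  have "\<exists>C\<ge>0. \<forall>n\<ge>1. \<Delta> n \<le> ennreal C"
  proof (rule contracting_recursion_bounded)
    show "\<Delta> 1 < \<infinity>" by (simp add: \<Delta>_def sample.emeasure_space_1)
    show "\<Delta> (Suc n) \<le> ennreal (1 + \<eta>0\<^sup>2 * G) * \<Delta> n + ennreal (\<eta>0 * K + \<eta>0\<^sup>2 * G)" if n: "1 \<le> n" for n
    proof (rule step[OF n])
      have *: "(\<eta> n)\<^sup>2 * G \<le> \<eta>0\<^sup>2 * G" "\<eta> n * K \<le> \<eta>0 * K"
        by (rule mult_right_mono[OF power_mono[OF eta_le less_imp_le[OF eta_pos]] G0],
          rule mult_right_mono[OF eta_le K])
      then show "1 - \<eta> n * \<mu> + (\<eta> n)\<^sup>2 * G \<le> 1 + \<eta>0\<^sup>2 * G"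
        using eta_pos[of n] mu_pos mult_pos_pos[of "\<eta> n" \<mu>] by linarith
      show "\<eta> n * K + (\<eta> n)\<^sup>2 * G \<le> \<eta>0 * K + \<eta>0\<^sup>2 * G" using * by linarith
    qed (use G0 K eta0_pos in auto)
    show "\<Delta> (Suc n) \<le> ennreal (1 - \<mu> / 2 * \<eta> n) * \<Delta> n + ennreal (\<eta> n * (K + \<mu> / 2))"
      if n: "N \<le> n" "1 \<le> n" for n
    proof (rule step[OF n(2)])
      have "\<eta> n * (\<eta> n * G) \<le> \<eta> n * (\<mu> / 2)"
        using N[OF n(1)] eta_pos[of n] by (intro mult_left_mono) auto
      then have *: "(\<eta> n)\<^sup>2 * G \<le> \<eta> n * (\<mu> / 2)" by (simp add: power2_eq_square mult.assoc)
      then show "1 - \<eta> n * \<mu> + (\<eta> n)\<^sup>2 * G \<le> 1 - \<mu> / 2 * \<eta> n" by (simp add: algebra_simps)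
      show "\<eta> n * K + (\<eta> n)\<^sup>2 * G \<le> \<eta> n * (K + \<mu> / 2)" using * by (simp add: algebra_simps)
      show "0 \<le> 1 - \<mu> / 2 * \<eta> n" using N[OF n(1)] by simp
      show "0 \<le> \<eta> n * (K + \<mu> / 2)" using eta_pos[of n] mu_pos K by simp
    qed
    show "0 \<le> \<eta> n \<and> \<mu> / 2 * \<eta> n \<le> 1" if "N \<le> n" for n
      using N[OF that] eta_pos[of n] by auto
  qed (use mu_pos K in auto)
  then show ?thesis by (simp add: \<Delta>_def)
qed

lemma gradient_sample_second_moment_bounded:
  "\<exists>C\<ge>0. \<forall>n\<ge>1. (\<integral>\<^sup>+w. ennreal ((norm (dF (iterate n w) (\<zeta> n w)))\<^sup>2) \<partial>M) \<le> ennreal C"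
proof -
  obtain G where G0: "0 \<le> G" and G: "\<And>x. (\<integral>z. (norm (dF x z))\<^sup>2 \<partial>D) \<le> G * (1 + (norm (x - xstar))\<^sup>2)"
    using gradient_second_moment_growth by blast
  obtain C where C0: "0 \<le> C"
    and C: "\<And>n. 1 \<le> n \<Longrightarrow> (\<integral>\<^sup>+w. ennreal ((norm (iterate n w - xstar))\<^sup>2) \<partial>M) \<le> ennreal C"
    using iterate_second_moment_bounded by blast
  have "(\<integral>\<^sup>+w. ennreal ((norm (dF (iterate n w) (\<zeta> n w)))\<^sup>2) \<partial>M) \<le> ennreal (G * (1 + C))"
    if n: "1 \<le> n" for n
  proof -
    define g where "g = (\<lambda>(x, z). ennreal ((norm (dF x z))\<^sup>2))"
    have g: "g \<in> borel_measurable (borel \<Otimes>\<^sub>M D)"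
      unfolding g_def using borel_measurable_dF by (simp add: split_beta)
    have "(\<integral>\<^sup>+w. g (iterate n w, \<zeta> n w) \<partial>M) = (\<integral>\<^sup>+w. (\<integral>\<^sup>+z. g (iterate n w, z) \<partial>D) \<partial>M)"
      by (rule nn_integral_iterate_zeta[OF n g])
    also have "\<dots> \<le> (\<integral>\<^sup>+w. ennreal G * (1 + ennreal ((norm (iterate n w - xstar))\<^sup>2)) \<partial>M)"
    proof (rule nn_integral_mono)
      fix w
      let ?x = "iterate n w"
      have "(\<integral>\<^sup>+z. g (?x, z) \<partial>D) = ennreal (\<integral>z. (norm (dF ?x z))\<^sup>2 \<partial>D)"
        unfolding g_def prod.case by (rule nn_integral_eq_integral[OF dF_square_integrable]) simp
      also have "\<dots> \<le> ennreal (G * (1 + (norm (?x - xstar))\<^sup>2))" by (rule ennreal_leI[OF G])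
      finally show "(\<integral>\<^sup>+z. g (?x, z) \<partial>D) \<le> ennreal G * (1 + ennreal ((norm (?x - xstar))\<^sup>2))"
        using G0 by (simp add: ennreal_mult ennreal_plus)
    qed
    also have "\<dots> = ennreal G * (1 + (\<integral>\<^sup>+w. ennreal ((norm (iterate n w - xstar))\<^sup>2) \<partial>M))"
      using measurable_iterate[OF n] by (simp add: nn_integral_add nn_integral_cmult sample.emeasure_space_1)
    also have "\<dots> \<le> ennreal G * (1 + ennreal C)"
      by (intro mult_left_mono add_left_mono C n) simp
    also have "\<dots> = ennreal (G * (1 + C))" using G0 C0 by (simp add: ennreal_mult ennreal_plus)
    finally show ?thesis by (simp add: g_def)
  qed
  moreover have "0 \<le> G * (1 + C)" using G0 C0 by simp
  ultimately show ?thesis by blast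
qed

lemma vcheck_second_moment_recursion:
  assumes n: "1 \<le> n" and \<theta>: "0 < \<theta>" and K0: "0 \<le> K"
    and K: "(\<integral>\<^sup>+w. ennreal ((norm (dF (iterate n w) (\<zeta> n w)))\<^sup>2) \<partial>M) \<le> ennreal K"
  shows "(\<integral>\<^sup>+w. ennreal ((norm (vcheck (Suc n) w))\<^sup>2) \<partial>M)
    \<le> ennreal ((1 - p n) * ((1 + \<theta>) * (growth n)\<^sup>2)) * (\<integral>\<^sup>+w. ennreal ((norm (vcheck n w))\<^sup>2) \<partial>M)
      + ennreal ((1 - p n) * ((1 + 1 / \<theta>) * (h n)\<^sup>2 * K))"
proof -
  define c where "c = \<eta> (n - 1) powr (\<beta> - 1)"
  define g where "g = (\<lambda>(x, z). ennreal ((norm (growth n *\<^sub>R (c *\<^sub>R P_col x) - h n *\<^sub>R P_col (dF x z)))\<^sup>2))"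
  have "(\<lambda>p. P_col (dF (fst p) (snd p))) \<in> borel_measurable (borel \<Otimes>\<^sub>M D)"
    using measurable_compose[OF borel_measurable_dF borel_measurable_P_col] by (simp add: split_beta)
  moreover have "(\<lambda>p. P_col (fst p)) \<in> borel_measurable (borel \<Otimes>\<^sub>M D)"
    by (rule measurable_compose[OF measurable_fst borel_measurable_P_col])
  ultimately have g: "g \<in> borel_measurable (borel \<Otimes>\<^sub>M D)"
    unfolding g_def by (simp add: split_beta)
  have g_eq: "g (iterate n w, \<zeta> n w) = ennreal ((norm (vcheck_minus n w))\<^sup>2)" for w
    unfolding g_def vcheck_minus_eq vcheck_def c_def by simp
  have p: "0 \<le> 1 - p n" using p_range[OF n] by simp
  have "(\<integral>\<^sup>+w. g (iterate n w, \<zeta> n w) \<partial>M)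
      \<le> (\<integral>\<^sup>+w. ennreal ((1 + \<theta>) * (growth n)\<^sup>2) * ennreal ((norm (vcheck n w))\<^sup>2)
          + ennreal ((1 + 1 / \<theta>) * (h n)\<^sup>2) * ennreal ((norm (dF (iterate n w) (\<zeta> n w)))\<^sup>2) \<partial>M)"
  proof (rule nn_integral_mono)
    fix w
    let ?d = "dF (iterate n w) (\<zeta> n w)"
    have "(norm (vcheck_minus n w))\<^sup>2
        \<le> (1 + \<theta>) * (norm (growth n *\<^sub>R vcheck n w))\<^sup>2 + (1 + 1 / \<theta>) * (norm (h n *\<^sub>R P_col ?d))\<^sup>2"
      unfolding vcheck_minus_eq by (rule norm_diff_square_le[OF \<theta>])
    also have "(norm (h n *\<^sub>R P_col ?d))\<^sup>2 \<le> (h n)\<^sup>2 * (norm ?d)\<^sup>2"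
      using norm_P_col_le[of ?d] by (simp add: power_mult_distrib mult_left_mono power_mono)
    finally have "(norm (vcheck_minus n w))\<^sup>2
        \<le> ((1 + \<theta>) * (growth n)\<^sup>2) * (norm (vcheck n w))\<^sup>2 + ((1 + 1 / \<theta>) * (h n)\<^sup>2) * (norm ?d)\<^sup>2"
      using \<theta> by (simp add: power_mult_distrib mult_left_mono mult.assoc)
    then show "g (iterate n w, \<zeta> n w) \<le> ennreal ((1 + \<theta>) * (growth n)\<^sup>2) * ennreal ((norm (vcheck n w))\<^sup>2)
        + ennreal ((1 + 1 / \<theta>) * (h n)\<^sup>2) * ennreal ((norm ?d)\<^sup>2)"
      unfolding g_eq using \<theta> by (simp add: ennreal_leI flip: ennreal_mult ennreal_plus)
  qed
  also have "\<dots> = ennreal ((1 + \<theta>) * (growth n)\<^sup>2) * (\<integral>\<^sup>+w. ennreal ((norm (vcheck n w))\<^sup>2) \<partial>M)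
      + ennreal ((1 + 1 / \<theta>) * (h n)\<^sup>2) * (\<integral>\<^sup>+w. ennreal ((norm (dF (iterate n w) (\<zeta> n w)))\<^sup>2) \<partial>M)"
  proof -
    have "(\<lambda>w. ennreal ((norm (vcheck n w))\<^sup>2)) \<in> borel_measurable M"
      "(\<lambda>w. ennreal ((norm (dF (iterate n w) (\<zeta> n w)))\<^sup>2)) \<in> borel_measurable M"
      using borel_measurable_vcheck[OF n] borel_measurable_gradient_sample[OF n] by simp_all
    then show ?thesis by (subst nn_integral_add) (simp_all add: nn_integral_cmult)
  qed
  also have "\<dots> \<le> ennreal ((1 + \<theta>) * (growth n)\<^sup>2) * (\<integral>\<^sup>+w. ennreal ((norm (vcheck n w))\<^sup>2) \<partial>M)
      + ennreal ((1 + 1 / \<theta>) * (h n)\<^sup>2) * ennreal K"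
    by (rule add_left_mono[OF mult_left_mono[OF K]]) simp
  finally have bound: "(\<integral>\<^sup>+w. g (iterate n w, \<zeta> n w) \<partial>M)
      \<le> ennreal ((1 + \<theta>) * (growth n)\<^sup>2) * (\<integral>\<^sup>+w. ennreal ((norm (vcheck n w))\<^sup>2) \<partial>M)
        + ennreal ((1 + 1 / \<theta>) * (h n)\<^sup>2) * ennreal K" .
  have "(\<integral>\<^sup>+w. ennreal ((norm (vcheck (Suc n) w))\<^sup>2) \<partial>M)
      = (\<integral>\<^sup>+w. (if \<omega> n w then 0 else g (iterate n w, \<zeta> n w)) \<partial>M)"
    using n by (intro nn_integral_cong) (simp add: vcheck_Suc g_eq)
  also have "\<dots> = ennreal (1 - p n) * (\<integral>\<^sup>+w. g (iterate n w, \<zeta> n w) \<partial>M)"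
    by (rule nn_integral_reset[OF n g])
  also have "\<dots> \<le> ennreal (1 - p n) *
      (ennreal ((1 + \<theta>) * (growth n)\<^sup>2) * (\<integral>\<^sup>+w. ennreal ((norm (vcheck n w))\<^sup>2) \<partial>M)
        + ennreal ((1 + 1 / \<theta>) * (h n)\<^sup>2) * ennreal K)"
    by (rule mult_left_mono[OF bound]) simp
  also have "\<dots> = ennreal ((1 - p n) * ((1 + \<theta>) * (growth n)\<^sup>2)) * (\<integral>\<^sup>+w. ennreal ((norm (vcheck n w))\<^sup>2) \<partial>M)
      + ennreal ((1 - p n) * ((1 + 1 / \<theta>) * (h n)\<^sup>2 * K))"
  proof -
    have alg: "ennreal (1 - p n) * (ennreal a * V + ennreal b * ennreal K)
        = ennreal ((1 - p n) * a) * V + ennreal ((1 - p n) * (b * K))" if "0 \<le> a" "0 \<le> b" for a b V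
      using p K0 that by (simp add: ennreal_mult distrib_left mult.assoc)
    show ?thesis by (rule alg) (use \<theta> in simp_all)
  qed
  finally show ?thesis .
qed

text \<open>
  Per step, a reset removes the fraction \<open>\<gamma> * h n\<close> of the second moment. With \<open>\<theta> = \<gamma> * h n / 4\<close>, the growth of
  the scale and the split of the square give back at most half of it, and the gradient contributes a
  term of order \<open>h n\<close>.
\<close>

lemma vcheck_second_moment_bounded:
  "\<exists>C\<ge>0. \<forall>n\<ge>1. (\<integral>\<^sup>+w. ennreal ((norm (vcheck n w))\<^sup>2) \<partial>M) \<le> ennreal C"
proof -
  obtain K where K0: "0 \<le> K"
    and K: "\<And>n. 1 \<le> n \<Longrightarrow> (\<integral>\<^sup>+w. ennreal ((norm (dF (iterate n w) (\<zeta> n w)))\<^sup>2) \<partial>M) \<le> ennreal K"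
    using gradient_sample_second_moment_bounded by blast
  define V where "V n = (\<integral>\<^sup>+w. ennreal ((norm (vcheck n w))\<^sup>2) \<partial>M)" for n
  have rec: "V (Suc n) \<le> ennreal a * V n + ennreal b"
    if "1 \<le> n" "0 < \<theta>" "(1 - p n) * ((1 + \<theta>) * (growth n)\<^sup>2) \<le> a"
      "(1 - p n) * ((1 + 1 / \<theta>) * (h n)\<^sup>2 * K) \<le> b" for n \<theta> a b
    unfolding V_def
    by (rule order_trans[OF vcheck_second_moment_recursion[OF that(1,2) K0 K[OF that(1)]]])
      (intro add_mono mult_right_mono ennreal_leI that(3,4) zero_le)
  have "eventually (\<lambda>n. (growth n - 1) / h n < \<gamma> / 12) sequentially"
    using order_tendstoD(2)[OF growth_relative_tendsto_0, of "\<gamma> / 12"] gamma_pos by simp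
  moreover have "eventually (\<lambda>n. h n < 1 / \<gamma>) sequentially"
    using order_tendstoD(2)[OF h_tendsto_0, of "1 / \<gamma>"] gamma_pos by simp
  ultimately have "eventually (\<lambda>n. (growth n - 1) / h n < \<gamma> / 12 \<and> h n < 1 / \<gamma>) sequentially"
    by (rule eventually_conj)
  then obtain N where N: "\<And>n. N \<le> n \<Longrightarrow> (growth n - 1) / h n < \<gamma> / 12 \<and> h n < 1 / \<gamma>"
    unfolding eventually_sequentially by blast
  have gh: "0 < \<gamma> * h n" "\<gamma> * h n \<le> 1" if "N \<le> n" for n
    using N[OF that] gamma_pos h_pos[of n] by (simp_all add: field_simps)
  have "\<exists>C\<ge>0. \<forall>n\<ge>1. V n \<le> ennreal C"
  proof (rule contracting_recursion_bounded)
    have "V 1 = ennreal ((norm (\<eta> 0 powr (\<beta> - 1) *\<^sub>R P_col x1))\<^sup>2)"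
      by (simp add: V_def vcheck_def sample.emeasure_space_1)
    then show "V 1 < \<infinity>" by simp
    show "V (Suc n) \<le> ennreal 18 * V n + ennreal (2 * (h 0)\<^sup>2 * K)" if n: "1 \<le> n" for n
    proof (rule rec[OF n, of 1])
      have p: "0 \<le> 1 - p n" "1 - p n \<le> 1" using p_range[OF n] by auto
      have "growth n \<le> 3" using growth_bounds[OF n] n
        by (rule_tac order_trans[of _ "1 + 2 / real n"]) (auto simp: field_simps)
      then have "(growth n)\<^sup>2 \<le> 3\<^sup>2" using growth_bounds[OF n] by (intro power_mono) auto
      then have "(1 - p n) * ((1 + 1) * (growth n)\<^sup>2) \<le> 1 * ((1 + 1) * 3\<^sup>2)"
        using p by (intro mult_mono) auto
      then show "(1 - p n) * ((1 + 1) * (growth n)\<^sup>2) \<le> 18" by simp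
      have "(h n)\<^sup>2 \<le> (h 0)\<^sup>2" using h_le[of n] h_pos[of n] by (intro power_mono) auto
      then have "(1 - p n) * ((1 + 1 / 1) * (h n)\<^sup>2 * K) \<le> 1 * ((1 + 1 / 1) * (h 0)\<^sup>2 * K)"
        using p K0 by (intro mult_mono) auto
      then show "(1 - p n) * ((1 + 1 / 1) * (h n)\<^sup>2 * K) \<le> 2 * (h 0)\<^sup>2 * K" by simp
    qed simp
    show "V (Suc n) \<le> ennreal (1 - \<gamma> / 2 * h n) * V n + ennreal (h n * (5 * K / \<gamma>))"
      if n: "N \<le> n" "1 \<le> n" for n
    proof (rule rec[OF n(2), of "\<gamma> * h n / 4"])
      define y where "y = \<gamma> * h n"
      have y: "0 < y" "y \<le> 1" using gh[OF n(1)] by (simp_all add: y_def)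
      have p: "1 - p n = 1 - y" using y p_eq[OF n(2)] by (simp add: y_def h_def)
      define e where "e = growth n - 1"
      have e: "0 \<le> e" "e \<le> y / 12"
        using growth_bounds[OF n(2)] N[OF n(1)] h_pos[of n] by (simp_all add: e_def y_def field_simps)
      have "(growth n)\<^sup>2 = 1 + 2 * e + e * e" by (simp add: e_def power2_eq_square algebra_simps)
      also have "e * e \<le> e * 1" using e y by (intro mult_left_mono) auto
      finally have g2: "(growth n)\<^sup>2 \<le> 1 + y / 4" using e by simp
      have "(1 - y) * ((1 + y / 4) * (growth n)\<^sup>2) \<le> (1 - y) * ((1 + y / 4) * (1 + y / 4))"
        using y g2 by (intro mult_left_mono) auto
      also have "\<dots> = 1 - y / 2 - y * (y * 7 / 16 + y * y / 16)" by (simp add: field_simps)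
      also have "\<dots> \<le> 1 - y / 2" using y by simp
      finally show "(1 - p n) * ((1 + \<gamma> * h n / 4) * (growth n)\<^sup>2) \<le> 1 - \<gamma> / 2 * h n"
        unfolding p by (simp add: y_def)
      have "(1 - y) * ((1 + 1 / (y / 4)) * (h n)\<^sup>2 * K) \<le> 1 * ((1 + 1 / (y / 4)) * (h n)\<^sup>2 * K)"
        using y K0 by (intro mult_right_mono) auto
      also have "\<dots> = (h n * h n + 4 * (h n * (h n / y))) * K" using y by (simp add: power2_eq_square field_simps)
      also have "h n / y = 1 / \<gamma>" using gamma_pos h_pos[of n] by (simp add: y_def)
      also have "(h n * h n + 4 * (h n * (1 / \<gamma>))) * K \<le> (h n * (1 / \<gamma>) + 4 * (h n * (1 / \<gamma>))) * K"
        using N[OF n(1)] h_pos[of n] K0 by (intro mult_right_mono add_right_mono mult_left_mono) auto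
      also have "\<dots> = h n * (5 * K / \<gamma>)" by (simp add: field_simps)
      finally show "(1 - p n) * ((1 + 1 / (\<gamma> * h n / 4)) * (h n)\<^sup>2 * K) \<le> h n * (5 * K / \<gamma>)"
        unfolding p by (simp add: y_def)
      show "0 < \<gamma> * h n / 4" using y by (simp add: y_def)
    qed
    show "0 \<le> h n \<and> \<gamma> / 2 * h n \<le> 1" if "N \<le> n" for n
      using gh[OF that] h_pos[of n] by auto
  qed (use gamma_pos K0 in auto)
  then show ?thesis by (simp add: V_def)
qed

text \<open>
  Both parts of the velocity have bounded second moments, as the relative growth of the scale is
  bounded.
\<close>

lemma slope_second_moment_bounded:
  "\<exists>C\<ge>0. \<forall>n\<ge>1. (\<integral>\<^sup>+w. ennreal ((norm (slope n w))\<^sup>2) \<partial>M) \<le> ennreal C"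
proof -
  obtain K where K0: "0 \<le> K"
    and K: "\<And>n. 1 \<le> n \<Longrightarrow> (\<integral>\<^sup>+w. ennreal ((norm (dF (iterate n w) (\<zeta> n w)))\<^sup>2) \<partial>M) \<le> ennreal K"
    using gradient_sample_second_moment_bounded by blast
  obtain C where C0: "0 \<le> C"
    and C: "\<And>n. 1 \<le> n \<Longrightarrow> (\<integral>\<^sup>+w. ennreal ((norm (vcheck n w))\<^sup>2) \<partial>M) \<le> ennreal C"
    using vcheck_second_moment_bounded by blast
  define k where "k = 2 * (2 / h 0)\<^sup>2"
  have k: "0 \<le> k" by (simp add: k_def)
  have "(\<integral>\<^sup>+w. ennreal ((norm (slope n w))\<^sup>2) \<partial>M) \<le> ennreal (2 * K + k * C)" if n: "1 \<le> n" for n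
  proof -
    have "(\<integral>\<^sup>+w. ennreal ((norm (slope n w))\<^sup>2) \<partial>M)
        \<le> (\<integral>\<^sup>+w. ennreal 2 * ennreal ((norm (dF (iterate n w) (\<zeta> n w)))\<^sup>2) + ennreal k * ennreal ((norm (vcheck n w))\<^sup>2) \<partial>M)"
    proof (rule nn_integral_mono)
      fix w
      let ?d = "dF (iterate n w) (\<zeta> n w)" and ?c = "(growth n - 1) / h n"
      have "(norm (slope n w))\<^sup>2 \<le> 2 * (norm (P_col ?d))\<^sup>2 + 2 * (norm (?c *\<^sub>R vcheck n w))\<^sup>2"
        using norm_diff_square_le[OF zero_less_one, of "P_col ?d" "?c *\<^sub>R vcheck n w"]
        unfolding slope_eq by (simp only: one_add_one div_by_1)
      moreover have "(norm (P_col ?d))\<^sup>2 \<le> (norm ?d)\<^sup>2" by (intro power_mono norm_P_col_le norm_ge_zero)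
      moreover have "(norm (?c *\<^sub>R vcheck n w))\<^sup>2 \<le> (2 / h 0)\<^sup>2 * (norm (vcheck n w))\<^sup>2"
      proof -
        have "0 \<le> ?c" using growth_bounds[OF n] h_pos[of n] by simp
        then have "?c\<^sup>2 \<le> (2 / h 0)\<^sup>2" using growth_relative_bound[OF n] by (intro power_mono)
        then have "?c\<^sup>2 * (norm (vcheck n w))\<^sup>2 \<le> (2 / h 0)\<^sup>2 * (norm (vcheck n w))\<^sup>2"
          by (rule mult_right_mono) simp
        moreover have "(norm (?c *\<^sub>R vcheck n w))\<^sup>2 = ?c\<^sup>2 * (norm (vcheck n w))\<^sup>2"
          by (simp only: norm_scaleR power_mult_distrib power2_abs)
        ultimately show ?thesis by simp
      qed
      ultimately have "(norm (slope n w))\<^sup>2 \<le> 2 * (norm ?d)\<^sup>2 + k * (norm (vcheck n w))\<^sup>2"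
        unfolding k_def mult.assoc by linarith
      then have "ennreal ((norm (slope n w))\<^sup>2) \<le> ennreal (2 * (norm ?d)\<^sup>2 + k * (norm (vcheck n w))\<^sup>2)"
        by (rule ennreal_leI)
      also have "\<dots> = ennreal 2 * ennreal ((norm ?d)\<^sup>2) + ennreal k * ennreal ((norm (vcheck n w))\<^sup>2)"
        using k by (simp add: ennreal_plus ennreal_mult)
      finally show "ennreal ((norm (slope n w))\<^sup>2)
        \<le> ennreal 2 * ennreal ((norm ?d)\<^sup>2) + ennreal k * ennreal ((norm (vcheck n w))\<^sup>2)" .
    qed
    also have "\<dots> = ennreal 2 * (\<integral>\<^sup>+w. ennreal ((norm (dF (iterate n w) (\<zeta> n w)))\<^sup>2) \<partial>M)
        + ennreal k * (\<integral>\<^sup>+w. ennreal ((norm (vcheck n w))\<^sup>2) \<partial>M)"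
    proof -
      have "(\<lambda>w. ennreal ((norm (vcheck n w))\<^sup>2)) \<in> borel_measurable M"
        "(\<lambda>w. ennreal ((norm (dF (iterate n w) (\<zeta> n w)))\<^sup>2)) \<in> borel_measurable M"
        using borel_measurable_vcheck[OF n] borel_measurable_gradient_sample[OF n] by simp_all
      then show ?thesis by (subst nn_integral_add) (simp_all add: nn_integral_cmult del: ennreal_numeral)
    qed
    also have "\<dots> \<le> ennreal 2 * ennreal K + ennreal k * ennreal C"
      by (rule add_mono[OF mult_left_mono[OF K[OF n]] mult_left_mono[OF C[OF n]]]) simp_all
    also have "\<dots> = ennreal (2 * K + k * C)" using K0 C0 k by (simp add: ennreal_plus ennreal_mult)
    finally show ?thesis .
  qed
  moreover have "0 \<le> 2 * K + k * C" using K0 C0 k by simp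
  ultimately show ?thesis by blast
qed

end

section \<open>Separation of the resets\<close>

text \<open>
  The step lengths have a divergent sum because \<open>\<alpha> * \<beta> < 1\<close>, so every time is reached.
\<close>

sublocale lpsa_regime \<subseteq> time_grid h
proof
  show "0 < h k" for k by (rule h_pos)
  fix n :: nat and c :: real assume n: "1 \<le> n"
  show "\<exists>m\<ge>n. c < sum h {n..m}"
  proof (rule ccontr)
    assume "\<not> ?thesis"
    then have le: "sum h {n..m} \<le> c" if "n \<le> m" for m using that by force
    have "sum h {..<m} \<le> sum h {..<n} + max 0 c" for m
    proof -
      have "sum h {..<m} \<le> sum h ({..<n} \<union> {n..max n m})"
        using h_pos by (intro sum_mono2) (auto simp: less_imp_le)
      also have "\<dots> = sum h {..<n} + sum h {n..max n m}" by (intro sum.union_disjoint) auto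
      also have "sum h {n..max n m} \<le> max 0 c" using le[of "max n m"] by simp
      finally show ?thesis by simp
    qed
    then have "summable h" using h_pos by (intro summableI_nonneg_bounded) (auto simp: less_imp_le)
    then have sum: "summable (\<lambda>n. inverse (h 0) * h n)" by (rule summable_mult)
    have "eventually (\<lambda>n. inverse (h 0) * h n = real n powr (- (\<alpha> * \<beta>))) sequentially"
      using eventually_ge_at_top[of 1] by eventually_elim (use h_pos[of 0] in \<open>simp add: h_eq\<close>)
    then have "summable (\<lambda>n. real n powr (- (\<alpha> * \<beta>)))"
      using sum by (rule summable_cong[THEN iffD1])
    then show False using exponent_less_1 by (simp add: summable_real_powr_iff)
  qed
qed

context lpsa_regime
begin

lemma Nidx_eq: "Nidx n t = idx n t"
  by (simp add: Nidx_def idx_def h_def)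

lemma Gam_diff: "1 \<le> n \<Longrightarrow> n \<le> k \<Longrightarrow> Gam k - Gam n = grid n k"
  unfolding Gam_def grid_def h_def
  using sum.atLeastLessThan_concat[of 1 n k "\<lambda>k. \<eta> k powr \<beta>"] by simp

lemma vbar_eq_path: "1 \<le> n \<Longrightarrow> vbar n t w = path (\<lambda>k. vcheck k w) (\<lambda>k. slope k w) n t"
  by (simp add: vbar_def path_def Nidx_eq Gam_diff idx_ge slope_def)

lemma p_le: "1 \<le> k \<Longrightarrow> p k \<le> \<gamma> * h k"
  by (simp add: p_eq h_def)

lemma omega_events [measurable]: "1 \<le> k \<Longrightarrow> {w \<in> space M. \<omega> k w} \<in> sets M"
  using \<omega>_measurable[of k] by measurable

lemma prob_some_omega_le:
  assumes fin: "finite S" and S: "\<And>k. k \<in> S \<Longrightarrow> 1 \<le> k"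
  shows "{w \<in> space M. \<exists>k\<in>S. \<omega> k w} \<in> sets M"
    "sample.prob {w \<in> space M. \<exists>k\<in>S. \<omega> k w} \<le> \<gamma> * sum h S"
proof -
  have eq: "{w \<in> space M. \<exists>k\<in>S. \<omega> k w} = (\<Union>k\<in>S. {w \<in> space M. \<omega> k w})" by auto
  show "{w \<in> space M. \<exists>k\<in>S. \<omega> k w} \<in> sets M"
    unfolding eq using fin S omega_events by (intro sets.finite_UN) auto
  have "sample.prob (\<Union>k\<in>S. {w \<in> space M. \<omega> k w}) \<le> (\<Sum>k\<in>S. sample.prob {w \<in> space M. \<omega> k w})"
    using fin S omega_events by (intro sample.finite_measure_subadditive_finite) auto
  also have "\<dots> \<le> (\<Sum>k\<in>S. \<gamma> * h k)" using S p_le by (intro sum_mono) (simp add: prob_omega)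
  finally show "sample.prob {w \<in> space M. \<exists>k\<in>S. \<omega> k w} \<le> \<gamma> * sum h S"
    by (simp add: eq sum_distrib_left)
qed

lemma prob_two_omegas_le:
  assumes fin: "finite S" and S: "\<And>k l. (k, l) \<in> S \<Longrightarrow> 1 \<le> k \<and> k < l"
  shows "{w \<in> space M. \<exists>(k, l)\<in>S. \<omega> k w \<and> \<omega> l w} \<in> sets M"
    "sample.prob {w \<in> space M. \<exists>(k, l)\<in>S. \<omega> k w \<and> \<omega> l w} \<le> \<gamma>\<^sup>2 * (\<Sum>(k, l)\<in>S. h k * h l)"
proof -
  have eq: "{w \<in> space M. \<exists>(k, l)\<in>S. \<omega> k w \<and> \<omega> l w} = (\<Union>(k, l)\<in>S. {w \<in> space M. \<omega> k w \<and> \<omega> l w})" by auto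
  have ev: "(case q of (k, l) \<Rightarrow> {w \<in> space M. \<omega> k w \<and> \<omega> l w}) \<in> sets M" if q: "q \<in> S" for q
  proof -
    obtain k l where kl: "q = (k, l)" by (cases q)
    then have "1 \<le> k" "1 \<le> l" using S q by force+
    then have "{w \<in> space M. \<omega> k w} \<inter> {w \<in> space M. \<omega> l w} \<in> sets M" by (intro sets.Int omega_events)
    moreover have "{w \<in> space M. \<omega> k w} \<inter> {w \<in> space M. \<omega> l w} = {w \<in> space M. \<omega> k w \<and> \<omega> l w}" by auto
    ultimately show ?thesis by (simp add: kl)
  qed
  show "{w \<in> space M. \<exists>(k, l)\<in>S. \<omega> k w \<and> \<omega> l w} \<in> sets M"
    unfolding eq using fin ev by (intro sets.finite_UN) auto
  have "sample.prob (\<Union>(k, l)\<in>S. {w \<in> space M. \<omega> k w \<and> \<omega> l w})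
      \<le> (\<Sum>q\<in>S. sample.prob (case q of (k, l) \<Rightarrow> {w \<in> space M. \<omega> k w \<and> \<omega> l w}))"
    using fin ev by (intro sample.finite_measure_subadditive_finite) auto
  also have "\<dots> \<le> (\<Sum>q\<in>S. \<gamma>\<^sup>2 * (case q of (k, l) \<Rightarrow> h k * h l))"
  proof (rule sum_mono)
    fix q assume q: "q \<in> S"
    obtain k l where kl: "q = (k, l)" by (cases q)
    then have n: "1 \<le> k" "1 \<le> l" "k \<noteq> l" using S q by force+
    have "p k * p l \<le> (\<gamma> * h k) * (\<gamma> * h l)"
      using n p_le p_range h_pos gamma_pos by (intro mult_mono) (auto simp: less_imp_le)
    then show "sample.prob (case q of (k, l) \<Rightarrow> {w \<in> space M. \<omega> k w \<and> \<omega> l w}) \<le> \<gamma>\<^sup>2 * (case q of (k, l) \<Rightarrow> h k * h l)"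
      using n by (simp add: kl prob_omega_pair power2_eq_square mult_ac)
  qed
  finally show "sample.prob {w \<in> space M. \<exists>(k, l)\<in>S. \<omega> k w \<and> \<omega> l w} \<le> \<gamma>\<^sup>2 * (\<Sum>(k, l)\<in>S. h k * h l)"
    by (simp add: eq sum_distrib_left)
qed

definition reset_times :: "nat \<Rightarrow> real \<Rightarrow> 'w \<Rightarrow> real set" where
  "reset_times n T w = {grid n (Suc k) | k. n \<le> k \<and> \<omega> k w \<and> grid n (Suc k) < T}"

text \<open>
  The first event is a reset within \<open>\<delta>\<close> after time 0; the second is a pair of resets before \<open>T\<close> at a
  distance of less than \<open>\<delta>\<close>.
\<close>

definition crowded_resets :: "nat \<Rightarrow> real \<Rightarrow> real \<Rightarrow> 'w set" where
  "crowded_resets n T \<delta> = {w \<in> space M. \<exists>k\<in>{k. n \<le> k \<and> grid n (Suc k) < \<delta>}. \<omega> k w}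
     \<union> {w \<in> space M. \<exists>(k, l)\<in>(SIGMA k:{k. n \<le> k \<and> grid n (Suc k) < T}.
          {l. Suc k \<le> l \<and> grid n (Suc l) < grid n (Suc k) + \<delta>}). \<omega> k w \<and> \<omega> l w}"

text \<open>
  Resets shortly before \<open>T\<close> are kept apart from the other coincidences because their probability
  cannot be bounded by a multiple of \<open>\<delta>\<close> alone: a single step may be much longer than \<open>\<delta>\<close>.
\<close>

definition late_reset :: "nat \<Rightarrow> real \<Rightarrow> real \<Rightarrow> 'w set" where
  "late_reset n T \<delta> = {w \<in> space M. \<exists>k\<in>{k. n \<le> k \<and> T - \<delta> < grid n (Suc k) \<and> grid n (Suc k) < T}. \<omega> k w}"

lemma reset_times_gap:
  assumes n: "1 \<le> n" and T: "0 < T" and w: "w \<in> space M" "w \<notin> crowded_resets n T \<delta>" "w \<notin> late_reset n T \<delta>"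
    and \<delta>: "\<delta> \<le> T"
    and u: "u \<in> {0, T} \<union> reset_times n T w" and v: "v \<in> {0, T} \<union> reset_times n T w" and uv: "u < v"
  shows "u + \<delta> \<le> v"
proof (rule ccontr)
  assume "\<not> u + \<delta> \<le> v"
  then have close: "v < u + \<delta>" by simp
  have jump: thesis if t: "t \<in> reset_times n T w"
    and concl: "\<And>k. t = grid n (Suc k) \<Longrightarrow> n \<le> k \<Longrightarrow> \<omega> k w \<Longrightarrow> 0 \<le> t \<Longrightarrow> t < T \<Longrightarrow> thesis" for t thesis
  proof -
    obtain k where "t = grid n (Suc k)" "n \<le> k" "\<omega> k w" "t < T"
      using t unfolding reset_times_def by blast
    then show thesis using concl grid_nonneg[OF n, of "Suc k"] by simp
  qed
  from u consider "u = 0" | "u = T" | "u \<in> reset_times n T w" by blast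
  then show False
  proof cases
    case 1
    then have "v \<noteq> T" "v \<noteq> 0" using close \<delta> uv by auto
    then have "v \<in> reset_times n T w" using v by blast
    then obtain k where k: "v = grid n (Suc k)" "n \<le> k" "\<omega> k w" by (rule jump)
    then have "k \<in> {k. n \<le> k \<and> grid n (Suc k) < \<delta>}" using close 1 by simp
    then show False using w(1,2) k(3) unfolding crowded_resets_def by blast
  next
    case 2
    then have "v \<in> reset_times n T w" using v uv T by auto
    then obtain k where "v < T" by (rule jump)
    then show False using 2 uv by simp
  next
    case 3
    then obtain k where k: "u = grid n (Suc k)" "n \<le> k" "\<omega> k w" "0 \<le> u" "u < T" by (rule jump)
    from v consider "v = 0" | "v = T" | "v \<in> reset_times n T w" by blast
    then show False
    proof cases
      case 1
      then show False using uv k by simp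
    next
      case 2
      then have "k \<in> {k. n \<le> k \<and> T - \<delta> < grid n (Suc k) \<and> grid n (Suc k) < T}" using close k by simp
      then show False using w(1,3) k(3) unfolding late_reset_def by blast
    next
      case 3
      then obtain l where l: "v = grid n (Suc l)" "n \<le> l" "\<omega> l w" by (rule jump)
      have "k < l"
      proof (rule ccontr)
        assume "\<not> k < l"
        then have "grid n (Suc l) \<le> grid n (Suc k)" using l(2) by (intro grid_mono[OF n]) simp_all
        then have "v \<le> u" using k(1) l(1) by simp
        then show False using uv by simp
      qed
      then have "(k, l) \<in> (SIGMA k:{k. n \<le> k \<and> grid n (Suc k) < T}.
          {l. Suc k \<le> l \<and> grid n (Suc l) < grid n (Suc k) + \<delta>})"
        using k l close by simp
      then have "w \<in> crowded_resets n T \<delta>"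
        unfolding crowded_resets_def using w(1) k(3) l(3) by (intro UnI2 CollectI conjI bexI[of _ "(k, l)"]) simp_all
      then show False using w(2) by simp
    qed
  qed
qed

text \<open>
  Resets have probability at most \<open>\<gamma> * h k\<close>, and steps that end within a window of length \<open>\<delta>\<close> after a
  grid point have total length at most \<open>\<delta>\<close>. For pairs the sum over the first reset adds a factor of at
  most \<open>\<gamma> * T\<close>.
\<close>

lemma prob_crowded_resets_le:
  assumes n: "1 \<le> n" and T: "0 < T" and \<delta>: "0 < \<delta>"
  shows "crowded_resets n T \<delta> \<in> sets M" "sample.prob (crowded_resets n T \<delta>) \<le> (\<gamma> + \<gamma>\<^sup>2 * T) * \<delta>"
proof -
  define S1 where "S1 = {k. n \<le> k \<and> grid n (Suc k) < \<delta>}"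
  define S where "S = {k. n \<le> k \<and> grid n (Suc k) < T}"
  define R where "R k = {l. Suc k \<le> l \<and> grid n (Suc l) < grid n (Suc k) + \<delta>}" for k
  have fin: "finite S1" "finite S" using finite_grid_below[OF n] by (simp_all add: S1_def S_def)
  have finR: "finite (R k)" if "k \<in> S" for k
    by (rule finite_subset[OF _ finite_grid_below[OF n, of "grid n (Suc k) + \<delta>"]])
      (use that in \<open>auto simp: R_def S_def\<close>)
  have finSR: "finite (Sigma S R)" using fin finR by (intro finite_SigmaI)
  have eq: "crowded_resets n T \<delta> = {w \<in> space M. \<exists>k\<in>S1. \<omega> k w} \<union> {w \<in> space M. \<exists>(k, l)\<in>Sigma S R. \<omega> k w \<and> \<omega> l w}"
    by (simp add: crowded_resets_def S1_def S_def R_def)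
  have S1: "1 \<le> k" if "k \<in> S1" for k using that n by (simp add: S1_def)
  note A = prob_some_omega_le[OF fin(1) S1]
  have SR: "1 \<le> k \<and> k < l" if "(k, l) \<in> Sigma S R" for k l
    using that n by (auto simp: S_def R_def)
  note B = prob_two_omegas_le[OF finSR SR]
  show "crowded_resets n T \<delta> \<in> sets M" unfolding eq using A(1) B(1) by (rule sets.Un)
  have "sum h S1 \<le> \<delta>"
    using sum_steps_below[OF n order_refl, of \<delta>] \<delta> by (simp add: S1_def grid_start)
  then have 1: "\<gamma> * sum h S1 \<le> \<gamma> * \<delta>" using gamma_pos by simp
  have "(\<Sum>(k, l)\<in>Sigma S R. h k * h l) = (\<Sum>k\<in>S. \<Sum>l\<in>R k. h k * h l)"
    using fin finR by (intro sum.Sigma[symmetric]) auto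
  also have "\<dots> = (\<Sum>k\<in>S. h k * sum h (R k))" by (simp add: sum_distrib_left)
  also have "\<dots> \<le> (\<Sum>k\<in>S. h k * \<delta>)"
  proof (intro sum_mono mult_left_mono)
    fix k assume "k \<in> S"
    then show "sum h (R k) \<le> \<delta>"
      using sum_steps_below[OF n, of "Suc k" "grid n (Suc k) + \<delta>"] \<delta> by (simp add: R_def S_def)
  qed (simp add: h_pos less_imp_le)
  also have "\<dots> = sum h S * \<delta>" by (simp add: sum_distrib_right)
  also have "\<dots> \<le> T * \<delta>"
    using sum_steps_below[OF n order_refl, of T] T \<delta> by (intro mult_right_mono) (simp_all add: S_def grid_start)
  finally have 2: "\<gamma>\<^sup>2 * (\<Sum>(k, l)\<in>Sigma S R. h k * h l) \<le> \<gamma>\<^sup>2 * (T * \<delta>)" by (intro mult_left_mono) auto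
  have "sample.prob (crowded_resets n T \<delta>) \<le> sample.prob {w \<in> space M. \<exists>k\<in>S1. \<omega> k w}
      + sample.prob {w \<in> space M. \<exists>(k, l)\<in>Sigma S R. \<omega> k w \<and> \<omega> l w}"
    unfolding eq by (rule measure_Un_le[OF A(1) B(1)])
  also have "\<dots> \<le> \<gamma> * \<delta> + \<gamma>\<^sup>2 * (T * \<delta>)" using A(2) B(2) 1 2 by linarith
  finally show "sample.prob (crowded_resets n T \<delta>) \<le> (\<gamma> + \<gamma>\<^sup>2 * T) * \<delta>" by (simp add: algebra_simps)
qed

lemma finite_late_reset:
  assumes "1 \<le> n" shows "finite {k. n \<le> k \<and> T - \<delta> < grid n (Suc k) \<and> grid n (Suc k) < T}"
  by (rule finite_subset[OF _ finite_grid_below[OF assms, of T]]) auto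

lemma sets_late_reset: "1 \<le> n \<Longrightarrow> late_reset n T \<delta> \<in> sets M"
  unfolding late_reset_def by (rule prob_some_omega_le[OF finite_late_reset]) auto

lemma prob_late_reset_le:
  assumes n: "1 \<le> n" and \<delta>: "0 < \<delta>" "\<delta> \<le> T" and small: "\<And>k. n \<le> k \<Longrightarrow> h k \<le> \<delta>"
  shows "sample.prob (late_reset n T \<delta>) \<le> 2 * \<gamma> * \<delta>"
proof -
  define S where "S = {k. n \<le> k \<and> T - \<delta> < grid n (Suc k) \<and> grid n (Suc k) < T}"
  \<comment> \<open>Step \<open>m\<close> is the one that reaches from outside into the window
    before \<open>T\<close>; its length accounts for the second \<open>\<delta>\<close>.\<close>
  define m where "m = idx n (T - \<delta>)"
  have m: "n \<le> m" "grid n m \<le> T - \<delta>" "T - \<delta> < grid n (Suc m)"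
    unfolding m_def using idx_ge idx_lower idx_upper n \<delta> by auto
  have "S \<subseteq> {k. m \<le> k \<and> grid n (Suc k) < T}"
  proof
    fix k assume k: "k \<in> S"
    have "m \<le> k"
    proof (rule ccontr)
      assume "\<not> m \<le> k"
      then have "grid n (Suc k) \<le> grid n m" using k by (intro grid_mono[OF n]) (auto simp: S_def)
      then show False using m k by (simp add: S_def)
    qed
    then show "k \<in> {k. m \<le> k \<and> grid n (Suc k) < T}" using k by (simp add: S_def)
  qed
  moreover have "finite {k. m \<le> k \<and> grid n (Suc k) < T}"
    by (rule finite_subset[OF _ finite_grid_below[OF n, of T]]) (use m in auto)
  ultimately have "sum h S \<le> sum h {k. m \<le> k \<and> grid n (Suc k) < T}"
    by (intro sum_mono2) (auto simp: h_pos less_imp_le)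
  also have "\<dots> \<le> T - grid n m" using m \<delta> by (intro sum_steps_below n) auto
  also have "\<dots> \<le> 2 * \<delta>" using m small[of m] grid_Suc[of n m] by simp
  finally have "\<gamma> * sum h S \<le> \<gamma> * (2 * \<delta>)" using gamma_pos by simp
  moreover have "sample.prob (late_reset n T \<delta>) \<le> \<gamma> * sum h S"
    unfolding late_reset_def S_def by (rule prob_some_omega_le[OF finite_late_reset[OF n]]) (use n in auto)
  ultimately show ?thesis by simp
qed

text \<open>
  For a fixed \<open>n\<close> there is a last grid point before \<open>T\<close>.
\<close>

lemma late_reset_empty:
  assumes n: "1 \<le> n"
  shows "\<exists>d>0. \<forall>\<delta>\<le>d. late_reset n T \<delta> = {}"
proof -
  define S where "S = {k. n \<le> k \<and> grid n (Suc k) < T}"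
  have fin: "finite S" using finite_grid_below[OF n] by (simp add: S_def)
  define d where "d = Min (insert 1 ((\<lambda>k. T - grid n (Suc k)) ` S))"
  have d_le: "d \<le> T - grid n (Suc k)" if "k \<in> S" for k
    unfolding d_def using fin that by (intro Min_le) auto
  have "0 < d" unfolding d_def using fin by (subst Min_gr_iff) (auto simp: S_def)
  moreover have "late_reset n T \<delta> = {}" if \<delta>: "\<delta> \<le> d" for \<delta>
  proof -
    have False if "n \<le> k" "T - \<delta> < grid n (Suc k)" "grid n (Suc k) < T" for k
      using d_le[of k] that \<delta> by (simp add: S_def)
    then show ?thesis unfolding late_reset_def by blast
  qed
  ultimately show ?thesis by blast
qed

lemma late_reset_mono: "\<delta> \<le> \<delta>' \<Longrightarrow> late_reset n T \<delta> \<subseteq> late_reset n T \<delta>'"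
proof
  fix w assume \<delta>: "\<delta> \<le> \<delta>'" and "w \<in> late_reset n T \<delta>"
  then obtain k where "w \<in> space M" "n \<le> k" "T - \<delta> < grid n (Suc k)" "grid n (Suc k) < T" "\<omega> k w"
    unfolding late_reset_def by blast
  moreover from this \<delta> have "T - \<delta>' < grid n (Suc k)" by linarith
  ultimately show "w \<in> late_reset n T \<delta>'" unfolding late_reset_def by blast
qed

text \<open>
  Late starting indices have steps shorter than \<open>d0\<close>, so the window before \<open>T\<close> holds total step length at
  most \<open>2 * d0\<close>. For each of the finitely many early ones the window holds no grid point once \<open>\<delta>\<close> is
  small.
\<close>

lemma prob_late_reset_small:
  assumes T: "0 < T" and \<epsilon>: "0 < \<epsilon>"
  shows "\<exists>d>0. \<forall>n\<ge>1. \<forall>\<delta>\<le>d. sample.prob (late_reset n T \<delta>) \<le> \<epsilon>"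
proof -
  define d0 where "d0 = min T (\<epsilon> / (2 * \<gamma>))"
  have d0: "0 < d0" "d0 \<le> T" "2 * \<gamma> * d0 \<le> \<epsilon>"
    using T \<epsilon> gamma_pos by (simp_all add: d0_def min_def field_simps)
  have "eventually (\<lambda>k. h k < d0) sequentially" using order_tendstoD(2)[OF h_tendsto_0 d0(1)] .
  then obtain N where N: "\<And>k. N \<le> k \<Longrightarrow> h k < d0" unfolding eventually_sequentially by blast
  have "\<forall>n\<in>{1..N}. \<exists>d>0. \<forall>\<delta>\<le>d. late_reset n T \<delta> = {}" using late_reset_empty by simp
  then obtain d where d: "\<And>n. n \<in> {1..N} \<Longrightarrow> 0 < d n \<and> (\<forall>\<delta>\<le>d n. late_reset n T \<delta> = {})"
    by metis
  define d1 where "d1 = Min (insert d0 (d ` {1..N}))"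
  have d1: "0 < d1" "d1 \<le> d0" "\<And>n. n \<in> {1..N} \<Longrightarrow> d1 \<le> d n"
  proof -
    show "0 < d1" unfolding d1_def using d d0 by (subst Min_gr_iff) auto
    show "d1 \<le> d0" unfolding d1_def by (intro Min_le) auto
    show "d1 \<le> d n" if "n \<in> {1..N}" for n unfolding d1_def using that by (intro Min_le) auto
  qed
  have "sample.prob (late_reset n T \<delta>) \<le> \<epsilon>" if n: "1 \<le> n" and \<delta>: "\<delta> \<le> d1" for n \<delta>
  proof (cases "n \<le> N")
    case True
    then have "n \<in> {1..N}" using n by simp
    then have "late_reset n T \<delta> = {}" using d[of n] d1(3)[of n] \<delta> by (meson order_trans)
    then show ?thesis using \<epsilon> by simp
  next
    case False
    have "sample.prob (late_reset n T \<delta>) \<le> sample.prob (late_reset n T d0)"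
      using \<delta> d1 n by (intro sample.finite_measure_mono late_reset_mono sets_late_reset) auto
    also have "\<dots> \<le> 2 * \<gamma> * d0"
      using N False by (intro prob_late_reset_le n d0) (meson less_imp_le nat_le_linear order_trans)
    finally show ?thesis using d0 by simp
  qed
  then show ?thesis using d1(1) by blast
qed

end

section \<open>Tightness\<close>

context lpsa_regime
begin

text \<open>
  The steps that meet \<open>[0,T]\<close> have total length at most \<open>T\<close> plus the length of the last step.
\<close>

lemma energy_le:
  assumes n: "1 \<le> n" and T: "0 \<le> T" and C0: "0 \<le> C"
    and C: "\<And>k. 1 \<le> k \<Longrightarrow> (\<integral>\<^sup>+w. ennreal ((norm (slope k w))\<^sup>2) \<partial>M) \<le> ennreal C"
  shows "(\<integral>\<^sup>+w. ennreal (\<Sum>k=n..idx n T. h k * (norm (slope k w))\<^sup>2) \<partial>M) \<le> ennreal ((T + h 0) * C)"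
proof -
  let ?I = "{n..idx n T}"
  have "(\<integral>\<^sup>+w. ennreal (\<Sum>k\<in>?I. h k * (norm (slope k w))\<^sup>2) \<partial>M)
      = (\<integral>\<^sup>+w. (\<Sum>k\<in>?I. ennreal (h k) * ennreal ((norm (slope k w))\<^sup>2)) \<partial>M)"
  proof (rule nn_integral_cong)
    fix w
    have "ennreal (\<Sum>k\<in>?I. h k * (norm (slope k w))\<^sup>2) = (\<Sum>k\<in>?I. ennreal (h k * (norm (slope k w))\<^sup>2))"
      by (rule sum_ennreal[symmetric]) (simp add: h_pos less_imp_le)
    also have "\<dots> = (\<Sum>k\<in>?I. ennreal (h k) * ennreal ((norm (slope k w))\<^sup>2))"
      by (intro sum.cong refl ennreal_mult) (simp_all add: h_pos less_imp_le)
    finally show "ennreal (\<Sum>k\<in>?I. h k * (norm (slope k w))\<^sup>2)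
      = (\<Sum>k\<in>?I. ennreal (h k) * ennreal ((norm (slope k w))\<^sup>2))" .
  qed
  also have "\<dots> = (\<Sum>k\<in>?I. (\<integral>\<^sup>+w. ennreal (h k) * ennreal ((norm (slope k w))\<^sup>2) \<partial>M))"
    using borel_measurable_slope n by (intro nn_integral_sum) simp
  also have "\<dots> \<le> (\<Sum>k\<in>?I. ennreal (h k * C))"
  proof (rule sum_mono)
    fix k assume k: "k \<in> ?I"
    then have k1: "1 \<le> k" using n by simp
    have "(\<integral>\<^sup>+w. ennreal (h k) * ennreal ((norm (slope k w))\<^sup>2) \<partial>M)
        = ennreal (h k) * (\<integral>\<^sup>+w. ennreal ((norm (slope k w))\<^sup>2) \<partial>M)"
      using borel_measurable_slope[OF k1] by (intro nn_integral_cmult) simp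
    also have "\<dots> \<le> ennreal (h k) * ennreal C" by (rule mult_left_mono[OF C[OF k1]]) simp
    also have "\<dots> = ennreal (h k * C)" using h_pos[of k] C0 by (simp add: ennreal_mult)
    finally show "(\<integral>\<^sup>+w. ennreal (h k) * ennreal ((norm (slope k w))\<^sup>2) \<partial>M) \<le> ennreal (h k * C)" .
  qed
  also have "\<dots> = ennreal (sum h ?I * C)"
    using C0 h_pos by (subst sum_ennreal) (simp_all add: less_imp_le sum_distrib_right)
  also have "\<dots> \<le> ennreal ((T + h 0) * C)"
  proof (intro ennreal_leI mult_right_mono C0)
    have "sum h ?I = grid n (Suc (idx n T))" by (simp add: grid_def atLeastLessThanSuc_atLeastAtMost)
    also have "\<dots> = grid n (idx n T) + h (idx n T)" by (rule grid_Suc[OF idx_ge[OF n]])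
    also have "\<dots> \<le> T + h 0" by (rule add_mono[OF idx_lower[OF n T] h_le])
    finally show "sum h ?I \<le> T + h 0" .
  qed
  finally show ?thesis .
qed

text \<open>
  Four bad events, each of probability at most \<open>\<epsilon> / 4\<close>: a large starting value, a large energy,
  crowded resets and a late reset. Outside of them the path lies in a set of the compact class.
\<close>

theorem interpolated_processes_tight:
  assumes T: "0 < T"
  shows "tight_random_elements M (skorokhod_topology T)
    (\<lambda>n w. restrict (\<lambda>t. vbar n t w) {0..T}) {1..}"
proof (rule tight_random_elementsI)
  interpret S: Metric_space "cadlag_paths T :: (real \<Rightarrow> real ^ 'd) set" "skorokhod_dist T"
    by (rule Metric_space_skorokhod[OF T])
  show "prob_space M" by (rule sample.prob_space_axioms)
  show "Hausdorff_space (skorokhod_topology T :: (real \<Rightarrow> real ^ 'd) topology)"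
    unfolding skorokhod_topology_def by (rule S.Hausdorff_space_mtopology)
  have path_eq: "restrict (\<lambda>t. vbar n t w) {0..T} = restrict (path (\<lambda>k. vcheck k w) (\<lambda>k. slope k w) n) {0..T}"
    if "1 \<le> n" for n w
    using vbar_eq_path[OF that] by simp
  show "(\<lambda>w. restrict (\<lambda>t. vbar n t w) {0..T}) \<in> M \<rightarrow>\<^sub>M borel_sigma (skorokhod_topology T)" if "n \<in> {1..}" for n
  proof -
    have n: "1 \<le> n" using that by simp
    show ?thesis
      unfolding path_eq[OF n] using n
      by (intro measurable_path n T borel_measurable_vcheck borel_measurable_slope) auto
  qed
  fix \<epsilon> :: real assume \<epsilon>: "0 < \<epsilon>"
  obtain V where V0: "0 \<le> V"
    and V: "\<And>n. 1 \<le> n \<Longrightarrow> (\<integral>\<^sup>+w. ennreal ((norm (vcheck n w))\<^sup>2) \<partial>M) \<le> ennreal V"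
    using vcheck_second_moment_bounded by blast
  obtain B where B0: "0 \<le> B"
    and B: "\<And>n. 1 \<le> n \<Longrightarrow> (\<integral>\<^sup>+w. ennreal ((norm (slope n w))\<^sup>2) \<partial>M) \<le> ennreal B"
    using slope_second_moment_bounded by blast
  obtain d where d: "0 < d" "\<And>n \<delta>. 1 \<le> n \<Longrightarrow> \<delta> \<le> d \<Longrightarrow> sample.prob (late_reset n T \<delta>) \<le> \<epsilon> / 4"
    using prob_late_reset_small[OF T, of "\<epsilon> / 4"] \<epsilon> by auto
  define q where "q = \<gamma> + \<gamma>\<^sup>2 * T"
  have q: "0 < q" using gamma_pos T by (simp add: q_def add_pos_pos)
  \<comment> \<open>Markov's inequality fixes both constants; the summand 1 makes them
    positive.\<close>
  define R where "R = sqrt (4 * V / \<epsilon> + 1)"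
  define C where "C = sqrt (4 * ((T + h 0) * B) / \<epsilon> + 1)"
  have TB: "0 \<le> (T + h 0) * B" using T h_pos[of 0] B0 by simp
  have R: "0 < R" "R\<^sup>2 = 4 * V / \<epsilon> + 1"
    unfolding R_def using V0 \<epsilon> by (simp_all add: add_nonneg_pos)
  have C: "0 < C" "C\<^sup>2 = 4 * ((T + h 0) * B) / \<epsilon> + 1"
    unfolding C_def using TB \<epsilon> by (simp_all add: add_nonneg_pos)
  define \<delta> where "\<delta> = min T (min d (\<epsilon> / 4 / q))"
  have \<delta>: "0 < \<delta>" "\<delta> \<le> T" "\<delta> \<le> d" "\<delta> \<le> \<epsilon> / 4 / q"
    using T d(1) \<epsilon> q by (simp_all add: \<delta>_def)
  let ?K = "holder_step_paths T \<delta> (R + C * sqrt T) C :: (real \<Rightarrow> real ^ 'd) set"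
  show "\<exists>K. compactin (skorokhod_topology T) K \<and> (\<forall>n\<in>{1..}. \<exists>Bad\<in>sets M. measure M Bad \<le> \<epsilon> \<and>
      (\<forall>w\<in>space M - Bad. restrict (\<lambda>t. vbar n t w) {0..T} \<in> K))"
  proof (intro exI[of _ ?K] conjI ballI)
    show "compactin (skorokhod_topology T) ?K"
      using T \<delta>(1) C(1) by (intro compactin_holder_step_paths) auto
    fix n :: nat assume "n \<in> {1..}"
    then have n: "1 \<le> n" by simp
    define energy where "energy w = (\<Sum>k=n..idx n T. h k * (norm (slope k w))\<^sup>2)" for w
    define Bad1 where "Bad1 = {w \<in> space M. R\<^sup>2 < (norm (vcheck n w))\<^sup>2}"
    define Bad2 where "Bad2 = {w \<in> space M. C\<^sup>2 < energy w}"
    have v: "(\<lambda>w. (norm (vcheck n w))\<^sup>2) \<in> borel_measurable M" using borel_measurable_vcheck[OF n] by simp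
    have e: "energy \<in> borel_measurable M"
      unfolding energy_def[abs_def] using borel_measurable_slope n
      by (intro borel_measurable_sum borel_measurable_times borel_measurable_const borel_measurable_power
          borel_measurable_norm) auto
    have sets: "Bad1 \<in> sets M" "Bad2 \<in> sets M" "crowded_resets n T \<delta> \<in> sets M" "late_reset n T \<delta> \<in> sets M"
      unfolding Bad1_def Bad2_def using v e prob_crowded_resets_le(1)[OF n T \<delta>(1)] sets_late_reset[OF n] by measurable
    have "sample.prob Bad1 \<le> \<epsilon> / 4"
      unfolding Bad1_def
      by (rule sample.prob_greater_le_of_nn_integral[OF v V[OF n] V0])
        (use R \<epsilon> in \<open>simp_all add: field_simps\<close>)
    moreover have "sample.prob Bad2 \<le> \<epsilon> / 4"
      unfolding Bad2_def
      by (rule sample.prob_greater_le_of_nn_integral[OF e energy_le[OF n less_imp_le[OF T] B0 B, folded energy_def] TB])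
        (use C \<epsilon> in \<open>simp_all add: field_simps\<close>)
    moreover have "sample.prob (crowded_resets n T \<delta>) \<le> \<epsilon> / 4"
    proof -
      have "q * \<delta> \<le> \<epsilon> / 4" using \<delta>(4) q by (simp add: field_simps)
      then show ?thesis using prob_crowded_resets_le(2)[OF n T \<delta>(1)] by (simp add: q_def)
    qed
    moreover have "sample.prob (late_reset n T \<delta>) \<le> \<epsilon> / 4" using d(2)[OF n \<delta>(3)] .
    moreover have "sample.prob ((Bad1 \<union> Bad2) \<union> (crowded_resets n T \<delta> \<union> late_reset n T \<delta>))
        \<le> (sample.prob Bad1 + sample.prob Bad2) + (sample.prob (crowded_resets n T \<delta>) + sample.prob (late_reset n T \<delta>))"
      using sets by (intro order_trans[OF measure_Un_le] add_mono measure_Un_le sets.Un)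
    ultimately have prob: "sample.prob ((Bad1 \<union> Bad2) \<union> (crowded_resets n T \<delta> \<union> late_reset n T \<delta>)) \<le> \<epsilon>" by linarith
    have good: "restrict (\<lambda>t. vbar n t w) {0..T} \<in> ?K"
      if w: "w \<in> space M - ((Bad1 \<union> Bad2) \<union> (crowded_resets n T \<delta> \<union> late_reset n T \<delta>))" for w
      unfolding path_eq[OF n]
    proof (rule path_in_holder_step_paths[OF n T \<delta>(1) less_imp_le[OF C(1)]])
      show "vcheck (Suc k) w = (if \<omega> k w then 0 else vcheck k w - h k *\<^sub>R slope k w)" if "n \<le> k" for k
        using that n by (intro vcheck_Suc_slope) simp
      show "(\<Sum>k=n..idx n T. h k * (norm (slope k w))\<^sup>2) \<le> C\<^sup>2"
        using w by (auto simp: Bad2_def energy_def)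
      have "(norm (vcheck n w))\<^sup>2 \<le> R\<^sup>2" using w by (auto simp: Bad1_def)
      then show "norm (vcheck n w) \<le> R" using R(1) by (intro power2_le_imp_le[of "norm (vcheck n w)"]) auto
      show "{0, T} \<union> reset_times n T w
        = {0, T} \<union> {grid n (Suc k) |k. n \<le> k \<and> \<omega> k w \<and> grid n (Suc k) < T}"
        by (simp add: reset_times_def)
      show "u + \<delta> \<le> v" if "u \<in> {0, T} \<union> reset_times n T w" "v \<in> {0, T} \<union> reset_times n T w" "u < v" for u v
        by (rule reset_times_gap[OF n T _ _ _ \<delta>(2) that]) (use w in auto)
    qed
    show "\<exists>Bad\<in>sets M. measure M Bad \<le> \<epsilon> \<and> (\<forall>w\<in>space M - Bad. restrict (\<lambda>t. vbar n t w) {0..T} \<in> ?K)"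
      using prob good sets by (intro bexI[of _ "(Bad1 \<union> Bad2) \<union> (crowded_resets n T \<delta> \<union> late_reset n T \<delta>)"] conjI ballI) auto
  qed
qed

end

theorem lemma3p1:
  fixes M :: "'w measure" and D :: "'z measure"
    and A :: "real ^ 'm ^ 'd"
    and F :: "real ^ 'd \<Rightarrow> 'z \<Rightarrow> real" and dF :: "real ^ 'd \<Rightarrow> 'z \<Rightarrow> real ^ 'd"
    and f :: "real ^ 'd \<Rightarrow> real" and df :: "real ^ 'd \<Rightarrow> real ^ 'd"
    and xstar x1 :: "real ^ 'd"
    and \<eta> p :: "nat \<Rightarrow> real" and \<alpha> \<beta> \<gamma> \<eta>0 \<mu> L :: real
    and \<zeta> :: "nat \<Rightarrow> 'w \<Rightarrow> 'z" and \<omega> :: "nat \<Rightarrow> 'w \<Rightarrow> bool"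
  assumes setting: "lpsa M D A F dF f df xstar p \<zeta> \<omega>"
    and steps: "\<eta> 0 = \<eta>0" "\<And>n. 1 \<le> n \<Longrightarrow> \<eta> n = \<eta>0 * real n powr (- \<alpha>)"
    and probs: "\<And>n. 1 \<le> n \<Longrightarrow> p n = min (\<gamma> * \<eta> n powr \<beta>) 1"
    and gamma: "0 < \<gamma>" and alpha: "0 < \<alpha>" "\<alpha> \<le> 1" and beta: "1 / 2 < \<beta>" "\<beta> < 1"
    and eta0: "0 < \<eta>0" "2 * of_bool (\<alpha> = 1) / \<mu> < \<eta>0"
    and smooth: "\<And>x y. norm (df x - df y) \<le> L * norm (x - y)"
    and strong: "0 < \<mu>" "strongly_convex \<mu> f"
    and cov_lipschitz: "\<And>x y. spectral_norm (covariance_matrix D (dF x) - covariance_matrix D (dF y))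
        \<le> L * norm (x - y)"
  shows "\<forall>T>0. tight_random_elements M (skorokhod_topology T)
    (\<lambda>n w. restrict (\<lambda>t. lpsa.vbar A dF df x1 \<eta> \<beta> \<zeta> \<omega> n t w) {0..T}) {1..}"
proof -
  interpret lpsa M D A F dF f df xstar x1 \<eta> p \<beta> \<zeta> \<omega> by (rule setting)
  interpret lpsa_regime M D A F dF f df xstar x1 \<eta> p \<beta> \<zeta> \<omega> \<alpha> \<gamma> \<eta>0 \<mu> L
    by unfold_locales (use assms in simp_all)
  show ?thesis using interpolated_processes_tight by simp
qed

end
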